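(* Let $X$ be a Banach space and let $A\subset X^*$ be arbitrary. (a) The following inclusions hold: - $\text{(I)-cl}(A)=\text{(I)-ccl}(A)\subset\text{(I)-ww}(A)\subset\operatorname{cl}_{IF}(A)\subset \text{(I)-env}(A)\cap \overline{A}^{w^*}\subset\overline{A}^{w^*}$; - $\overline{A}^{\|\cdot\|}\subset\text{(I)-mn}(A)\subset\text{(I)-cl}(A)$; - $\overline{A}^{\|\cdot\|}\subset\operatorname{cl}_{IC}(A)\subset\text{(I)-ccl}(A)$; - $\overline{A}^{\|\cdot\|}\subset\overline{A}^{\mu(X^*,C(X))}\subset\text{(I)-bcl}(A)\subset\text{(I)-cbcl}(A)\subset \overline{A}^{\sigma(X^*,B_1(X))}\subset\overline{A}^{w^*}$. (b) Assume $A$ is norm-separable. Then $$\text{(I)-ccl}(A)=\overline{A}^{\|\cdot\|},\quad \text{(I)-ww}(A)=\operatorname{cl}_{IF}(A)=\overline{A}^{w},\quad \text{(I)-env}(A)=\overline{\operatorname{conv} A}^{\|\cdot\|}.$$ (c) Assume $X$ is separable. Then $$\overline{A}^{\|\cdot\|}=\overline{A}^{\mu(X^*,C(X))},\quad \text{(I)-bcl}(A)\subset \text{(I)-mn}(A)\quad\mbox{and}\quad\text{(I)-cbcl}(A)\subset\text{(I)-ww}(A).$$ (d) Assume $X$ is a separable Banach space not containing an isomorphic copy of $\ell_1$. Then $$\text{(I)-env}(A)=\overline{\operatorname{conv} A}^{\|\cdot\|},\quad \text{(I)-cbcl}(A)=\text{(I)-ww}(A)=\operatorname{cl}_{IF}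(A)=\overline{A}^{w}.$$
   Context: Banach spaces are real or complex; $\operatorname{conv}$ is the convex hull, $\overline{A}^{\tau}$ is the closure of $A$ in the topology $\tau$, and $w$, $w^*$ are the weak topology $\sigma(X^*,X^{**})$ and the weak$^*$ topology $\sigma(X^*,X)$ on $X^*$. Put $B_1(X)=\{x^{**}\in X^{**} : \text{there is a sequence } (x_n) \text{ in } X \text{ with } x_n\to x^{**} \text{ in the weak}^*\text{ topology of } X^{**}\}$ and $C(X)=\{x^{**}\in X^{**} : \text{there is a countable } C\subset X \text{ with } x^{**}\in\overline{C}^{w^*}\}$. For a linear subspace $Z\subset X^{**}$, $\sigma(X^*,Z)$ is the weakest topology on $X^*$ making all elements of $Z$ continuous, and $\mu(X^*,Z)$ is the Mackey topology, i.e. the topology on $X^*$ of uniform convergence on absolutely convex $\sigma(Z,X^* )$-compact subsets of $Z$ ($X$ is regarded as a subspace of $X^{**}$). For $A\subset X^*$ define, where the intersections are over all countable (respectively finite) covers of $A$ by subsets of $A$: $$\text{(I)-env}(A)= \bigcap\left\{\overline{\operatorname{conv}\bigcup_{n=1}^\infty \overline{\operatorname{conv} A_n}^{w^*}}^{\|\cdot\|} : A=\bigcup_{n=1}^\infty A_n\right\},$$ $$\text{(I)-cl}(A)= \bigcap\left\{\overline{\bigcup_{n=1}^\infty \overline{A_n}^{w^*}}^{\|\cdot\|} : A=\bigcup_{n=1}^\infty A_n\right\},\quad \text{(I)-ccl}(A)= \bigcap\left\{\overline{\bigcup_{n=1}^\infty \overline{\operatorname{conv} A_n}^{w^*}}^{\|\cdot\|}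 : A=\bigcup_{n=1}^\infty A_n\right\},$$ $$\text{(I)-mn}(A)= \bigcap\left\{\overline{\bigcup_{n=1}^\infty \overline{A_n}^{\mu(X^*,X)}}^{\|\cdot\|} : A=\bigcup_{n=1}^\infty A_n\right\},\quad \text{(I)-ww}(A)= \bigcap\left\{\overline{\bigcup_{n=1}^\infty \overline{\operatorname{conv} A_n}^{w^*}}^{w} : A=\bigcup_{n=1}^\infty A_n\right\},$$ $$\operatorname{cl}_{IF}(A)=\bigcap\left\{\bigcup_{j=1}^n \text{(I)-env}(A_j) : A=\bigcup_{j=1}^n A_j,\ n\in\mathbb{N}\right\},\quad \operatorname{cl}_{IC}(A)=\bigcap\left\{\overline{\bigcup_{n=1}^\infty \text{(I)-env}(A_n)}^{\|\cdot\|} : A=\bigcup_{n=1}^\infty A_n\right\},$$ $$\text{(I)-bcl}(A)= \bigcap\left\{\overline{\bigcup_{n=1}^\infty \overline{A_n}^{\mu(X^*,B_1(X))}}^{\mu(X^*,C(X))} : A=\bigcup_{n=1}^\infty A_n\right\},$$ $$\text{(I)-cbcl}(A)= \bigcap\left\{\overline{\bigcup_{n=1}^\infty \overline{\operatorname{conv} A_n}^{\sigma(X^*,B_1(X))}}^{\sigma(X^*,C(X))} : A=\bigcup_{n=1}^\infty A_n\right\}.$$ *)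

theory Defs
  imports "HOL-Analysis.Analysis"
begin

section \<open>Real and complex Banach spaces\<close>

text \<open>
  The library class \<^class>\<open>banach\<close> only provides real scalars. Real and complex spaces are treated
  simultaneously: the scalars form a normed field that is \<open>\<real>\<close> or \<open>\<complex>\<close>, and a Banach space over it is
  a type of class \<^class>\<open>banach\<close> with a scalar multiplication \<open>sc\<close> compatible with the norm and with
  the real structure. A multiplicative norm on \<open>\<complex>\<close> extending the absolute value of \<open>\<real>\<close> is
  the usual modulus, so nothing beyond the two intended fields satisfies the class axiom.
\<close>

class real_or_complex = real_normed_field +
  assumes real_or_complex:
    "(\<forall>z. \<exists>a. z = a *\<^sub>R 1) \<or>
     (\<exists>i. i * i = - 1 \<and> (\<forall>z. \<exists>a b. z = a *\<^sub>R 1 + b *\<^sub>R i))"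

instance real :: real_or_complex
proof
  show "(\<forall>z::real. \<exists>a. z = a *\<^sub>R 1) \<or>
     (\<exists>i::real. i * i = - 1 \<and> (\<forall>z. \<exists>a b. z = a *\<^sub>R 1 + b *\<^sub>R i))"
    by simp
qed

instance complex :: real_or_complex
proof
  have "z = Re z *\<^sub>R 1 + Im z *\<^sub>R \<i>" for z :: complex
    by (simp add: complex_eq_iff)
  then have "\<exists>i::complex. i * i = - 1 \<and> (\<forall>z. \<exists>a b. z = a *\<^sub>R 1 + b *\<^sub>R i)"
    by (intro exI[of _ "\<i>"]) (simp, blast)
  then show "(\<forall>z::complex. \<exists>a. z = a *\<^sub>R 1) \<or>
     (\<exists>i::complex. i * i = - 1 \<and> (\<forall>z. \<exists>a b. z = a *\<^sub>R 1 + b *\<^sub>R i))" ..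
qed

definition banach_over :: "('k::real_or_complex \<Rightarrow> 'a::banach \<Rightarrow> 'a) \<Rightarrow> bool" where
  "banach_over sc \<longleftrightarrow> vector_space sc \<and>
     (\<forall>c x. norm (sc c x) = norm c * norm x) \<and> (\<forall>r x. sc (of_real r) x = r *\<^sub>R x)"

text \<open>
  \<open>X\<^sup>*\<close> is the set of scalar-linear functionals among the bounded real-linear maps into the
  scalars; the norm is the operator norm of the ambient type, in which \<open>X\<^sup>*\<close> is a closed subspace,
  so that \<^const>\<open>closure\<close> is the norm closure in \<open>X\<^sup>*\<close>.
\<close>

definition dual_space ::
  "('k::real_or_complex \<Rightarrow> 'a::banach \<Rightarrow> 'a) \<Rightarrow> ('a \<Rightarrow>\<^sub>L 'k) set" where
  "dual_space sc = {f. \<forall>c x. blinfun_apply f (sc c x) = c * blinfun_apply f x}"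

text \<open>
  Elements of \<open>X\<^sup>*\<^sup>*\<close> are functionals on \<open>X\<^sup>*\<close>, extended by \<open>0\<close> to the ambient type so that
  each of them is represented by exactly one function. The product of \<open>c\<close> and \<open>f \<in> X\<^sup>*\<close> is
  \<open>blinfun_mult_right c o\<^sub>L f\<close>.
\<close>

definition bidual_space ::
  "('k::real_or_complex \<Rightarrow> 'a::banach \<Rightarrow> 'a) \<Rightarrow> (('a \<Rightarrow>\<^sub>L 'k) \<Rightarrow> 'k) set" where
  "bidual_space sc = {\<phi>.
     (\<forall>f. f \<notin> dual_space sc \<longrightarrow> \<phi> f = 0) \<and>
     (\<forall>f\<in>dual_space sc. \<forall>g\<in>dual_space sc. \<phi> (f + g) = \<phi> f + \<phi> g) \<and>
     (\<forall>c. \<forall>f\<in>dual_space sc. \<phi> (blinfun_mult_right c o\<^sub>L f) = c * \<phi> f) \<and>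
     (\<exists>M. \<forall>f\<in>dual_space sc. norm (\<phi> f) \<le> M * norm f)}"

definition canonical_embedding ::
  "('k::real_or_complex \<Rightarrow> 'a::banach \<Rightarrow> 'a) \<Rightarrow> 'a \<Rightarrow> ('a \<Rightarrow>\<^sub>L 'k) \<Rightarrow> 'k" where
  "canonical_embedding sc x = (\<lambda>f. if f \<in> dual_space sc then blinfun_apply f x else 0)"

lemma banach_over_real: "banach_over (scaleR :: real \<Rightarrow> 'a::banach \<Rightarrow> 'a)"
  unfolding banach_over_def
  by (auto intro!: vector_space.intro simp: algebra_simps)

lemma banach_over_complex: "banach_over ((*) :: complex \<Rightarrow> complex \<Rightarrow> complex)"
  unfolding banach_over_def
  by (auto intro!: vector_space.intro simp: algebra_simps norm_mult scaleR_conv_of_real)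

lemma dual_space_real: "dual_space (scaleR :: real \<Rightarrow> 'a::banach \<Rightarrow> 'a) = UNIV"
  by (auto simp: dual_space_def blinfun.scaleR_right)

section \<open>Topologies\<close>

text \<open>The weakest topology on \<open>S\<close> making all members of \<open>F\<close> continuous.\<close>

definition initial_topology :: "'b set \<Rightarrow> ('b \<Rightarrow> 'k::topological_space) set \<Rightarrow> 'b topology" where
  "initial_topology S F =
     topology_generated_by (insert S {S \<inter> \<phi> -` U | \<phi> U. \<phi> \<in> F \<and> open U})"

lemma topspace_initial_topology [simp]: "topspace (initial_topology S F) = S"
  unfolding initial_topology_def topology_generated_by_topspace by auto

text \<open>
  Uniform convergence on the members of a family \<open>\<KK>\<close> of sets of functions on \<open>S\<close>.
  Finite subfamilies occur because \<open>\<KK>\<close> is not required to be directed.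
\<close>

definition uniform_convergence_topology ::
  "'b set \<Rightarrow> ('b \<Rightarrow> 'k::real_normed_vector) set set \<Rightarrow> 'b topology" where
  "uniform_convergence_topology S \<KK> = topology (\<lambda>U. U \<subseteq> S \<and>
     (\<forall>f\<in>U. \<exists>\<FF> e. finite \<FF> \<and> \<FF> \<subseteq> \<KK> \<and> 0 < e \<and>
        {g\<in>S. \<forall>K\<in>\<FF>. \<forall>\<phi>\<in>K. norm (\<phi> g - \<phi> f) < e} \<subseteq> U))"

lemma openin_uniform_convergence_topology:
  fixes \<KK> :: "('b \<Rightarrow> 'k::real_normed_vector) set set"
  shows "openin (uniform_convergence_topology S \<KK>) U \<longleftrightarrow> U \<subseteq> S \<and>
     (\<forall>f\<in>U. \<exists>\<FF> e. finite \<FF> \<and> \<FF> \<subseteq> \<KK> \<and> 0 < e \<and>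
        {g\<in>S. \<forall>K\<in>\<FF>. \<forall>\<phi>\<in>K. norm (\<phi> g - \<phi> f) < e} \<subseteq> U)"
proof -
  define N where "N = (\<lambda>(\<FF> :: ('b \<Rightarrow> 'k) set set) e f. {g\<in>S. \<forall>K\<in>\<FF>. \<forall>\<phi>\<in>K. norm (\<phi> g - \<phi> f) < e})"
  define P where "P = (\<lambda>f U. \<exists>\<FF> e. finite \<FF> \<and> \<FF> \<subseteq> \<KK> \<and> 0 < e \<and> N \<FF> e f \<subseteq> U)"
  have mono: "N \<GG> d f \<subseteq> N \<FF> e f" if "\<FF> \<subseteq> \<GG>" "d \<le> e" for \<FF> \<GG> d e f
    using that unfolding N_def by fastforce
  have inter: "P f (U \<inter> V)" if U: "P f U" and V: "P f V" for f U V
  proof -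
    from U obtain \<FF> d where 1: "finite \<FF>" "\<FF> \<subseteq> \<KK>" "0 < d" "N \<FF> d f \<subseteq> U"
      unfolding P_def by (elim exE conjE)
    from V obtain \<GG> e where 2: "finite \<GG>" "\<GG> \<subseteq> \<KK>" "0 < e" "N \<GG> e f \<subseteq> V"
      unfolding P_def by (elim exE conjE)
    have "N (\<FF> \<union> \<GG>) (min d e) f \<subseteq> N \<FF> d f" "N (\<FF> \<union> \<GG>) (min d e) f \<subseteq> N \<GG> e f"
      by (rule mono; simp)+
    with 1(4) 2(4) have "N (\<FF> \<union> \<GG>) (min d e) f \<subseteq> U \<inter> V" by blast
    moreover have "finite (\<FF> \<union> \<GG>)" "\<FF> \<union> \<GG> \<subseteq> \<KK>" "0 < min d e"
      using 1(1-3) 2(1-3) by simp_all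
    ultimately show ?thesis unfolding P_def by blast
  qed
  have P_mono: "P f V" if "P f U" "U \<subseteq> V" for f U V
    using that unfolding P_def by (meson subset_trans)
  have top: "istopology (\<lambda>U. U \<subseteq> S \<and> (\<forall>f\<in>U. P f U))"
    unfolding istopology_def
  proof (intro conjI allI impI)
    fix U V assume "U \<subseteq> S \<and> (\<forall>f\<in>U. P f U)" "V \<subseteq> S \<and> (\<forall>f\<in>V. P f V)"
    then show "U \<inter> V \<subseteq> S" "\<forall>f\<in>U \<inter> V. P f (U \<inter> V)"
      using inter by blast+
  next
    fix \<U> assume "\<forall>U\<in>\<U>. U \<subseteq> S \<and> (\<forall>f\<in>U. P f U)"
    then show "\<Union>\<U> \<subseteq> S" "\<forall>f\<in>\<Union>\<U>. P f (\<Union>\<U>)"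
      using P_mono by (blast, meson UnionE Union_upper)
  qed
  have "uniform_convergence_topology S \<KK> = topology (\<lambda>U. U \<subseteq> S \<and> (\<forall>f\<in>U. P f U))"
    by (simp only: uniform_convergence_topology_def P_def N_def)
  also have "openin \<dots> = (\<lambda>U. U \<subseteq> S \<and> (\<forall>f\<in>U. P f U))"
    by (rule topology_inverse'[OF top])
  finally have "openin (uniform_convergence_topology S \<KK>) = (\<lambda>U. U \<subseteq> S \<and> (\<forall>f\<in>U. P f U))" .
  from fun_cong[OF this, of U] show ?thesis
    unfolding P_def N_def .
qed

lemma topspace_uniform_convergence_topology [simp]:
  "topspace (uniform_convergence_topology S \<KK>) = S"
proof
  show "topspace (uniform_convergence_topology S \<KK>) \<subseteq> S"
    using openin_topspace[of "uniform_convergence_topology S \<KK>"]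
    unfolding openin_uniform_convergence_topology by (rule conjunct1)
  have "openin (uniform_convergence_topology S \<KK>) S"
    unfolding openin_uniform_convergence_topology
    by (intro conjI ballI subset_refl exI[of _ "{}"] exI[of _ "1::real"]) auto
  then show "S \<subseteq> topspace (uniform_convergence_topology S \<KK>)"
    by (rule openin_subset)
qed

definition absolutely_convex :: "('b \<Rightarrow> 'k::real_or_complex) set \<Rightarrow> bool" where
  "absolutely_convex K \<longleftrightarrow>
     (\<forall>\<phi>\<in>K. \<forall>\<psi>\<in>K. \<forall>a b. norm a + norm b \<le> 1 \<longrightarrow> (\<lambda>f. a * \<phi> f + b * \<psi> f) \<in> K)"

text \<open>\<open>\<sigma>(X\<^sup>*, Z)\<close>, \<open>\<sigma>(Z, X\<^sup>*)\<close> and \<open>\<mu>(X\<^sup>*, Z)\<close> for a subspace \<open>Z\<close> of \<open>X\<^sup>*\<^sup>*\<close>\<close>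

definition sigma_dual ::
  "('k::real_or_complex \<Rightarrow> 'a::banach \<Rightarrow> 'a) \<Rightarrow> (('a \<Rightarrow>\<^sub>L 'k) \<Rightarrow> 'k) set \<Rightarrow> ('a \<Rightarrow>\<^sub>L 'k) topology" where
  "sigma_dual sc Z = initial_topology (dual_space sc) Z"

definition sigma_bidual ::
  "('k::real_or_complex \<Rightarrow> 'a::banach \<Rightarrow> 'a) \<Rightarrow> (('a \<Rightarrow>\<^sub>L 'k) \<Rightarrow> 'k) set \<Rightarrow>
   (('a \<Rightarrow>\<^sub>L 'k) \<Rightarrow> 'k) topology" where
  "sigma_bidual sc Z = initial_topology Z ((\<lambda>f \<phi>. \<phi> f) ` dual_space sc)"

definition mackey ::
  "('k::real_or_complex \<Rightarrow> 'a::banach \<Rightarrow> 'a) \<Rightarrow> (('a \<Rightarrow>\<^sub>L 'k) \<Rightarrow> 'k) set \<Rightarrow> ('a \<Rightarrow>\<^sub>L 'k) topology" where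
  "mackey sc Z = uniform_convergence_topology (dual_space sc)
     {K. K \<subseteq> Z \<and> absolutely_convex K \<and> compactin (sigma_bidual sc Z) K}"

definition embedded_space ::
  "('k::real_or_complex \<Rightarrow> 'a::banach \<Rightarrow> 'a) \<Rightarrow> (('a \<Rightarrow>\<^sub>L 'k) \<Rightarrow> 'k) set" where
  "embedded_space sc = range (canonical_embedding sc)"

definition weak_star ::
  "('k::real_or_complex \<Rightarrow> 'a::banach \<Rightarrow> 'a) \<Rightarrow> ('a \<Rightarrow>\<^sub>L 'k) topology" where
  "weak_star sc = sigma_dual sc (embedded_space sc)"

definition weak ::
  "('k::real_or_complex \<Rightarrow> 'a::banach \<Rightarrow> 'a) \<Rightarrow> ('a \<Rightarrow>\<^sub>L 'k) topology" where
  "weak sc = sigma_dual sc (bidual_space sc)"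

definition weak_star_bidual ::
  "('k::real_or_complex \<Rightarrow> 'a::banach \<Rightarrow> 'a) \<Rightarrow> (('a \<Rightarrow>\<^sub>L 'k) \<Rightarrow> 'k) topology" where
  "weak_star_bidual sc = sigma_bidual sc (bidual_space sc)"

definition B1_set ::
  "('k::real_or_complex \<Rightarrow> 'a::banach \<Rightarrow> 'a) \<Rightarrow> (('a \<Rightarrow>\<^sub>L 'k) \<Rightarrow> 'k) set" where
  "B1_set sc = {\<phi> \<in> bidual_space sc. \<exists>x :: nat \<Rightarrow> 'a.
     limitin (weak_star_bidual sc) (\<lambda>n. canonical_embedding sc (x n)) \<phi> sequentially}"

definition C_set ::
  "('k::real_or_complex \<Rightarrow> 'a::banach \<Rightarrow> 'a) \<Rightarrow> (('a \<Rightarrow>\<^sub>L 'k) \<Rightarrow> 'k) set" where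
  "C_set sc = {\<phi> \<in> bidual_space sc. \<exists>C :: 'a set. countable C \<and>
     \<phi> \<in> weak_star_bidual sc closure_of (canonical_embedding sc ` C)}"

section \<open>Envelopes and closures\<close>

definition I_env ::
  "('k::real_or_complex \<Rightarrow> 'a::banach \<Rightarrow> 'a) \<Rightarrow> ('a \<Rightarrow>\<^sub>L 'k) set \<Rightarrow> ('a \<Rightarrow>\<^sub>L 'k) set" where
  "I_env sc A = \<Inter> {closure (convex hull (\<Union>n. weak_star sc closure_of (convex hull (E n)))) | E.
     A = (\<Union>n::nat. E n)}"

definition I_cl ::
  "('k::real_or_complex \<Rightarrow> 'a::banach \<Rightarrow> 'a) \<Rightarrow> ('a \<Rightarrow>\<^sub>L 'k) set \<Rightarrow> ('a \<Rightarrow>\<^sub>L 'k) set" where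
  "I_cl sc A = \<Inter> {closure (\<Union>n. weak_star sc closure_of (E n)) | E. A = (\<Union>n::nat. E n)}"

definition I_ccl ::
  "('k::real_or_complex \<Rightarrow> 'a::banach \<Rightarrow> 'a) \<Rightarrow> ('a \<Rightarrow>\<^sub>L 'k) set \<Rightarrow> ('a \<Rightarrow>\<^sub>L 'k) set" where
  "I_ccl sc A = \<Inter> {closure (\<Union>n. weak_star sc closure_of (convex hull (E n))) | E.
     A = (\<Union>n::nat. E n)}"

definition I_mn ::
  "('k::real_or_complex \<Rightarrow> 'a::banach \<Rightarrow> 'a) \<Rightarrow> ('a \<Rightarrow>\<^sub>L 'k) set \<Rightarrow> ('a \<Rightarrow>\<^sub>L 'k) set" where
  "I_mn sc A = \<Inter> {closure (\<Union>n. mackey sc (embedded_space sc) closure_of (E n)) | E.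
     A = (\<Union>n::nat. E n)}"

definition I_ww ::
  "('k::real_or_complex \<Rightarrow> 'a::banach \<Rightarrow> 'a) \<Rightarrow> ('a \<Rightarrow>\<^sub>L 'k) set \<Rightarrow> ('a \<Rightarrow>\<^sub>L 'k) set" where
  "I_ww sc A = \<Inter> {weak sc closure_of (\<Union>n. weak_star sc closure_of (convex hull (E n))) | E.
     A = (\<Union>n::nat. E n)}"

definition cl_IF ::
  "('k::real_or_complex \<Rightarrow> 'a::banach \<Rightarrow> 'a) \<Rightarrow> ('a \<Rightarrow>\<^sub>L 'k) set \<Rightarrow> ('a \<Rightarrow>\<^sub>L 'k) set" where
  "cl_IF sc A = \<Inter> {(\<Union>j\<in>{1..n}. I_env sc (E j)) | (n::nat) E. 1 \<le> n \<and> A = (\<Union>j\<in>{1..n}. E j)}"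

definition cl_IC ::
  "('k::real_or_complex \<Rightarrow> 'a::banach \<Rightarrow> 'a) \<Rightarrow> ('a \<Rightarrow>\<^sub>L 'k) set \<Rightarrow> ('a \<Rightarrow>\<^sub>L 'k) set" where
  "cl_IC sc A = \<Inter> {closure (\<Union>n. I_env sc (E n)) | E. A = (\<Union>n::nat. E n)}"

definition I_bcl ::
  "('k::real_or_complex \<Rightarrow> 'a::banach \<Rightarrow> 'a) \<Rightarrow> ('a \<Rightarrow>\<^sub>L 'k) set \<Rightarrow> ('a \<Rightarrow>\<^sub>L 'k) set" where
  "I_bcl sc A = \<Inter> {mackey sc (C_set sc) closure_of
       (\<Union>n. mackey sc (B1_set sc) closure_of (E n)) | E. A = (\<Union>n::nat. E n)}"

definition I_cbcl ::
  "('k::real_or_complex \<Rightarrow> 'a::banach \<Rightarrow> 'a) \<Rightarrow> ('a \<Rightarrow>\<^sub>L 'k) set \<Rightarrow> ('a \<Rightarrow>\<^sub>L 'k) set" where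
  "I_cbcl sc A = \<Inter> {sigma_dual sc (C_set sc) closure_of
       (\<Union>n. sigma_dual sc (B1_set sc) closure_of (convex hull (E n))) | E. A = (\<Union>n::nat. E n)}"

section \<open>Copies of \<open>\<ell>\<^sub>1\<close>\<close>

definition l1_space :: "(nat \<Rightarrow> 'k::real_or_complex) set" where
  "l1_space = {a. summable (\<lambda>n. norm (a n))}"

definition l1_norm :: "(nat \<Rightarrow> 'k::real_or_complex) \<Rightarrow> real" where
  "l1_norm a = (\<Sum>n. norm (a n))"

text \<open>\<open>T\<close> is an isomorphism of \<open>\<ell>\<^sub>1\<close> (over the same scalars) onto a subspace of \<open>X\<close>.\<close>

definition contains_l1 :: "('k::real_or_complex \<Rightarrow> 'a::banach \<Rightarrow> 'a) \<Rightarrow> bool" where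
  "contains_l1 sc \<longleftrightarrow> (\<exists>T :: (nat \<Rightarrow> 'k) \<Rightarrow> 'a.
     (\<forall>a\<in>l1_space. \<forall>b\<in>l1_space. T (\<lambda>n. a n + b n) = T a + T b) \<and>
     (\<forall>c. \<forall>a\<in>l1_space. T (\<lambda>n. c * a n) = sc c (T a)) \<and>
     (\<exists>m M. 0 < m \<and> (\<forall>a\<in>l1_space.
        m * l1_norm a \<le> norm (T a) \<and> norm (T a) \<le> M * l1_norm a)))"

end

theory Submission
  imports Defs
begin

text \<open>
  All the inclusions come from one device: convexification is harmless for a set that lies in a
  halfspace, and countable covers allow a set to be cut into pieces that do. Three cuts are used.

  \<^item> A point outside the \<open>\<sigma>(X\<^sup>*, Z)\<close>-closure of \<open>A\<close> is separated from \<open>A\<close> by finitely many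
    halfspaces given by \<open>Z\<close> (\<open>finite_halfspace_cover\<close>). For \<open>Z = X\<close>, \<open>Z = B\<^sub>1(X)\<close> and
    \<open>Z = X\<^sup>*\<^sup>*\<close> this bounds \<open>cl_IF\<close> and \<open>I_cbcl\<close> from above by closures of \<open>A\<close>
    itself.
  \<^item> A bounded set whose weak-star closure has positive distance from \<open>f\<close> is covered by finitely many
    weak-star closed halfspaces at positive distance from \<open>f\<close>, by weak-star compactness and the
    definition of the dual norm (\<open>weak_star_finite_halfspace_cover\<close>). Hence \<open>I_ccl\<close> is no larger
    than \<open>I_cl\<close>.
  \<^item> A norm-separable set is cut into countably many pieces of small balls, and balls of \<open>X\<^sup>*\<close> are
    weak-star closed and convex (\<open>norm_separable_small_pieces\<close>).

  The inclusion of \<open>I_ww\<close> in \<open>cl_IF\<close> is Mazur's theorem. The inclusions of norm closures in Mackey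
  closures are the uniform boundedness principle, and the Mackey topologies are compared by comparing
  the compact sets that define them. If \<open>X\<close> is separable, then \<open>C(X) = X\<^sup>*\<^sup>*\<close> by Helly's theorem, and the
  unit ball of \<open>X\<^sup>*\<^sup>*\<close> is compact, so that \<open>\<mu>(X\<^sup>*, C(X))\<close> is the norm topology.

  Suppose now that \<open>X\<close> is separable without a copy of \<open>\<ell>\<^sub>1\<close>. The property of \<open>\<phi> \<in> X\<^sup>*\<^sup>*\<close> behind
  the remaining equalities is that for \<open>c < d\<close> the halfspace \<open>Re \<phi> \<le> c\<close> is a countable union of sets whose
  weak-star closed convex hulls lie in \<open>Re \<phi> \<le> d\<close> (\<open>halfspace_coverable_no_l1\<close>). It follows from the
  theorem of Odell and Rosenthal that \<open>\<phi>\<close> is the weak-star limit of a sequence in \<open>X\<close>, but it also has the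
  following direct proof. If it fails, an
  exhaustion argument leaves a bounded set none of whose relatively weak-star open parts can be covered
  in this way; each part therefore has \<open>Re \<phi> \<le> c\<close> on it and a point with \<open>Re \<phi> > d\<close> in its weak-star
  closed convex hull. Approximating \<open>\<phi>\<close> at finitely many such points by an element of \<open>X\<close> splits all
  the parts of a finite family, and a dyadic tree of splittings yields a bounded sequence in \<open>X\<close> on
  which all sign patterns occur. Over the complex numbers independence of real parts is not
  enough; a pigeonhole principle (\<open>always_hit_pigeonhole\<close>) confines the values on the two sides of all
  the splittings to two small balls, which makes the sequence equivalent to the basis of \<open>\<ell>\<^sub>1\<close> over
  either field.

  Given that covering property, a point outside the norm closed convex hull of \<open>A\<close> is separated from \<open>A\<close> by
  some \<open>\<phi>\<close>, and the cover shows that it is not in \<open>I_env A\<close>.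
\<close>

section \<open>The scalar field\<close>

text \<open>
  A second square root of \<open>- 1\<close> can only be the negative of the first, so in the complex case any
  choice of it works; in the real case there is none and the value \<open>0\<close> makes the formulas below
  collapse to the real ones, so that the two cases need not be separated.
\<close>

definition im_unit :: "'k::real_or_complex" where
  "im_unit = (if \<exists>i::'k. i * i = - 1 then SOME i. i * i = - 1 else 0)"

lemma square_neq_minus_one_of_real:
  "(of_real a * of_real a :: 'k::real_normed_field) \<noteq> - 1"
proof
  assume "(of_real a * of_real a :: 'k) = - 1"
  then have "(of_real (a * a) :: 'k) = of_real (- 1)"
    by simp
  then have "a * a = - 1"
    by (simp only: of_real_eq_iff)
  then show False
    using zero_le_square[of a] by linarith
qed

lemma im_unit_cases:
  obtains (real) "(im_unit :: 'k::real_or_complex) = 0" "\<And>z::'k. \<exists>a. z = of_real a"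
  | (complex) "(im_unit :: 'k) * im_unit = - 1"
      "\<And>z::'k. \<exists>a b. z = of_real a + of_real b * im_unit"
proof (cases "\<exists>i::'k. i * i = - 1")
  case True
  then have sq: "(im_unit :: 'k) * im_unit = - 1"
    unfolding im_unit_def by (simp add: someI_ex[of "\<lambda>i::'k. i * i = - 1"])
  from real_or_complex[where 'a = 'k] show ?thesis
  proof
    assume "\<forall>z::'k. \<exists>a. z = a *\<^sub>R 1"
    then obtain a where "(im_unit::'k) = of_real a"
      by (metis of_real_def)
    with sq show ?thesis
      using square_neq_minus_one_of_real[of a, where 'k='k] by simp
  next
    assume "\<exists>i::'k. i * i = - 1 \<and> (\<forall>z. \<exists>a b. z = a *\<^sub>R 1 + b *\<^sub>R i)"
    then obtain i :: 'k where i: "i * i = - 1" and ex: "\<And>z. \<exists>a b. z = a *\<^sub>R 1 + b *\<^sub>R i"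
      by blast
    have "(i - im_unit) * (i + im_unit) = 0"
      using i sq by (simp add: algebra_simps)
    then have "i = im_unit \<or> i = - im_unit"
      by (simp add: eq_neg_iff_add_eq_0)
    then have "\<exists>a b. z = of_real a + of_real b * im_unit" for z :: 'k
    proof
      assume "i = im_unit"
      then show ?thesis
        using ex[of z] by (simp add: scaleR_conv_of_real)
    next
      assume *: "i = - im_unit"
      obtain a b where "z = a *\<^sub>R 1 + b *\<^sub>R i"
        using ex by blast
      with * have "z = of_real a + of_real (- b) * im_unit"
        by (simp add: scaleR_conv_of_real)
      then show ?thesis
        by blast
    qed
    with sq show ?thesis
      by (rule complex)
  qed
next
  case False
  then have "(im_unit :: 'k) = 0" "\<And>z::'k. \<exists>a. z = of_real a"
    using real_or_complex[where 'a = 'k] unfolding im_unit_def of_real_def by auto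
  then show ?thesis
    by (rule real)
qed

definition of_complex :: "complex \<Rightarrow> 'k::real_or_complex" where
  "of_complex w = of_real (Re w) + of_real (Im w) * im_unit"

text \<open>
  The norm agrees with the modulus because it is multiplicative: the powers of \<open>w\<close> satisfy
  \<open>\<parallel>w\<^sup>n\<parallel> \<le> 2 |w|\<^sup>n\<close>, and taking \<open>n\<close>-th roots removes the constant. The reverse inequality
  is the same one for the inverse.
\<close>

lemma norm_of_complex:
  assumes im: "(im_unit :: 'k::real_or_complex) * im_unit = - 1"
  shows "norm (of_complex w :: 'k) = norm w"
proof -
  have mult: "of_complex (v * w) = (of_complex v * of_complex w :: 'k)" for v w
  proof -
    have "of_complex v * of_complex w = (of_real (Re v * Re w) :: 'k) + of_real (Im v * Im w) * (im_unit * im_unit)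
       + of_real (Re v * Im w + Im v * Re w) * im_unit"
      unfolding of_complex_def by (simp add: algebra_simps)
    also have "\<dots> = of_complex (v * w)"
      unfolding im of_complex_def by (simp add: algebra_simps)
    finally show ?thesis by simp
  qed
  have one: "of_complex 1 = (1::'k)"
    by (simp add: of_complex_def)
  have pow: "of_complex (w ^ n) = (of_complex w ^ n :: 'k)" for w n
    by (induction n) (simp_all add: one mult)
  have "norm (im_unit :: 'k) ^ 2 = 1"
    using im by (metis norm_minus_cancel norm_mult norm_one power2_eq_square)
  then have ni: "norm (im_unit :: 'k) = 1"
    by (simp add: power2_eq_1_iff) (smt (verit) norm_ge_zero)
  have two: "norm (of_complex w :: 'k) \<le> 2 * norm w" for w
  proof -
    have "norm (of_complex w :: 'k) \<le> \<bar>Re w\<bar> + \<bar>Im w\<bar>"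
      unfolding of_complex_def by (rule order_trans[OF norm_triangle_ineq]) (simp add: norm_mult ni)
    also have "\<dots> \<le> 2 * norm w"
      using abs_Re_le_cmod[of w] abs_Im_le_cmod[of w] by linarith
    finally show ?thesis .
  qed
  have le: "norm (of_complex w :: 'k) \<le> norm w" for w
  proof (rule ccontr)
    assume "\<not> ?thesis"
    then have gt: "norm w < norm (of_complex w :: 'k)" by simp
    have w0: "w \<noteq> 0"
      using gt by (auto simp: of_complex_def)
    define q where "q = norm (of_complex w :: 'k) / norm w"
    have "1 < q"
      using gt w0 by (simp add: q_def)
    then obtain n where n: "2 < q ^ n"
      using real_arch_pow by blast
    have "norm (of_complex w :: 'k) ^ n \<le> 2 * norm w ^ n"
      using two[of "w ^ n"] by (simp add: pow norm_power)
    then have "q ^ n \<le> 2"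
      using w0 by (simp add: q_def power_divide divide_le_eq)
    with n show False by simp
  qed
  show ?thesis
  proof (cases "w = 0")
    case True
    then show ?thesis by (simp add: of_complex_def)
  next
    case False
    then have "norm (of_complex w :: 'k) * norm (of_complex (inverse w) :: 'k) = 1"
      by (metis mult norm_mult norm_one one right_inverse)
    moreover have "norm w * norm (of_complex (inverse w) :: 'k) \<le> 1"
      using mult_left_mono[OF le[of "inverse w"], of "norm w"] False by (simp add: norm_inverse)
    ultimately have "norm w * norm (of_complex (inverse w) :: 'k)
        \<le> norm (of_complex w :: 'k) * norm (of_complex (inverse w) :: 'k)"
      by linarith
    moreover have "0 < norm (of_complex (inverse w) :: 'k)"
      using \<open>norm (of_complex w :: 'k) * norm (of_complex (inverse w) :: 'k) = 1\<close>
      by (metis mult_zero_right norm_ge_zero order_le_less zero_neq_one)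
    ultimately have "norm w \<le> norm (of_complex w :: 'k)"
      by (rule mult_right_le_imp_le)
    with le[of w] show ?thesis by simp
  qed
qed

definition re_part :: "'k::real_or_complex \<Rightarrow> real" where
  "re_part z = (THE a. \<exists>b. z = of_real a + of_real b * im_unit)"

lemma re_part_eq: "re_part (of_real a + of_real b * im_unit :: 'k::real_or_complex) = a"
  unfolding re_part_def
proof (rule the_equality)
  fix c
  assume "\<exists>d. (of_real a + of_real b * im_unit :: 'k) = of_real c + of_real d * im_unit"
  then obtain d where d: "(of_real a + of_real b * im_unit :: 'k) = of_real c + of_real d * im_unit"
    by blast
  show "c = a"
  proof (cases rule: im_unit_cases[where 'k = 'k])
    case real
    with d show ?thesis by simp
  next
    case complex
    have "norm (of_complex (Complex (a - c) (b - d)) :: 'k) = 0"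
      using d by (simp add: of_complex_def algebra_simps)
    then have "Complex (a - c) (b - d) = 0"
      by (simp add: norm_of_complex[OF complex(1)])
    then show ?thesis
      by (simp add: complex_eq_iff)
  qed
qed (rule exI, rule refl)

lemma scalar_decomp:
  obtains a b where "(z :: 'k::real_or_complex) = of_real a + of_real b * im_unit"
proof (cases rule: im_unit_cases[where 'k = 'k])
  case real
  then show ?thesis using that by force
next
  case complex
  then show ?thesis using that by blast
qed

lemma linear_re_part: "linear (re_part :: 'k::real_or_complex \<Rightarrow> real)"
proof
  fix y z :: 'k and r :: real
  obtain a b where y: "y = of_real a + of_real b * im_unit"
    by (rule scalar_decomp)
  obtain c d where z: "z = of_real c + of_real d * im_unit"
    by (rule scalar_decomp)
  have "y + z = of_real (a + c) + of_real (b + d) * im_unit"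
    by (simp add: y z algebra_simps)
  then show "re_part (y + z) = re_part y + re_part z"
    by (metis re_part_eq y z)
  have "r *\<^sub>R y = of_real (r * a) + of_real (r * b) * im_unit"
    by (simp add: y algebra_simps scaleR_conv_of_real)
  then show "re_part (r *\<^sub>R y) = r *\<^sub>R re_part y"
    by (metis re_part_eq y real_scaleR_def)
qed

lemma abs_re_part_le: "\<bar>re_part z\<bar> \<le> norm (z :: 'k::real_or_complex)"
proof -
  obtain a b where z: "z = of_real a + of_real b * im_unit"
    by (rule scalar_decomp)
  have "\<bar>a\<bar> \<le> norm z"
  proof (cases rule: im_unit_cases[where 'k = 'k])
    case real
    with z show ?thesis by simp
  next
    case complex
    have "norm z = norm (Complex a b)"
      by (simp add: z norm_of_complex[OF complex(1), symmetric] of_complex_def)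
    then show ?thesis
      using abs_Re_le_cmod[of "Complex a b"] by simp
  qed
  then show ?thesis
    by (simp add: z re_part_eq)
qed

lemma re_part_le_norm: "re_part z \<le> norm (z :: 'k::real_or_complex)"
  using abs_re_part_le[of z] by linarith

lemma bounded_linear_re_part: "bounded_linear (re_part :: 'k::real_or_complex \<Rightarrow> real)"
  by (rule bounded_linear_intro[where K = 1])
     (simp_all add: linear_add[OF linear_re_part] linear_scale[OF linear_re_part] abs_re_part_le)

lemma re_part_of_real [simp]: "re_part (of_real r :: 'k::real_or_complex) = r"
  using re_part_eq[of r 0, where 'k = 'k] by simp

lemma re_part_one [simp]: "re_part (1 :: 'k::real_or_complex) = 1"
  using re_part_of_real[of 1, where 'k = 'k] by simp

lemmas re_part_add = linear_add[OF linear_re_part]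
  and re_part_diff = linear_diff[OF linear_re_part]
  and re_part_minus = linear_neg[OF linear_re_part]
  and re_part_scaleR = linear_scale[OF linear_re_part]
  and re_part_sum = linear_sum[OF linear_re_part]
  and re_part_zero [simp] = linear_0[OF linear_re_part]

lemma re_part_of_real_mult [simp]: "re_part (of_real r * z :: 'k::real_or_complex) = r * re_part z"
  using re_part_scaleR[of r z] by (simp add: scaleR_conv_of_real)

lemma re_part_im_unit [simp]: "re_part (im_unit :: 'k::real_or_complex) = 0"
  using re_part_eq[of 0 1, where 'k = 'k] by simp

text \<open>The imaginary part of \<open>z\<close> is the real part of \<open>- i z\<close>.\<close>

lemma scalar_eq_re_parts:
  "z = of_real (re_part z) - of_real (re_part (im_unit * z)) * (im_unit :: 'k::real_or_complex)"
proof -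
  obtain a b where z: "z = of_real a + of_real b * im_unit"
    by (rule scalar_decomp)
  show ?thesis
  proof (cases rule: im_unit_cases[where 'k = 'k])
    case real
    then show ?thesis
      using z by simp
  next
    case complex
    have "im_unit * z = of_real a * im_unit + of_real b * (im_unit * im_unit)"
      by (simp add: z algebra_simps)
    also have "\<dots> = of_real (- b) + of_real a * im_unit"
      unfolding complex by simp
    finally have "re_part (im_unit * z) = - b"
      by (metis re_part_eq)
    then show ?thesis
      by (simp add: z re_part_eq)
  qed
qed

lemma norm_im_unit_le: "norm (im_unit :: 'k::real_or_complex) \<le> 1"
proof (cases rule: im_unit_cases[where 'k = 'k])
  case complex
  then have "norm (im_unit :: 'k) = norm \<i>"
    using norm_of_complex[OF complex(1), of "\<i>"] by (simp add: of_complex_def)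
  then show ?thesis by simp
qed simp

lemma norm_le_re_parts:
  "norm (z :: 'k::real_or_complex) \<le> \<bar>re_part z\<bar> + \<bar>re_part (im_unit * z)\<bar>"
proof -
  have "norm z \<le> norm (of_real (re_part z) :: 'k) + norm (of_real (re_part (im_unit * z)) * im_unit :: 'k)"
    by (subst (1) scalar_eq_re_parts[of z]) (rule norm_triangle_ineq4)
  also have "\<dots> \<le> \<bar>re_part z\<bar> + \<bar>re_part (im_unit * z)\<bar> * 1"
    unfolding norm_mult norm_of_real
    by (intro add_left_mono mult_left_mono norm_im_unit_le) auto
  finally show ?thesis by simp
qed

text \<open>
  Norms of functionals are thereby reduced to real parts, over either field.
\<close>

lemma unit_scalar_rotating:
  obtains c :: "'k::real_or_complex" where "norm c = 1" "c * z = of_real (norm z)"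
proof (cases "z = 0")
  case True
  then show ?thesis using that[of 1] by simp
next
  case False
  then show ?thesis
    using that[of "of_real (norm z) / z"] by (simp add: norm_divide)
qed

text \<open>
  The coordinates \<open>(Re z, Re (i z))\<close> transport these properties from the plane. They supply the
  compactness of bounded closed sets of scalars, the completeness of dual spaces and the
  Lindeloef property of spaces of scalar sequences.
\<close>

instance real_or_complex \<subseteq> heine_borel
proof
  fix f :: "nat \<Rightarrow> 'a"
  assume "bounded (range f)"
  then obtain M where M: "\<And>n. norm (f n) \<le> M"
    unfolding bounded_iff by auto
  define g where "g = (\<lambda>n. (re_part (f n), re_part (im_unit * f n)))"
  have "norm (g n) \<le> M + M" for n
  proof -
    have "norm (im_unit * f n) \<le> 1 * norm (f n)"
      unfolding norm_mult by (intro mult_right_mono norm_im_unit_le) auto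
    then have "\<bar>re_part (f n)\<bar> \<le> M" "\<bar>re_part (im_unit * f n)\<bar> \<le> M"
      using abs_re_part_le[of "f n"] abs_re_part_le[of "im_unit * f n"] M[of n] by linarith+
    then show ?thesis
      unfolding g_def using norm_Pair_le[of "re_part (f n)" "re_part (im_unit * f n)"] by simp
  qed
  then have "bounded (range g)"
    unfolding bounded_iff by blast
  then obtain l r where r: "strict_mono (r :: nat \<Rightarrow> nat)" and lim: "(g \<circ> r) \<longlonglongrightarrow> l"
    using bounded_imp_convergent_subsequence by blast
  define h :: "real \<times> real \<Rightarrow> 'a" where "h = (\<lambda>p. of_real (fst p) - of_real (snd p) * im_unit)"
  have "isCont h l"
    unfolding h_def by (intro continuous_intros)
  then have "(\<lambda>n. h ((g \<circ> r) n)) \<longlonglongrightarrow> h l"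
    using lim by (rule isCont_tendsto_compose)
  moreover have "h (g n) = f n" for n
    unfolding h_def g_def using scalar_eq_re_parts[of "f n"] by simp
  ultimately have "(f \<circ> r) \<longlonglongrightarrow> h l"
    by (simp add: o_def)
  with r show "\<exists>l r. strict_mono (r :: nat \<Rightarrow> nat) \<and> (f \<circ> r) \<longlonglongrightarrow> l"
    by blast
qed

instance real_or_complex \<subseteq> banach ..

instance real_or_complex \<subseteq> second_countable_topology
proof
  define h :: "real \<times> real \<Rightarrow> 'a" where "h = (\<lambda>p. of_real (fst p) - of_real (snd p) * im_unit)"
  have cont: "continuous_on UNIV h"
    unfolding h_def by (intro continuous_intros)
  have surj: "h (re_part z, re_part (im_unit * z)) = z" for z
    unfolding h_def using scalar_eq_re_parts[of z] by simp
  obtain D :: "(real \<times> real) set" where D: "countable D" "\<And>X. open X \<Longrightarrow> X \<noteq> {} \<Longrightarrow> \<exists>d\<in>D. d \<in> X"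
    using countable_dense_setE by blast
  define B where "B = (\<lambda>(d, q). ball (h d) (real_of_rat q)) ` (D \<times> UNIV)"
  have "countable B"
    unfolding B_def using D(1) by (intro countable_image countable_SIGMA) auto
  moreover have "topological_basis B"
  proof (rule topological_basisI)
    show "open b" if "b \<in> B" for b
      using that unfolding B_def by auto
  next
    fix U :: "'a set" and z
    assume "open U" "z \<in> U"
    then obtain e where e: "0 < e" "ball z e \<subseteq> U"
      using open_contains_ball by blast
    obtain q where q: "0 < real_of_rat q" "real_of_rat q < e / 2"
      using of_rat_dense[of 0 "e / 2"] e(1) by auto
    have "open (h -` ball z (real_of_rat q))"
      using cont by (simp add: open_vimage)
    moreover have "h -` ball z (real_of_rat q) \<noteq> {}"
      using surj[of z] q(1) by (metis vimageI2 centre_in_ball empty_iff)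
    ultimately obtain d where d: "d \<in> D" "h d \<in> ball z (real_of_rat q)"
      using D(2) by blast
    have "ball (h d) (real_of_rat q) \<subseteq> U"
    proof
      fix y assume "y \<in> ball (h d) (real_of_rat q)"
      then have "dist z y < e"
        using d(2) q(2) dist_triangle[of z y "h d"] by auto
      then show "y \<in> U"
        using e(2) by auto
    qed
    moreover have "z \<in> ball (h d) (real_of_rat q)"
      using d(2) by (simp add: dist_commute)
    ultimately show "\<exists>b\<in>B. z \<in> b \<and> b \<subseteq> U"
      using d(1) unfolding B_def by blast
  qed
  ultimately show "\<exists>B::'a set set. countable B \<and> open = generate_topology B"
    using topological_basis_imp_subbasis by blast
qed

section \<open>Separation of a point from a convex set\<close>

definition sublinear :: "('v::real_vector \<Rightarrow> real) \<Rightarrow> bool" where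
  "sublinear p \<longleftrightarrow> (\<forall>x y. p (x + y) \<le> p x + p y) \<and> (\<forall>t x. 0 \<le> t \<longrightarrow> p (t *\<^sub>R x) \<le> t * p x)"

lemma sublinear_add: "sublinear p \<Longrightarrow> p (x + y) \<le> p x + p y"
  by (simp add: sublinear_def)

lemma sublinear_scale_le: "sublinear p \<Longrightarrow> 0 \<le> t \<Longrightarrow> p (t *\<^sub>R x) \<le> t * p x"
  by (simp add: sublinear_def)

lemma sublinear_zero:
  assumes "sublinear p"
  shows "p 0 = 0"
proof -
  have "p 0 \<le> 0"
    using sublinear_scale_le[OF assms, of 0 0] by simp
  moreover have "p 0 \<le> p 0 + p 0"
    using sublinear_add[OF assms, of 0 0] by simp
  ultimately show ?thesis by linarith
qed

lemma sublinear_scale: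
  assumes "sublinear p" "0 \<le> t"
  shows "p (t *\<^sub>R x) = t * p x"
proof (cases "t = 0")
  case True
  then show ?thesis
    using sublinear_zero[OF assms(1)] by simp
next
  case False
  have "p x \<le> (1 / t) * p (t *\<^sub>R x)"
    using sublinear_scale_le[OF assms(1), of "1 / t" "t *\<^sub>R x"] assms(2) False by simp
  then have "t * p x \<le> p (t *\<^sub>R x)"
    using False assms(2) by (simp add: field_simps)
  with sublinear_scale_le[OF assms] show ?thesis
    by (rule antisym)
qed

lemma sublinear_neg: "sublinear p \<Longrightarrow> - p (- x) \<le> p x"
  using sublinear_add[of p x "- x"] sublinear_zero[of p] by simp

text \<open>
  The infimum of a family is sublinear although its members need not be, as soon as sums and multiples
  of members dominate further members. Infima over chains, over one real parameter and over
  \<open>[0, \<infinity>) \<times> C\<close> all have this form.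
\<close>

lemma sublinear_INF:
  fixes g :: "'i \<Rightarrow> 'v::real_vector \<Rightarrow> real"
  assumes ne: "I \<noteq> {}" and bdd: "\<And>y. bdd_below ((\<lambda>i. g i y) ` I)"
    and add: "\<And>i j x y. i \<in> I \<Longrightarrow> j \<in> I \<Longrightarrow> \<exists>k\<in>I. g k (x + y) \<le> g i x + g j y"
    and scale: "\<And>i s x. i \<in> I \<Longrightarrow> 0 \<le> s \<Longrightarrow> \<exists>k\<in>I. g k (s *\<^sub>R x) \<le> s * g i x"
  shows "sublinear (\<lambda>y. INF i\<in>I. g i y)"
proof -
  let ?p = "\<lambda>y. INF i\<in>I. g i y"
  have lower: "?p y \<le> g i y" if "i \<in> I" for i y
    using that by (rule cINF_lower[OF bdd])
  have 1: "?p (x + y) \<le> ?p x + ?p y" for x y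
  proof -
    have "?p (x + y) - g i x \<le> ?p y" if i: "i \<in> I" for i
    proof (rule cINF_greatest[OF ne])
      fix j assume "j \<in> I"
      with i obtain k where "k \<in> I" "g k (x + y) \<le> g i x + g j y"
        using add by blast
      with lower[of k "x + y"] show "?p (x + y) - g i x \<le> g j y"
        by linarith
    qed
    then have "?p (x + y) - ?p y \<le> g i x" if "i \<in> I" for i
      using that by (simp add: algebra_simps)
    then have "?p (x + y) - ?p y \<le> ?p x"
      by (rule cINF_greatest[OF ne])
    then show ?thesis by linarith
  qed
  have 2: "?p (s *\<^sub>R x) \<le> s * ?p x" if s: "0 \<le> s" for s x
  proof -
    have le: "?p (s *\<^sub>R x) \<le> s * g i x" if "i \<in> I" for i
      using scale[OF that s, of x] lower order_trans by blast
    show ?thesis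
    proof (cases "s = 0")
      case True
      then show ?thesis
        using le ne by auto
    next
      case False
      then have "?p (s *\<^sub>R x) / s \<le> ?p x"
        using le s by (intro cINF_greatest[OF ne]) (simp add: field_simps)
      then show ?thesis
        using False s by (simp add: field_simps)
    qed
  qed
  show ?thesis
    unfolding sublinear_def using 1 2 by blast
qed

text \<open>
  The Hahn-Banach theorem without partial functionals: a sublinear functional that is minimal for
  the pointwise order is already linear, because
  \<open>x \<mapsto> inf\<^sub>t (q (x + t y) - t q y)\<close> is sublinear and lies below \<open>q\<close>.
\<close>

lemma sublinear_dominates_linear:
  fixes p :: "'v::real_vector \<Rightarrow> real"
  assumes p: "sublinear p"
  obtains f where "linear f" "\<And>x. f x \<le> p x"
proof -
  define A where "A = {q :: 'v \<Rightarrow> real. sublinear q \<and> q \<le> p}"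
  define P where "P = (\<lambda>q r :: 'v \<Rightarrow> real. r \<le> q)"
  have "\<exists>m\<in>A. \<forall>a\<in>A. P m a \<longrightarrow> a = m"
  proof (rule predicate_Zorn)
    show "partial_order_on A (relation_of P A)"
      by (rule partial_order_on_relation_ofI) (auto simp: P_def)
  next
    fix C assume C: "C \<in> Chains (relation_of P A)"
    have CA: "C \<subseteq> A" and total: "\<And>q r. q \<in> C \<Longrightarrow> r \<in> C \<Longrightarrow> q \<le> r \<or> r \<le> q"
      using C unfolding Chains_def relation_of_def P_def by auto
    show "\<exists>u\<in>A. \<forall>a\<in>C. P a u"
    proof (cases "C = {}")
      case True
      then show ?thesis
        using p unfolding A_def by blast
    next
      case False
      have bdd: "bdd_below ((\<lambda>q. q y) ` C)" for y
      proof (rule bdd_belowI2)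
        fix q assume "q \<in> C"
        then have "sublinear q" "q (- y) \<le> p (- y)"
          using CA by (auto simp: A_def le_fun_def)
        then show "- p (- y) \<le> q y"
          using sublinear_neg[of q y] by linarith
      qed
      define u where "u = (\<lambda>y. INF q\<in>C. q y)"
      have "sublinear u"
        unfolding u_def
      proof (rule sublinear_INF[OF False bdd])
        fix q r and x y :: 'v
        assume qr: "q \<in> C" "r \<in> C"
        then have sub: "q (x + y) \<le> q x + q y" "r (x + y) \<le> r x + r y"
          using CA sublinear_add unfolding A_def by blast+
        from total[OF qr] show "\<exists>k\<in>C. k (x + y) \<le> q x + r y"
        proof
          assume "q \<le> r"
          then have "q y \<le> r y" by (simp add: le_fun_def)
          with sub(1) have "q (x + y) \<le> q x + r y" by linarith
          with qr(1) show ?thesis by blast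
        next
          assume "r \<le> q"
          then have "r x \<le> q x" by (simp add: le_fun_def)
          with sub(2) have "r (x + y) \<le> q x + r y" by linarith
          with qr(2) show ?thesis by blast
        qed
      next
        fix q s and x :: 'v
        assume "q \<in> C" "(0::real) \<le> s"
        then show "\<exists>k\<in>C. k (s *\<^sub>R x) \<le> s * q x"
          using CA sublinear_scale_le unfolding A_def by blast
      qed
      moreover have lower: "u \<le> q" if "q \<in> C" for q
        unfolding u_def le_fun_def using cINF_lower[OF bdd that] by blast
      moreover obtain q where "q \<in> C" "q \<le> p"
        using False CA unfolding A_def by blast
      ultimately show ?thesis
        unfolding A_def P_def using order_trans by blast
    qed
  qed
  then obtain q where q: "sublinear q" "q \<le> p" and min: "\<And>r. sublinear r \<Longrightarrow> r \<le> q \<Longrightarrow> r = q"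
    unfolding A_def P_def by (auto intro: order_trans)
  have super: "q x + q y \<le> q (x + y)" for x y
  proof -
    define g where "g = (\<lambda>t x. q (x + t *\<^sub>R y) - t * q y)"
    define r where "r = (\<lambda>x. INF t\<in>{0..}. g t x)"
    have bdd: "bdd_below ((\<lambda>t. g t x) ` {0..})" for x
    proof (rule bdd_belowI2)
      fix t :: real assume "t \<in> {0..}"
      then have "t * q y = q ((x + t *\<^sub>R y) + - x)"
        using sublinear_scale[OF q(1), of t y] by simp
      also have "\<dots> \<le> q (x + t *\<^sub>R y) + q (- x)"
        by (rule sublinear_add[OF q(1)])
      finally show "- q (- x) \<le> g t x"
        unfolding g_def by linarith
    qed
    have "sublinear r"
      unfolding r_def
    proof (rule sublinear_INF[OF _ bdd])
      fix s t :: real and x z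
      assume "s \<in> {0..}" "t \<in> {0..}"
      moreover have "g (s + t) (x + z) \<le> g s x + g t z"
        using sublinear_add[OF q(1), of "x + s *\<^sub>R y" "z + t *\<^sub>R y"]
        unfolding g_def by (simp add: algebra_simps)
      ultimately show "\<exists>k\<in>{0..}. g k (x + z) \<le> g s x + g t z"
        by (intro bexI[of _ "s + t"]) auto
    next
      fix t s :: real and x
      assume "t \<in> {0..}" "0 \<le> s"
      moreover from this have "g (s * t) (s *\<^sub>R x) \<le> s * g t x"
        using sublinear_scale_le[OF q(1), of s "x + t *\<^sub>R y"]
        unfolding g_def by (simp add: algebra_simps)
      ultimately show "\<exists>k\<in>{0..}. g k (s *\<^sub>R x) \<le> s * g t x"
        by (intro bexI[of _ "s * t"]) auto
    qed simp
    have lower: "r x \<le> g t x" if "0 \<le> t" for t x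
      unfolding r_def using that by (intro cINF_lower[OF bdd]) auto
    then have "r \<le> q"
      unfolding le_fun_def using lower[of 0] by (simp add: g_def)
    with \<open>sublinear r\<close> have "r = q"
      by (rule min)
    with lower[of 1 x] show ?thesis
      by (simp add: g_def)
  qed
  have add: "q (x + y) = q x + q y" for x y
    using super sublinear_add[OF q(1)] by (intro antisym)
  have neg: "q (- x) = - q x" for x
    using add[of x "- x"] sublinear_zero[OF q(1)] by simp
  have "q (t *\<^sub>R x) = t * q x" for t x
  proof (cases "0 \<le> t")
    case True
    then show ?thesis by (rule sublinear_scale[OF q(1)])
  next
    case False
    then show ?thesis
      using sublinear_scale[OF q(1), of "- t" x] neg[of "t *\<^sub>R x"] by simp
  qed
  then have "linear q"
    using add by (intro linearI) auto
  moreover have "q x \<le> p x" for x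
    using q(2) by (simp add: le_fun_def)
  ultimately show ?thesis by (rule that)
qed

text \<open>
  Geometric form. The functional \<open>p y = inf {\<parallel>y + t (x - c)\<parallel> - t d | t \<ge> 0, c \<in> C}\<close> combines both
  requirements: \<open>p \<le> \<parallel>\<cdot>\<parallel>\<close> (\<open>t = 0\<close>) and \<open>p (c - x) \<le> - d\<close> (\<open>t = 1\<close>).
\<close>

lemma real_separation:
  fixes C :: "'v::real_normed_vector set"
  assumes C: "convex C" "C \<noteq> {}" and d: "\<And>c. c \<in> C \<Longrightarrow> d \<le> norm (x - c)"
  obtains u where "linear u" "\<And>y. u y \<le> norm y" "\<And>c. c \<in> C \<Longrightarrow> u c \<le> u x - d"
proof -
  define I where "I = {0::real..} \<times> C"
  define g where "g = (\<lambda>(t, c) y. norm (y + t *\<^sub>R (x - c)) - t * d)"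
  have bdd: "bdd_below ((\<lambda>i. g i y) ` I)" for y
  proof (rule bdd_belowI2)
    fix i assume "i \<in> I"
    then obtain t c where i: "i = (t, c)" "0 \<le> t" "c \<in> C"
      unfolding I_def by auto
    have "t * d \<le> norm (t *\<^sub>R (x - c))"
      using mult_left_mono[OF d[OF i(3)] i(2)] i(2) by simp
    also have "\<dots> \<le> norm (y + t *\<^sub>R (x - c)) + norm y"
      using norm_triangle_ineq4[of "y + t *\<^sub>R (x - c)" y] by simp
    finally show "- norm y \<le> g i y"
      by (simp add: g_def i(1))
  qed
  define p where "p = (\<lambda>y. INF i\<in>I. g i y)"
  have "sublinear p"
    unfolding p_def
  proof (rule sublinear_INF[OF _ bdd])
    show "I \<noteq> {}"
      using C(2) by (auto simp: I_def)
  next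
    fix i j and y z :: 'v
    assume "i \<in> I" "j \<in> I"
    then obtain s a t b where ij: "i = (s, a)" "j = (t, b)" "0 \<le> s" "0 \<le> t" "a \<in> C" "b \<in> C"
      unfolding I_def by auto
    define c where "c = (if s + t = 0 then a else (s / (s + t)) *\<^sub>R a + (t / (s + t)) *\<^sub>R b)"
    have "c \<in> C"
      unfolding c_def using ij C(1)
      by (auto intro!: convexD simp flip: add_divide_distrib)
    then have k: "(s + t, c) \<in> I"
      using ij by (simp add: I_def)
    have "(s + t) *\<^sub>R c = s *\<^sub>R a + t *\<^sub>R b"
      unfolding c_def using ij(3,4) by (auto simp: scaleR_add_right add_nonneg_eq_0_iff)
    then have "y + z + (s + t) *\<^sub>R (x - c) = (y + s *\<^sub>R (x - a)) + (z + t *\<^sub>R (x - b))"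
      by (simp add: algebra_simps)
    then have "norm (y + z + (s + t) *\<^sub>R (x - c)) \<le> norm (y + s *\<^sub>R (x - a)) + norm (z + t *\<^sub>R (x - b))"
      by (metis norm_triangle_ineq)
    then have "g (s + t, c) (y + z) \<le> g i y + g j z"
      unfolding g_def ij by (simp add: algebra_simps)
    with k show "\<exists>k\<in>I. g k (y + z) \<le> g i y + g j z"
      by blast
  next
    fix i and s :: real and y :: 'v
    assume "i \<in> I" and s: "0 \<le> s"
    then obtain t c where i: "i = (t, c)" "0 \<le> t" "c \<in> C"
      unfolding I_def by auto
    have "s *\<^sub>R y + (s * t) *\<^sub>R (x - c) = s *\<^sub>R (y + t *\<^sub>R (x - c))"
      by (simp add: algebra_simps)
    then have "norm (s *\<^sub>R y + (s * t) *\<^sub>R (x - c)) = s * norm (y + t *\<^sub>R (x - c))"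
      using s by simp
    then have "g (s * t, c) (s *\<^sub>R y) \<le> s * g i y"
      unfolding g_def i by (simp add: algebra_simps)
    moreover have "(s * t, c) \<in> I"
      using i s by (simp add: I_def)
    ultimately show "\<exists>k\<in>I. g k (s *\<^sub>R y) \<le> s * g i y"
      by blast
  qed
  then obtain u where u: "linear u" "\<And>y. u y \<le> p y"
    using sublinear_dominates_linear by blast
  have lower: "p y \<le> norm (y + t *\<^sub>R (x - c)) - t * d" if "0 \<le> t" "c \<in> C" for y t c
    using cINF_lower[OF bdd, of "(t, c)" y] that unfolding p_def g_def I_def by simp
  show ?thesis
  proof (rule that[OF u(1)])
    show "u y \<le> norm y" for y
      using C(2) u(2)[of y] lower[of 0 _ y] by force
    show "u c \<le> u x - d" if "c \<in> C" for c
      using u(2)[of "c - x"] lower[of 1 c "c - x"] that linear_diff[OF u(1), of c x] by simp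
  qed
qed

lemma banach_overD:
  assumes "banach_over s"
  shows "s c (x + y) = s c x + s c y" "s (b + c) x = s b x + s c x" "s b (s c x) = s (b * c) x"
    "s 1 x = x" "norm (s c x) = norm c * norm x" "s (of_real r) x = r *\<^sub>R x"
  using assms unfolding banach_over_def
  by (auto simp: vector_space.vector_space_assms)

lemma banach_over_zero [simp]: "banach_over s \<Longrightarrow> s 0 x = 0" "banach_over s \<Longrightarrow> s c 0 = 0"
  using banach_overD(5)[of s 0 x] banach_overD(5)[of s c 0] by simp_all

text \<open>A real functional \<open>u\<close> is the real part of \<open>x \<mapsto> u x - i u (i x)\<close>.\<close>

lemma scalar_linear_of_real_linear:
  fixes s :: "'k::real_or_complex \<Rightarrow> 'v::banach \<Rightarrow> 'v"
  assumes s: "banach_over s" and u: "linear u" and le: "\<And>y. u y \<le> norm y"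
  obtains g :: "'v \<Rightarrow> 'k" where "\<And>y z. g (y + z) = g y + g z" "\<And>c y. g (s c y) = c * g y"
    "\<And>y. norm (g y) \<le> norm y" "\<And>y. re_part (g y) = u y"
proof -
  define g :: "'v \<Rightarrow> 'k" where "g = (\<lambda>y. of_real (u y) - of_real (u (s im_unit y)) * im_unit)"
  have add: "g (y + z) = g y + g z" for y z
    unfolding g_def by (simp add: banach_overD(1)[OF s] linear_add[OF u] algebra_simps)
  have re: "re_part (g y) = u y" for y
    unfolding g_def by (simp add: re_part_diff)
  have real: "g (s (of_real r) y) = of_real r * g y" for r y
  proof -
    have "s im_unit (s (of_real r) y) = s (of_real r) (s im_unit y)"
      by (simp add: banach_overD(3)[OF s] mult.commute)
    then show ?thesis
      unfolding g_def by (simp add: banach_overD(6)[OF s] linear_scale[OF u] algebra_simps)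
  qed
  have unit: "g (s im_unit y) = im_unit * g y" for y
  proof (cases rule: im_unit_cases[where 'k = 'k])
    case real
    then show ?thesis
      unfolding g_def using s by (simp add: linear_0[OF u])
  next
    case complex
    have "s (- 1) y = - y"
      using banach_overD(6)[OF s, of "- 1" y] by simp
    then have "g (s im_unit y) = of_real (u (s im_unit y)) + of_real (u y) * im_unit"
      unfolding g_def banach_overD(3)[OF s] complex(1) by (simp add: linear_neg[OF u])
    also have "\<dots> = of_real (u y) * im_unit - of_real (u (s im_unit y)) * (im_unit * im_unit)"
      unfolding complex(1) by simp
    also have "\<dots> = im_unit * g y"
      unfolding g_def by (simp add: algebra_simps)
    finally show ?thesis .
  qed
  have scale: "g (s c y) = c * g y" for c y
  proof -
    obtain a b where c: "c = of_real a + of_real b * im_unit"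
      by (rule scalar_decomp)
    have "g (s c y) = g (s (of_real a) y) + g (s (of_real b) (s im_unit y))"
      unfolding c by (simp add: banach_overD(2,3)[OF s] add)
    also have "\<dots> = c * g y"
      unfolding real unit c by (simp add: algebra_simps)
    finally show ?thesis .
  qed
  have "norm (g y) \<le> norm y" for y
  proof -
    obtain c :: 'k where c: "norm c = 1" "c * g y = of_real (norm (g y))"
      by (rule unit_scalar_rotating)
    have "norm (g y) = re_part (g (s c y))"
      by (simp add: scale c(2))
    also have "\<dots> \<le> norm (s c y)"
      unfolding re by (rule le)
    finally show ?thesis
      by (simp add: banach_overD(5)[OF s] c(1))
  qed
  with add scale re show ?thesis
    using that by blast
qed

lemma scalar_separation:
  fixes s :: "'k::real_or_complex \<Rightarrow> 'v::banach \<Rightarrow> 'v"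
  assumes s: "banach_over s" and C: "convex C" "C \<noteq> {}" and d: "\<And>c. c \<in> C \<Longrightarrow> d \<le> norm (x - c)"
  obtains g :: "'v \<Rightarrow> 'k" where "\<And>y z. g (y + z) = g y + g z" "\<And>c y. g (s c y) = c * g y"
    "\<And>y. norm (g y) \<le> norm y" "\<And>c. c \<in> C \<Longrightarrow> re_part (g c) \<le> re_part (g x) - d"
proof -
  obtain u where u: "linear u" "\<And>y. u y \<le> norm y" "\<And>c. c \<in> C \<Longrightarrow> u c \<le> u x - d"
    using real_separation[OF C d] by blast
  obtain g :: "'v \<Rightarrow> 'k" where "\<And>y z. g (y + z) = g y + g z" "\<And>c y. g (s c y) = c * g y"
    "\<And>y. norm (g y) \<le> norm y" "\<And>y. re_part (g y) = u y"
    using scalar_linear_of_real_linear[OF s u(1,2)] by blast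
  with u(3) show ?thesis
    using that[of g] by simp
qed

section \<open>Dual and bidual spaces\<close>

text \<open>
  With this multiplication \<open>X\<^sup>*\<close> is again a Banach space over the scalars, and the separation theorem
  applies to it.
\<close>

definition dual_scale :: "'k::real_or_complex \<Rightarrow> ('a::banach \<Rightarrow>\<^sub>L 'k) \<Rightarrow> ('a \<Rightarrow>\<^sub>L 'k)" where
  "dual_scale c f = blinfun_mult_right c o\<^sub>L f"

lemma dual_scale_apply [simp]: "blinfun_apply (dual_scale c f) x = c * blinfun_apply f x"
  unfolding dual_scale_def by (simp add: blinfun_compose.rep_eq)

lemma norm_dual_scale:
  fixes f :: "'a::banach \<Rightarrow>\<^sub>L 'k::real_or_complex"
  shows "norm (dual_scale c f) = norm c * norm f"
proof -
  have le: "norm (dual_scale c f) \<le> norm c * norm f" for c :: 'k and f :: "'a \<Rightarrow>\<^sub>L 'k"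
  proof (rule norm_blinfun_bound)
    fix x
    show "norm (blinfun_apply (dual_scale c f) x) \<le> norm c * norm f * norm x"
      using mult_left_mono[OF norm_blinfun[of f x], of "norm c"] by (simp add: norm_mult mult.assoc)
  qed simp
  show ?thesis
  proof (cases "c = 0")
    case True
    then show ?thesis using le[of c f] by simp
  next
    case False
    then have "dual_scale (inverse c) (dual_scale c f) = f"
      by (intro blinfun_eqI) simp
    then have "norm f \<le> norm (inverse c) * norm (dual_scale c f)"
      using le[of "inverse c" "dual_scale c f"] by simp
    then have "norm c * norm f \<le> norm (dual_scale c f)"
      using mult_left_mono[OF \<open>norm f \<le> norm (inverse c) * norm (dual_scale c f)\<close>, of "norm c"] False
      by (simp add: norm_inverse flip: mult.assoc)
    with le[of c f] show ?thesis by simp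
  qed
qed

lemma dual_scale_of_real [simp]: "dual_scale (of_real r) f = r *\<^sub>R f"
  by (rule blinfun_eqI) (simp add: blinfun.scaleR_left scaleR_conv_of_real)

lemma banach_over_dual_scale:
  "banach_over (dual_scale :: 'k::real_or_complex \<Rightarrow> ('a::banach \<Rightarrow>\<^sub>L 'k) \<Rightarrow> ('a \<Rightarrow>\<^sub>L 'k))"
  unfolding banach_over_def norm_dual_scale dual_scale_of_real
  by (auto intro!: vector_space.intro blinfun_eqI simp: blinfun.add_left blinfun.add_right algebra_simps)

lemma dual_spaceD: "f \<in> dual_space sc \<Longrightarrow> blinfun_apply f (sc c x) = c * blinfun_apply f x"
  by (simp add: dual_space_def)

lemma dual_space_0 [simp]: "0 \<in> dual_space sc"
  by (simp add: dual_space_def)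

lemma dual_space_add: "f \<in> dual_space sc \<Longrightarrow> g \<in> dual_space sc \<Longrightarrow> f + g \<in> dual_space sc"
  by (simp add: dual_space_def blinfun.add_left algebra_simps)

lemma dual_space_scaleR: "f \<in> dual_space sc \<Longrightarrow> r *\<^sub>R f \<in> dual_space sc"
  by (simp add: dual_space_def blinfun.scaleR_left)

lemma dual_space_dual_scale: "f \<in> dual_space sc \<Longrightarrow> dual_scale c f \<in> dual_space sc"
  by (simp add: dual_space_def)

lemma dual_space_diff: "f \<in> dual_space sc \<Longrightarrow> g \<in> dual_space sc \<Longrightarrow> f - g \<in> dual_space sc"
  by (simp add: dual_space_def blinfun.diff_left algebra_simps)

lemma convex_dual_space: "convex (dual_space sc)"
  by (intro convexI dual_space_add dual_space_scaleR)

lemma closed_dual_space: "closed (dual_space sc)"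
proof -
  have "dual_space sc = (\<Inter>c. \<Inter>x. {f. blinfun_apply f (sc c x) = c * blinfun_apply f x})"
    by (auto simp: dual_space_def)
  moreover have "closed {f. blinfun_apply f (sc c x) = c * blinfun_apply f x}" for c x
    by (intro closed_Collect_eq continuous_intros)
  ultimately show ?thesis
    by (metis (no_types, lifting) closed_INT)
qed

lemma dual_spaceI:
  assumes sc: "banach_over sc" and add: "\<And>x y. g (x + y) = g x + g y"
    and scale: "\<And>c x. g (sc c x) = c * g x" and bound: "\<And>x. norm (g x) \<le> norm x * K"
  obtains f where "f \<in> dual_space sc" "\<And>x. blinfun_apply f x = g x"
proof -
  have "bounded_linear g"
  proof (rule bounded_linear_intro[OF add _ bound])
    show "g (r *\<^sub>R x) = r *\<^sub>R g x" for r x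
      using scale[of "of_real r" x] by (simp add: banach_overD(6)[OF sc] scaleR_conv_of_real)
  qed
  then have "blinfun_apply (Blinfun g) = g"
    by (rule bounded_linear_Blinfun_apply)
  then show ?thesis
    using that[of "Blinfun g"] scale by (simp add: dual_space_def)
qed

lemma dual_norm_approx:
  assumes sc: "banach_over sc" and f: "f \<in> dual_space sc" and r: "r < norm f"
  obtains x where "norm x \<le> 1" "r < re_part (blinfun_apply f x)"
proof -
  obtain x where x: "norm x \<le> 1" "r < norm (blinfun_apply f x)"
  proof (cases "r < 0")
    case True
    show ?thesis
      by (rule that[of 0]) (simp_all add: True)
  next
    case False
    have "\<exists>x. norm (blinfun_apply f x) > r * norm x"
    proof (rule ccontr)
      assume "\<not> ?thesis"
      then have "norm f \<le> r"
        using False by (intro norm_blinfun_bound) (auto simp: not_less)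
      with r show False by simp
    qed
    then obtain x where x: "r * norm x < norm (blinfun_apply f x)"
      by blast
    then have "x \<noteq> 0"
      by auto
    then have "r < norm (blinfun_apply f (x /\<^sub>R norm x))"
      using x by (simp add: blinfun.scaleR_right divide_simps mult.commute)
    then show ?thesis
      using that[of "x /\<^sub>R norm x"] \<open>x \<noteq> 0\<close> by simp
  qed
  obtain c where c: "norm c = 1" "c * blinfun_apply f x = of_real (norm (blinfun_apply f x))"
    by (rule unit_scalar_rotating)
  show ?thesis
    using that[of "sc c x"] x c by (simp add: dual_spaceD[OF f] banach_overD(5)[OF sc])
qed

lemma dual_norm_le:
  assumes sc: "banach_over sc" and f: "f \<in> dual_space sc"
    and le: "\<And>x. norm x \<le> 1 \<Longrightarrow> re_part (blinfun_apply f x) \<le> r"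
  shows "norm f \<le> r"
proof (rule ccontr)
  assume "\<not> norm f \<le> r"
  then have "r < norm f" by simp
  then obtain x where "norm x \<le> 1" "r < re_part (blinfun_apply f x)"
    by (rule dual_norm_approx[OF sc f])
  with le[of x] show False by simp
qed

lemma bidual_add:
  "\<phi> \<in> bidual_space sc \<Longrightarrow> f \<in> dual_space sc \<Longrightarrow> g \<in> dual_space sc \<Longrightarrow> \<phi> (f + g) = \<phi> f + \<phi> g"
  unfolding bidual_space_def by blast

lemma bidual_scale:
  "\<phi> \<in> bidual_space sc \<Longrightarrow> f \<in> dual_space sc \<Longrightarrow> \<phi> (dual_scale c f) = c * \<phi> f"
  unfolding bidual_space_def dual_scale_def by blast

lemma bidual_scaleR:
  "\<phi> \<in> bidual_space sc \<Longrightarrow> f \<in> dual_space sc \<Longrightarrow> \<phi> (r *\<^sub>R f) = of_real r * \<phi> f"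
  using bidual_scale[of \<phi> sc f "of_real r"] by simp

lemma bidual_diff:
  assumes "\<phi> \<in> bidual_space sc" "f \<in> dual_space sc" "g \<in> dual_space sc"
  shows "\<phi> (f - g) = \<phi> f - \<phi> g"
  using bidual_add[OF assms(1,2) dual_space_scaleR[OF assms(3), of "- 1"]]
    bidual_scaleR[OF assms(1,3), of "- 1"] by simp

lemma bidual_outside: "\<phi> \<in> bidual_space sc \<Longrightarrow> f \<notin> dual_space sc \<Longrightarrow> \<phi> f = 0"
  unfolding bidual_space_def by blast

lemma bidual_bound:
  assumes "\<phi> \<in> bidual_space sc"
  obtains M where "0 < M" "\<And>f. norm (\<phi> f) \<le> M * norm f"
proof -
  obtain M where M: "\<And>f. f \<in> dual_space sc \<Longrightarrow> norm (\<phi> f) \<le> M * norm f"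
    using assms unfolding bidual_space_def by blast
  have "norm (\<phi> f) \<le> (\<bar>M\<bar> + 1) * norm f" for f
  proof (cases "f \<in> dual_space sc")
    case True
    have "M * norm f \<le> (\<bar>M\<bar> + 1) * norm f"
      by (intro mult_right_mono) auto
    with M[OF True] show ?thesis by simp
  next
    case False
    then show ?thesis
      using bidual_outside[OF assms] by simp
  qed
  then show ?thesis
    using that[of "\<bar>M\<bar> + 1"] by simp
qed

lemma bidualI:
  assumes "\<And>f. f \<notin> dual_space sc \<Longrightarrow> \<phi> f = 0"
    and "\<And>f g. f \<in> dual_space sc \<Longrightarrow> g \<in> dual_space sc \<Longrightarrow> \<phi> (f + g) = \<phi> f + \<phi> g"
    and "\<And>c f. f \<in> dual_space sc \<Longrightarrow> \<phi> (dual_scale c f) = c * \<phi> f"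
    and "\<And>f. f \<in> dual_space sc \<Longrightarrow> norm (\<phi> f) \<le> M * norm f"
  shows "\<phi> \<in> bidual_space sc"
  unfolding bidual_space_def mem_Collect_eq dual_scale_def[symmetric]
  by (intro conjI allI ballI impI exI[of _ M] assms)

lemma bidual_mult:
  assumes "\<phi> \<in> bidual_space sc"
  shows "(\<lambda>f. c * \<phi> f) \<in> bidual_space sc"
proof -
  obtain M where M: "\<And>f. norm (\<phi> f) \<le> M * norm f"
    using bidual_bound[OF assms] by blast
  show ?thesis
  proof (rule bidualI[where M = "norm c * M"])
    show "norm (c * \<phi> f) \<le> norm c * M * norm f" for f
      using mult_left_mono[OF M, of "norm c" f] by (simp add: norm_mult mult.assoc)
  qed (use assms in \<open>simp_all add: bidual_outside[OF assms] bidual_add[OF assms] bidual_scale[OF assms] algebra_simps\<close>)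
qed

lemma canonical_embedding_apply:
  "f \<in> dual_space sc \<Longrightarrow> canonical_embedding sc x f = blinfun_apply f x"
  by (simp add: canonical_embedding_def)

lemma norm_canonical_embedding_le: "norm (canonical_embedding sc x f) \<le> norm x * norm f"
  unfolding canonical_embedding_def using norm_blinfun[of f x] by (simp add: mult.commute)

lemma canonical_embedding_in_bidual: "canonical_embedding sc x \<in> bidual_space sc"
proof (rule bidualI)
  show "norm (canonical_embedding sc x f) \<le> norm x * norm f" for f
    by (rule norm_canonical_embedding_le)
qed (simp_all add: canonical_embedding_def dual_space_add dual_space_dual_scale blinfun.add_left)

lemma mult_canonical_embedding:
  "(\<lambda>f. c * canonical_embedding sc x f) = canonical_embedding sc (sc c x)"
  by (auto simp: canonical_embedding_def dual_spaceD)

lemma embedded_subset_bidual: "embedded_space sc \<subseteq> bidual_space sc"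
  unfolding embedded_space_def using canonical_embedding_in_bidual by blast

lemma embedded_mult: "\<phi> \<in> embedded_space sc \<Longrightarrow> (\<lambda>f. c * \<phi> f) \<in> embedded_space sc"
  unfolding embedded_space_def by (auto simp: mult_canonical_embedding)

text \<open>
  Mazur's theorem. The separating functional of the ambient space of bounded real-linear maps is linear
  over the scalars, so its restriction to \<open>X\<^sup>*\<close> belongs to the bidual.
\<close>

lemma bidual_separation:
  fixes C :: "('a::banach \<Rightarrow>\<^sub>L 'k::real_or_complex) set"
  assumes C: "convex C" and x: "x \<notin> closure C"
  obtains \<phi> d where "\<phi> \<in> bidual_space sc" "0 < d"
    "\<And>c. c \<in> C \<inter> dual_space sc \<Longrightarrow> x \<in> dual_space sc \<Longrightarrow> re_part (\<phi> c) \<le> re_part (\<phi> x) - d"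
proof (cases "C = {}")
  case True
  show ?thesis
    by (rule that[OF canonical_embedding_in_bidual[of sc 0] zero_less_one]) (simp add: True)
next
  case False
  obtain d where d: "0 < d" "\<And>c. c \<in> C \<Longrightarrow> d \<le> norm (x - c)"
  proof -
    obtain d where "0 < d" "\<And>c. c \<in> C \<Longrightarrow> \<not> dist c x < d"
      using x unfolding closure_approachable by blast
    then show ?thesis
      using that[of d] by (simp add: dist_norm norm_minus_commute not_less)
  qed
  obtain g :: "('a \<Rightarrow>\<^sub>L 'k) \<Rightarrow> 'k" where g: "\<And>y z. g (y + z) = g y + g z"
    "\<And>c y. g (dual_scale c y) = c * g y" "\<And>y. norm (g y) \<le> norm y"
    "\<And>c. c \<in> C \<Longrightarrow> re_part (g c) \<le> re_part (g x) - d"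
    by (rule scalar_separation[OF banach_over_dual_scale C False d(2)]) (assumption, rule that)
  define \<phi> where "\<phi> = (\<lambda>f. if f \<in> dual_space sc then g f else 0)"
  have "\<phi> \<in> bidual_space sc"
    by (rule bidualI[where M = 1])
       (simp_all add: \<phi>_def g dual_space_add dual_space_dual_scale)
  then show ?thesis
  proof (rule that[OF _ d(1)])
    fix c assume "c \<in> C \<inter> dual_space sc" "x \<in> dual_space sc"
    then show "re_part (\<phi> c) \<le> re_part (\<phi> x) - d"
      using g(4)[of c] by (simp add: \<phi>_def)
  qed
qed

section \<open>Closures in weak and Mackey topologies\<close>

lemma closure_of_initial_topology_iff:
  fixes F :: "('b \<Rightarrow> 'k::real_normed_vector) set"
  shows "f \<in> initial_topology S F closure_of A \<longleftrightarrow>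
    f \<in> S \<and> (\<forall>G e. finite G \<and> G \<subseteq> F \<and> 0 < e \<longrightarrow> (\<exists>g\<in>A \<inter> S. \<forall>\<phi>\<in>G. norm (\<phi> g - \<phi> f) < e))"
    (is "?L \<longleftrightarrow> ?R")
proof
  define \<B> where "\<B> = insert S {S \<inter> \<phi> -` U | \<phi> U. \<phi> \<in> F \<and> open U}"
  define N where "N = (\<lambda>(G :: ('b \<Rightarrow> 'k) set) e f. {g\<in>S. \<forall>\<phi>\<in>G. norm (\<phi> g - \<phi> f) < e})"
  have open_basis: "openin (initial_topology S F) U" if "U \<in> \<B>" for U
    using that unfolding initial_topology_def \<B>_def by (rule topology_generated_by_Basis)
  have open_N: "openin (initial_topology S F) (N G e f)" if "finite G" "G \<subseteq> F" for G e f
    using that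
  proof (induction G)
    case empty
    have "N {} e f = S"
      unfolding N_def by simp
    then show ?case
      using open_basis[of S] by (simp add: \<B>_def)
  next
    case (insert \<phi> G)
    have "N (insert \<phi> G) e f = (S \<inter> \<phi> -` ball (\<phi> f) e) \<inter> N G e f"
      unfolding N_def by (auto simp: dist_norm norm_minus_commute)
    moreover have "openin (initial_topology S F) (S \<inter> \<phi> -` ball (\<phi> f) e)"
      using insert.prems by (intro open_basis) (unfold \<B>_def, blast)
    ultimately show ?case
      using insert by auto
  qed
  {
    assume L: ?L
    show ?R
    proof (intro conjI allI impI)
      show "f \<in> S"
        using L by (simp add: in_closure_of)
      fix G and e :: real assume G: "finite G \<and> G \<subseteq> F \<and> 0 < e"
      then have "f \<in> N G e f"
        using \<open>f \<in> S\<close> by (simp add: N_def)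
      then obtain g where "g \<in> A" "g \<in> N G e f"
        using L open_N[of G e f] G unfolding in_closure_of by blast
      then show "\<exists>g\<in>A \<inter> S. \<forall>\<phi>\<in>G. norm (\<phi> g - \<phi> f) < e"
        unfolding N_def by blast
    qed
  next
    assume R: ?R
    have "\<exists>G e. finite G \<and> G \<subseteq> F \<and> 0 < e \<and> N G e f \<subseteq> T"
      if "generate_topology_on \<B> T" "f \<in> T" for T
      using that
    proof (induction T)
      case Empty
      then show ?case by simp
    next
      case (Int a b)
      then obtain G d where G: "finite G \<and> G \<subseteq> F \<and> 0 < d \<and> N G d f \<subseteq> a"
        by blast
      from Int obtain H e where H: "finite H \<and> H \<subseteq> F \<and> 0 < e \<and> N H e f \<subseteq> b"
        by blast
      have "N (G \<union> H) (min d e) f \<subseteq> N G d f \<inter> N H e f"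
        unfolding N_def by auto
      with G H have "N (G \<union> H) (min d e) f \<subseteq> a \<inter> b"
        by blast
      moreover have "finite (G \<union> H)" "G \<union> H \<subseteq> F" "0 < min d e"
        using G H by simp_all
      ultimately show ?case by blast
    next
      case (UN K)
      from UN.prems obtain k where k: "k \<in> K" "f \<in> k"
        by blast
      from UN.IH[OF this] obtain G e where "finite G \<and> G \<subseteq> F \<and> 0 < e \<and> N G e f \<subseteq> k"
        by blast
      with k(1) show ?case
        by blast
    next
      case (Basis T)
      then consider "T = S" | \<phi> U where "\<phi> \<in> F" "open U" "T = S \<inter> \<phi> -` U"
        unfolding \<B>_def by blast
      then show ?case
      proof cases
        case 1
        then show ?thesis
          by (intro exI[of _ "{}"] exI[of _ 1]) (auto simp: N_def)
      next
        case 2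
        then obtain e where e: "0 < e" "ball (\<phi> f) e \<subseteq> U"
          using Basis(2) open_contains_ball by blast
        then have "y \<in> U" if "norm (y - \<phi> f) < e" for y
          using that by (intro subsetD[OF e(2)]) (simp add: dist_norm norm_minus_commute)
        then show ?thesis
          using 2 e(1) by (intro exI[of _ "{\<phi>}"] exI[of _ e]) (auto simp: N_def)
      qed
    qed
    then have nbhd: "\<exists>G e. finite G \<and> G \<subseteq> F \<and> 0 < e \<and> N G e f \<subseteq> T"
      if "openin (initial_topology S F) T" "f \<in> T" for T
      using that unfolding initial_topology_def openin_topology_generated_by_iff \<B>_def by blast
    have "\<exists>y. y \<in> A \<and> y \<in> T" if T: "f \<in> T" "openin (initial_topology S F) T" for T
    proof -
      obtain G e where G: "finite G \<and> G \<subseteq> F \<and> 0 < e" "N G e f \<subseteq> T"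
        using nbhd[OF T(2,1)] by blast
      then obtain g where "g \<in> A \<inter> S" "\<forall>\<phi>\<in>G. norm (\<phi> g - \<phi> f) < e"
        using R by blast
      with G(2) show ?thesis
        unfolding N_def by blast
    qed
    then show ?L
      using R unfolding in_closure_of by simp
  }
qed

lemma closure_of_uniform_convergence_topology_iff:
  fixes \<KK> :: "('b \<Rightarrow> 'k::real_normed_vector) set set"
  shows "f \<in> uniform_convergence_topology S \<KK> closure_of A \<longleftrightarrow>
    f \<in> S \<and> (\<forall>\<FF> e. finite \<FF> \<and> \<FF> \<subseteq> \<KK> \<and> 0 < e \<longrightarrow>
      (\<exists>g\<in>A \<inter> S. \<forall>K\<in>\<FF>. \<forall>\<phi>\<in>K. norm (\<phi> g - \<phi> f) < e))"
    (is "?L \<longleftrightarrow> ?R")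
proof
  assume L: ?L
  show ?R
  proof (intro conjI allI impI)
    show "f \<in> S"
      using L by (simp add: in_closure_of)
    fix \<FF> and e :: real assume \<FF>: "finite \<FF> \<and> \<FF> \<subseteq> \<KK> \<and> 0 < e"
    \<comment> \<open>The pointwise strict inequality over a whole \<open>K\<close> does not define an open set;
      a uniform gap \<open>d < e\<close> does.\<close>
    define U where "U = {g\<in>S. \<exists>d<e. \<forall>K\<in>\<FF>. \<forall>\<phi>\<in>K. norm (\<phi> g - \<phi> f) \<le> d}"
    have "openin (uniform_convergence_topology S \<KK>) U"
      unfolding openin_uniform_convergence_topology
    proof (intro conjI ballI)
      fix g assume "g \<in> U"
      then obtain d where d: "d < e" "\<And>K \<phi>. K \<in> \<FF> \<Longrightarrow> \<phi> \<in> K \<Longrightarrow> norm (\<phi> g - \<phi> f) \<le> d"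
        unfolding U_def by blast
      have "{h\<in>S. \<forall>K\<in>\<FF>. \<forall>\<phi>\<in>K. norm (\<phi> h - \<phi> g) < (e - d) / 2} \<subseteq> U"
      proof safe
        fix h assume h: "h \<in> S" "\<forall>K\<in>\<FF>. \<forall>\<phi>\<in>K. norm (\<phi> h - \<phi> g) < (e - d) / 2"
        have "norm (\<phi> h - \<phi> f) \<le> (e + d) / 2" if "K \<in> \<FF>" "\<phi> \<in> K" for K \<phi>
        proof -
          have "norm (\<phi> h - \<phi> f) \<le> norm (\<phi> h - \<phi> g) + norm (\<phi> g - \<phi> f)"
            using norm_triangle_ineq[of "\<phi> h - \<phi> g" "\<phi> g - \<phi> f"] by simp
          moreover have "norm (\<phi> h - \<phi> g) < (e - d) / 2" "norm (\<phi> g - \<phi> f) \<le> d"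
            using h(2) d(2) that by blast+
          ultimately show ?thesis by argo
        qed
        moreover have "(e + d) / 2 < e"
          using d(1) by simp
        ultimately show "h \<in> U"
          unfolding U_def using h(1) by blast
      qed
      moreover have "0 < (e - d) / 2"
        using d(1) by simp
      ultimately show "\<exists>\<FF> e. finite \<FF> \<and> \<FF> \<subseteq> \<KK> \<and> 0 < e \<and>
        {h\<in>S. \<forall>K\<in>\<FF>. \<forall>\<phi>\<in>K. norm (\<phi> h - \<phi> g) < e} \<subseteq> U"
        using \<FF> by blast
    qed (auto simp: U_def)
    moreover have "f \<in> U"
      unfolding U_def using \<open>f \<in> S\<close> \<FF> by (auto intro!: exI[of _ 0])
    ultimately obtain g where "g \<in> A" "g \<in> U"
      using L unfolding in_closure_of by blast
    then show "\<exists>g\<in>A \<inter> S. \<forall>K\<in>\<FF>. \<forall>\<phi>\<in>K. norm (\<phi> g - \<phi> f) < e"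
      unfolding U_def by force
  qed
next
  assume R: ?R
  have "\<exists>y. y \<in> A \<and> y \<in> T" if T: "f \<in> T" "openin (uniform_convergence_topology S \<KK>) T" for T
  proof -
    obtain \<FF> e where \<FF>: "finite \<FF> \<and> \<FF> \<subseteq> \<KK> \<and> 0 < e"
      "{g\<in>S. \<forall>K\<in>\<FF>. \<forall>\<phi>\<in>K. norm (\<phi> g - \<phi> f) < e} \<subseteq> T"
      using T unfolding openin_uniform_convergence_topology by meson
    then obtain g where "g \<in> A \<inter> S" "\<forall>K\<in>\<FF>. \<forall>\<phi>\<in>K. norm (\<phi> g - \<phi> f) < e"
      using R by blast
    with \<FF>(2) show ?thesis by blast
  qed
  then show ?L
    using R unfolding in_closure_of by simp
qed

lemma continuous_map_initial_topology:
  fixes F :: "('b \<Rightarrow> 'k::topological_space) set"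
  assumes "\<And>x. x \<in> topspace T \<Longrightarrow> h x \<in> S" and "\<And>\<phi>. \<phi> \<in> F \<Longrightarrow> continuous_map T euclidean (\<lambda>x. \<phi> (h x))"
  shows "continuous_map T (initial_topology S F) h"
  unfolding initial_topology_def
proof (rule continuous_on_generated_topo)
  fix U assume "U \<in> insert S {S \<inter> \<phi> -` U |\<phi> U. \<phi> \<in> F \<and> open U}"
  then consider "U = S" | \<phi> V where "\<phi> \<in> F" "open V" "U = S \<inter> \<phi> -` V"
    by blast
  then show "openin T (h -` U \<inter> topspace T)"
  proof cases
    case 1
    then have "h -` U \<inter> topspace T = topspace T"
      using assms(1) by auto
    then show ?thesis by simp
  next
    case 2
    have "openin T {x \<in> topspace T. \<phi> (h x) \<in> V}"
      using openin_continuous_map_preimage[OF assms(2)[OF 2(1)]] 2(2) by simp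
    moreover have "h -` U \<inter> topspace T = {x \<in> topspace T. \<phi> (h x) \<in> V}"
      using assms(1) 2(3) by auto
    ultimately show ?thesis by simp
  qed
qed (use assms(1) in auto)

lemma continuous_map_eval_initial_topology:
  fixes \<phi> :: "'b \<Rightarrow> 'k::topological_space"
  assumes "\<phi> \<in> F"
  shows "continuous_map (initial_topology S F) euclidean \<phi>"
  unfolding continuous_map_def
proof (intro conjI allI impI)
  fix U :: "'k set" assume "openin euclidean U"
  then have "S \<inter> \<phi> -` U \<in> insert S {S \<inter> \<phi> -` U |\<phi> U. \<phi> \<in> F \<and> open U}"
    using assms by auto
  then have "openin (initial_topology S F) (S \<inter> \<phi> -` U)"
    unfolding initial_topology_def by (rule topology_generated_by_Basis)
  moreover have "S \<inter> \<phi> -` U = {x \<in> topspace (initial_topology S F). \<phi> x \<in> U}"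
    by auto
  ultimately show "openin (initial_topology S F) {x \<in> topspace (initial_topology S F). \<phi> x \<in> U}"
    by simp
qed simp

lemma topspace_sigma_dual [simp]: "topspace (sigma_dual sc Z) = dual_space sc"
  by (simp add: sigma_dual_def)

lemma topspace_mackey [simp]: "topspace (mackey sc Z) = dual_space sc"
  by (simp add: mackey_def)

lemma topspace_sigma_bidual [simp]: "topspace (sigma_bidual sc Z) = Z"
  by (simp add: sigma_bidual_def)

lemma topspace_weak_star [simp]: "topspace (weak_star sc) = dual_space sc"
  by (simp add: weak_star_def)

lemma topspace_weak [simp]: "topspace (weak sc) = dual_space sc"
  by (simp add: weak_def)

lemma sigma_closure_subset_dual: "sigma_dual sc Z closure_of A \<subseteq> dual_space sc"
  using closure_of_subset_topspace[of "sigma_dual sc Z" A] by simp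

lemma sigma_closure_iff:
  "f \<in> sigma_dual sc Z closure_of A \<longleftrightarrow> f \<in> dual_space sc \<and>
    (\<forall>G e. finite G \<and> G \<subseteq> Z \<and> 0 < e \<longrightarrow> (\<exists>g\<in>A \<inter> dual_space sc. \<forall>\<phi>\<in>G. norm (\<phi> g - \<phi> f) < e))"
  unfolding sigma_dual_def by (rule closure_of_initial_topology_iff)

lemma mackey_closure_iff:
  "f \<in> mackey sc Z closure_of A \<longleftrightarrow> f \<in> dual_space sc \<and>
    (\<forall>\<FF> e. finite \<FF> \<and> (\<forall>K\<in>\<FF>. K \<subseteq> Z \<and> absolutely_convex K \<and> compactin (sigma_bidual sc Z) K) \<and> 0 < e \<longrightarrow>
      (\<exists>g\<in>A \<inter> dual_space sc. \<forall>K\<in>\<FF>. \<forall>\<phi>\<in>K. norm (\<phi> g - \<phi> f) < e))"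
  unfolding mackey_def closure_of_uniform_convergence_topology_iff subset_iff[of _ "Collect _"] mem_Collect_eq
    Ball_def[symmetric]
  by (rule refl)

lemma sigma_closure_antimono:
  "Z \<subseteq> Y \<Longrightarrow> sigma_dual sc Y closure_of A \<subseteq> sigma_dual sc Z closure_of A"
proof
  fix f assume Z: "Z \<subseteq> Y" and f: "f \<in> sigma_dual sc Y closure_of A"
  show "f \<in> sigma_dual sc Z closure_of A"
    unfolding sigma_closure_iff
  proof (intro conjI allI impI)
    show "f \<in> dual_space sc"
      using f unfolding sigma_closure_iff by (rule conjunct1)
    fix G and e :: real assume "finite G \<and> G \<subseteq> Z \<and> 0 < e"
    then have "finite G \<and> G \<subseteq> Y \<and> 0 < e"
      using Z by blast
    then show "\<exists>g\<in>A \<inter> dual_space sc. \<forall>\<phi>\<in>G. norm (\<phi> g - \<phi> f) < e"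
      using f unfolding sigma_closure_iff by simp
  qed
qed

abbreviation halfspace ::
  "('k::real_or_complex \<Rightarrow> 'a::banach \<Rightarrow> 'a) \<Rightarrow> (('a \<Rightarrow>\<^sub>L 'k) \<Rightarrow> 'k) \<Rightarrow> real \<Rightarrow> ('a \<Rightarrow>\<^sub>L 'k) set" where
  "halfspace sc \<phi> r \<equiv> {f \<in> dual_space sc. re_part (\<phi> f) \<le> r}"

abbreviation weak_star_hull ::
  "('k::real_or_complex \<Rightarrow> 'a::banach \<Rightarrow> 'a) \<Rightarrow> ('a \<Rightarrow>\<^sub>L 'k) set \<Rightarrow> ('a \<Rightarrow>\<^sub>L 'k) set" where
  "weak_star_hull sc A \<equiv> weak_star sc closure_of (convex hull A)"

lemma closedin_halfspace:
  fixes sc :: "'k::real_or_complex \<Rightarrow> 'a::banach \<Rightarrow> 'a"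
  assumes "\<phi> \<in> Z"
  shows "closedin (sigma_dual sc Z) (halfspace sc \<phi> r)"
proof -
  have "continuous_map (sigma_dual sc Z) euclidean \<phi>"
    unfolding sigma_dual_def by (rule continuous_map_eval_initial_topology[OF assms])
  moreover have "closed {z :: 'k. re_part z \<le> r}"
    using linear_continuous_on[OF bounded_linear_re_part, of UNIV]
    by (intro closed_Collect_le) auto
  ultimately have "closedin (sigma_dual sc Z) {f \<in> topspace (sigma_dual sc Z). \<phi> f \<in> {z. re_part z \<le> r}}"
    by (intro closedin_continuous_map_preimage) auto
  then show ?thesis
    by simp
qed

lemma convex_halfspace:
  assumes "\<phi> \<in> bidual_space sc"
  shows "convex (halfspace sc \<phi> r)"
proof (rule convexI)
  fix f g and u v :: real
  assume f: "f \<in> halfspace sc \<phi> r" and g: "g \<in> halfspace sc \<phi> r"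
    and uv: "0 \<le> u" "0 \<le> v" "u + v = 1"
  have "re_part (\<phi> (u *\<^sub>R f + v *\<^sub>R g)) = u * re_part (\<phi> f) + v * re_part (\<phi> g)"
    using f g by (simp add: bidual_add[OF assms] bidual_scaleR[OF assms] dual_space_scaleR re_part_add)
  also have "\<dots> \<le> r"
    using f g uv by (intro convex_bound_le) auto
  finally show "u *\<^sub>R f + v *\<^sub>R g \<in> halfspace sc \<phi> r"
    using f g by (simp add: dual_space_add dual_space_scaleR)
qed

lemma closure_subset_sigma_closure:
  assumes Z: "Z \<subseteq> bidual_space sc" and A: "A \<subseteq> dual_space sc"
  shows "closure A \<subseteq> sigma_dual sc Z closure_of A"
proof
  fix f assume f: "f \<in> closure A"
  have fd: "f \<in> dual_space sc"
    using f closure_minimal[OF A closed_dual_space] by blast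
  show "f \<in> sigma_dual sc Z closure_of A"
    unfolding sigma_closure_iff
  proof (intro conjI allI impI fd)
    fix G and e :: real
    assume G: "finite G \<and> G \<subseteq> Z \<and> 0 < e"
    have "\<exists>M. \<forall>g. 0 < M \<and> norm (\<phi> g) \<le> M * norm g" if "\<phi> \<in> G" for \<phi>
    proof -
      have "\<phi> \<in> bidual_space sc"
        using that G Z by blast
      then obtain M where "0 < M" "\<And>g. norm (\<phi> g) \<le> M * norm g"
        by (rule bidual_bound) blast
      then show ?thesis by blast
    qed
    then have "\<exists>M. \<forall>\<phi>\<in>G. \<forall>g. 0 < M \<phi> \<and> norm (\<phi> g) \<le> M \<phi> * norm g"
      by (intro bchoice) blast
    then obtain M where M: "\<And>\<phi> g. \<phi> \<in> G \<Longrightarrow> 0 < M \<phi> \<and> norm (\<phi> g) \<le> M \<phi> * norm g"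
      by blast
    define N where "N = 1 + sum M G"
    have "0 \<le> sum M G"
      using M by (intro sum_nonneg) (auto intro: less_imp_le)
    then have "0 < N"
      unfolding N_def by simp
    have le: "M \<phi> \<le> N" if "\<phi> \<in> G" for \<phi>
    proof -
      have "M \<phi> \<le> sum M G"
        using that G M[THEN conjunct1] by (intro member_le_sum) (auto intro: less_imp_le)
      then show ?thesis
        unfolding N_def by simp
    qed
    have "0 < e / N"
      using G \<open>0 < N\<close> by simp
    then obtain g where g: "g \<in> A" "dist g f < e / N"
      using f unfolding closure_approachable by blast
    have "norm (\<phi> g - \<phi> f) < e" if "\<phi> \<in> G" for \<phi>
    proof -
      have "norm (\<phi> g - \<phi> f) = norm (\<phi> (g - f))"
        using bidual_diff[of \<phi> sc g f] that G Z A g(1) fd by (metis subsetD)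
      also have "\<dots> \<le> N * norm (g - f)"
        using M[OF that, of "g - f"] mult_right_mono[OF le[OF that], of "norm (g - f)"] by simp
      also have "\<dots> < e"
        using g(2) \<open>0 < N\<close> by (simp add: dist_norm field_simps)
      finally show ?thesis .
    qed
    with g(1) A show "\<exists>g\<in>A \<inter> dual_space sc. \<forall>\<phi>\<in>G. norm (\<phi> g - \<phi> f) < e"
      by blast
  qed
qed

lemma closedin_sigma_imp_closed:
  assumes "Z \<subseteq> bidual_space sc" "closedin (sigma_dual sc Z) C"
  shows "closed C"
proof -
  have "C \<subseteq> dual_space sc"
    using closedin_subset[OF assms(2)] by simp
  then have "closure C \<subseteq> C"
    using closure_subset_sigma_closure[OF assms(1)] closure_of_closedin[OF assms(2)] by blast
  then show ?thesis
    using closure_subset_eq by blast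
qed

lemma closed_halfspace:
  assumes "\<phi> \<in> bidual_space sc"
  shows "closed (halfspace sc \<phi> r)"
  using closedin_sigma_imp_closed[OF subset_refl closedin_halfspace[OF assms]] .


text \<open>
  A point outside the \<open>\<sigma>(X\<^sup>*, Z)\<close>-closure of \<open>A\<close> is separated from
  \<open>A\<close> by finitely many real halfspaces given by members of \<open>Z\<close>, because
  \<open>|z| \<ge> e\<close> forces one of \<open>Re z\<close>, \<open>- Re z\<close>, \<open>Re (i z)\<close>, \<open>- Re (i z)\<close> to be at least \<open>e / 2\<close>. This splits \<open>A\<close> into
  finitely many pieces for which convexity is harmless.
\<close>

lemma finite_halfspace_cover:
  fixes sc :: "'k::real_or_complex \<Rightarrow> 'a::banach \<Rightarrow> 'a"
  assumes A: "A \<subseteq> dual_space sc" and f: "f \<in> dual_space sc"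
    and fA: "f \<notin> sigma_dual sc Z closure_of A"
    and Zb: "Z \<subseteq> bidual_space sc" and mult: "\<And>c \<phi>. \<phi> \<in> Z \<Longrightarrow> (\<lambda>f. c * \<phi> f) \<in> Z"
    and ne: "Z \<noteq> {}"
  obtains n \<psi> d where "1 \<le> (n::nat)" "0 < d" "\<And>j. j \<in> {1..n} \<Longrightarrow> \<psi> j \<in> Z"
    "A = (\<Union>j\<in>{1..n}. {g \<in> A. re_part (\<psi> j g) \<le> re_part (\<psi> j f) - d})"
proof -
  obtain G e where G: "finite G" "G \<subseteq> Z" "0 < e"
    and far: "\<And>g. g \<in> A \<Longrightarrow> \<exists>\<phi>\<in>G. e \<le> norm (\<phi> g - \<phi> f)"
  proof -
    obtain G e where G: "finite G" "G \<subseteq> Z" "0 < e"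
      "\<And>g. g \<in> A \<inter> dual_space sc \<Longrightarrow> \<not> (\<forall>\<phi>\<in>G. norm (\<phi> g - \<phi> f) < e)"
      using fA f unfolding sigma_closure_iff by blast
    show ?thesis
    proof (rule that[OF G(1-3)])
      show "\<exists>\<phi>\<in>G. e \<le> norm (\<phi> g - \<phi> f)" if "g \<in> A" for g
        using G(4)[of g] that A by (auto simp: not_less)
    qed
  qed
  obtain \<phi>0 where \<phi>0: "\<phi>0 \<in> Z"
    using ne by blast
  define U :: "'k set" where "U = {1, - 1, im_unit, - im_unit}"
  define P where "P = (\<lambda>p f. fst p * snd p f) ` (U \<times> insert \<phi>0 G)"
  have "finite U" "U \<noteq> {}"
    unfolding U_def by simp_all
  have PZ: "\<psi> \<in> Z" if "\<psi> \<in> P" for \<psi>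
  proof -
    from that obtain p where p: "\<psi> = (\<lambda>f. fst p * snd p f)" "p \<in> U \<times> insert \<phi>0 G"
      unfolding P_def by (rule imageE)
    from p(2) have "snd p \<in> Z"
      using G(2) \<phi>0 by (auto simp: mem_Times_iff)
    then show ?thesis
      unfolding p(1) by (rule mult)
  qed
  have fin: "finite P"
    unfolding P_def using G(1) \<open>finite U\<close> by simp
  have "P \<noteq> {}"
    unfolding P_def using \<open>U \<noteq> {}\<close> by simp
  then have card: "1 \<le> card P"
    using fin by (simp add: Suc_leI card_gt_0_iff)
  obtain h where h: "bij_betw h {1..card P} P"
    using ex_bij_betw_nat_finite_1[OF fin] by blast
  have main: "\<exists>\<psi>\<in>P. re_part (\<psi> g) \<le> re_part (\<psi> f) - e / 2" if g: "g \<in> A" for g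
  proof -
    obtain \<phi> where \<phi>: "\<phi> \<in> G" "e \<le> norm (\<phi> g - \<phi> f)"
      using far[OF g] by blast
    define z where "z = \<phi> g - \<phi> f"
    have "e \<le> \<bar>re_part z\<bar> + \<bar>re_part (im_unit * z)\<bar>"
      using \<phi>(2) norm_le_re_parts[of z] unfolding z_def by linarith
    then have "\<exists>c\<in>U. re_part (c * z) \<le> - (e / 2)"
      unfolding U_def bex_simps mult_1_left mult_minus_left re_part_minus by linarith
    then obtain c where c: "c \<in> U" "re_part (c * z) \<le> - (e / 2)"
      by blast
    have 1: "(\<lambda>f. c * \<phi> f) \<in> P"
      unfolding P_def using c(1) \<phi>(1) by (intro image_eqI[where x = "(c, \<phi>)"]) simp_all
    have 2: "re_part (c * \<phi> g) \<le> re_part (c * \<phi> f) - e / 2"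
      using c(2) unfolding z_def by (simp add: right_diff_distrib re_part_diff)
    show ?thesis
      using 1 2 by (intro bexI[where x = "\<lambda>f. c * \<phi> f"]) simp_all
  qed
  show ?thesis
  proof (rule that[OF card, of "e / 2" h])
    show "0 < e / 2"
      using G(3) by simp
    show "h j \<in> Z" if "j \<in> {1..card P}" for j
      using PZ[of "h j"] bij_betwE[OF h] that by blast
    show "A = (\<Union>j\<in>{1..card P}. {g \<in> A. re_part (h j g) \<le> re_part (h j f) - e / 2})"
    proof (intro antisym subsetI)
      fix g assume g: "g \<in> A"
      then obtain \<psi> where \<psi>: "\<psi> \<in> P" "re_part (\<psi> g) \<le> re_part (\<psi> f) - e / 2"
        using main[OF g] by (elim bexE)
      from \<psi>(1) have "\<psi> \<in> h ` {1..card P}"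
        unfolding bij_betw_imp_surj_on[OF h] .
      then obtain j where "\<psi> = h j" "j \<in> {1..card P}"
        by (rule imageE)
      with \<psi>(2) g show "g \<in> (\<Union>j\<in>{1..card P}. {g \<in> A. re_part (h j g) \<le> re_part (h j f) - e / 2})"
        by auto
    next
      fix g assume "g \<in> (\<Union>j\<in>{1..card P}. {g \<in> A. re_part (h j g) \<le> re_part (h j f) - e / 2})"
      then show "g \<in> A"
        by (elim UN_E CollectE conjE)
    qed
  qed
qed

section \<open>Compact sets of functionals\<close>

lemma compact_imp_compactin_sigma_bidual:
  fixes sc :: "'k::real_or_complex \<Rightarrow> 'a::banach \<Rightarrow> 'a"
  assumes "compact K" "K \<subseteq> Z"
  shows "compactin (sigma_bidual sc Z) K"
proof -
  have "continuous_map (top_of_set K) (sigma_bidual sc Z) (\<lambda>\<phi>. \<phi>)"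
    unfolding sigma_bidual_def
  proof (rule continuous_map_initial_topology)
    fix \<Phi> :: "(('a \<Rightarrow>\<^sub>L 'k) \<Rightarrow> 'k) \<Rightarrow> 'k"
    assume "\<Phi> \<in> (\<lambda>f \<phi>. \<phi> f) ` dual_space sc"
    then obtain f where "\<Phi> = (\<lambda>\<phi>. \<phi> f)"
      by blast
    then show "continuous_map (top_of_set K) euclidean (\<lambda>\<phi>. \<Phi> \<phi>)"
      using continuous_on_subset[OF continuous_on_product_coordinates[of f]] by simp
  qed (use assms(2) in auto)
  moreover have "compactin (top_of_set K) K"
    using assms(1) by (simp add: compactin_subtopology)
  ultimately have "compactin (sigma_bidual sc Z) ((\<lambda>\<phi>. \<phi>) ` K)"
    by (rule image_compactin[rotated])
  then show ?thesis
    by simp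
qed

lemma compactin_sigma_bidual_mono:
  fixes sc :: "'k::real_or_complex \<Rightarrow> 'a::banach \<Rightarrow> 'a"
  assumes "compactin (sigma_bidual sc Z) K" "Z \<subseteq> Y"
  shows "compactin (sigma_bidual sc Y) K"
proof -
  have "continuous_map (sigma_bidual sc Z) (sigma_bidual sc Y) (\<lambda>\<phi>. \<phi>)"
    unfolding sigma_bidual_def
  proof (rule continuous_map_initial_topology)
    fix \<Phi> :: "(('a \<Rightarrow>\<^sub>L 'k) \<Rightarrow> 'k) \<Rightarrow> 'k"
    assume "\<Phi> \<in> (\<lambda>f \<phi>. \<phi> f) ` dual_space sc"
    then show "continuous_map (initial_topology Z ((\<lambda>f \<phi>. \<phi> f) ` dual_space sc)) euclidean (\<lambda>\<phi>. \<Phi> \<phi>)"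
      by (rule continuous_map_eval_initial_topology)
  qed (use assms(2) in auto)
  with assms(1) have "compactin (sigma_bidual sc Y) ((\<lambda>\<phi>. \<phi>) ` K)"
    by (rule image_compactin)
  then show ?thesis
    by simp
qed

lemma compactin_sigma_bidual_bounded:
  fixes sc :: "'k::real_or_complex \<Rightarrow> 'a::banach \<Rightarrow> 'a"
  assumes K: "compactin (sigma_bidual sc Z) K" and f: "f \<in> dual_space sc"
  obtains M where "\<And>\<phi>. \<phi> \<in> K \<Longrightarrow> norm (\<phi> f) \<le> M"
proof -
  have "continuous_map (sigma_bidual sc Z) euclidean (\<lambda>\<phi>. \<phi> f)"
    unfolding sigma_bidual_def by (rule continuous_map_eval_initial_topology) (rule imageI[OF f])
  with K have "compactin euclidean ((\<lambda>\<phi>. \<phi> f) ` K)"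
    by (rule image_compactin)
  then have "bounded ((\<lambda>\<phi>. \<phi> f) ` K)"
    by (simp add: compact_imp_bounded)
  then obtain M where "\<forall>z\<in>(\<lambda>\<phi>. \<phi> f) ` K. norm z \<le> M"
    unfolding bounded_iff by blast
  then show ?thesis
    by (intro that[of M]) simp
qed

definition disc :: "('b \<Rightarrow> 'k::real_or_complex) \<Rightarrow> ('b \<Rightarrow> 'k) set" where
  "disc \<phi> = (\<lambda>c f. c * \<phi> f) ` cball 0 1"

lemma self_in_disc: "\<phi> \<in> disc \<phi>"
  unfolding disc_def by (rule image_eqI[where x = 1]) simp_all

lemma compact_disc: "compact (disc \<phi>)"
  unfolding disc_def
proof (rule compact_continuous_image)
  show "continuous_on (cball 0 1) (\<lambda>c f. c * \<phi> f)"
    by (intro continuous_on_coordinatewise_then_product continuous_intros)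
qed (rule compact_cball)

lemma absolutely_convex_disc:
  fixes \<phi> :: "'b \<Rightarrow> 'k::real_or_complex"
  shows "absolutely_convex (disc \<phi>)"
  unfolding absolutely_convex_def
proof (intro ballI allI impI)
  fix \<psi> \<eta> and a b :: 'k
  assume "\<psi> \<in> disc \<phi>" "\<eta> \<in> disc \<phi>" and ab: "norm a + norm b \<le> 1"
  then obtain c d where cd: "\<psi> = (\<lambda>f. c * \<phi> f)" "\<eta> = (\<lambda>f. d * \<phi> f)" "norm c \<le> 1" "norm d \<le> 1"
    unfolding disc_def by (auto simp: dist_norm)
  have "norm (a * c + b * d) \<le> norm a * norm c + norm b * norm d"
    by (rule order_trans[OF norm_triangle_ineq]) (simp add: norm_mult)
  also have "\<dots> \<le> norm a * 1 + norm b * 1"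
    using cd(3,4) by (intro add_mono mult_left_mono) auto
  finally have "norm (a * c + b * d) \<le> 1"
    using ab by simp
  then show "(\<lambda>f. a * \<psi> f + b * \<eta> f) \<in> disc \<phi>"
    unfolding disc_def cd by (intro image_eqI[where x = "a * c + b * d"]) (auto simp: algebra_simps)
qed

text \<open>
  A disc \<open>{c \<phi> | |c| \<le> 1}\<close> is absolutely convex and compact, and uniform convergence on it is convergence
  at \<open>\<phi>\<close>.
\<close>

lemma mackey_closure_subset_sigma_closure:
  fixes sc :: "'k::real_or_complex \<Rightarrow> 'a::banach \<Rightarrow> 'a"
  assumes mult: "\<And>c \<phi>. \<phi> \<in> Z \<Longrightarrow> (\<lambda>f. c * \<phi> f) \<in> Z"
  shows "mackey sc Z closure_of A \<subseteq> sigma_dual sc Z closure_of A"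
proof
  fix f assume f: "f \<in> mackey sc Z closure_of A"
  then have fd: "f \<in> dual_space sc"
    unfolding mackey_closure_iff by (rule conjunct1)
  show "f \<in> sigma_dual sc Z closure_of A"
    unfolding sigma_closure_iff
  proof (intro conjI allI impI fd)
    fix G :: "(('a \<Rightarrow>\<^sub>L 'k) \<Rightarrow> 'k) set" and e :: real
    assume G: "finite G \<and> G \<subseteq> Z \<and> 0 < e"
    have sub: "disc \<phi> \<subseteq> Z" if "\<phi> \<in> G" for \<phi>
    proof -
      have "\<phi> \<in> Z"
        using that G by blast
      then show ?thesis
        unfolding disc_def using mult[of \<phi>] by (intro image_subsetI)
    qed
    have "disc \<phi> \<subseteq> Z \<and> absolutely_convex (disc \<phi>) \<and> compactin (sigma_bidual sc Z) (disc \<phi>)"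
      if "\<phi> \<in> G" for \<phi>
      using sub[OF that] compact_imp_compactin_sigma_bidual[OF compact_disc sub[OF that]]
      by (simp add: absolutely_convex_disc)
    then have "finite (disc ` G) \<and>
        (\<forall>K\<in>disc ` G. K \<subseteq> Z \<and> absolutely_convex K \<and> compactin (sigma_bidual sc Z) K) \<and> 0 < e"
      using G by simp
    then have "\<exists>g\<in>A \<inter> dual_space sc. \<forall>K\<in>disc ` G. \<forall>\<phi>\<in>K. norm (\<phi> g - \<phi> f) < e"
      using f unfolding mackey_closure_iff by blast
    then show "\<exists>g\<in>A \<inter> dual_space sc. \<forall>\<phi>\<in>G. norm (\<phi> g - \<phi> f) < e"
      using self_in_disc by blast
  qed
qed

lemma mackey_closure_antimono:
  assumes "Z \<subseteq> Y"
  shows "mackey sc Y closure_of A \<subseteq> mackey sc Z closure_of A"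
proof
  fix f assume f: "f \<in> mackey sc Y closure_of A"
  then have fd: "f \<in> dual_space sc"
    unfolding mackey_closure_iff by (rule conjunct1)
  show "f \<in> mackey sc Z closure_of A"
    unfolding mackey_closure_iff
  proof (intro conjI allI impI fd)
    fix \<FF> and e :: real
    assume "finite \<FF> \<and> (\<forall>K\<in>\<FF>. K \<subseteq> Z \<and> absolutely_convex K \<and> compactin (sigma_bidual sc Z) K) \<and> 0 < e"
    then have "finite \<FF> \<and> (\<forall>K\<in>\<FF>. K \<subseteq> Y \<and> absolutely_convex K \<and> compactin (sigma_bidual sc Y) K) \<and> 0 < e"
      using compactin_sigma_bidual_mono[OF _ assms] assms by (meson subset_trans)
    then show "\<exists>g\<in>A \<inter> dual_space sc. \<forall>K\<in>\<FF>. \<forall>\<phi>\<in>K. norm (\<phi> g - \<phi> f) < e"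
      using f unfolding mackey_closure_iff by blast
  qed
qed

text \<open>The uniform boundedness principle, by Baire category in the complete space \<open>X\<^sup>*\<close>.\<close>

lemma uniform_boundedness_bidual:
  fixes sc :: "'k::real_or_complex \<Rightarrow> 'a::banach \<Rightarrow> 'a"
  assumes K: "K \<subseteq> bidual_space sc"
    and ptw: "\<And>f. f \<in> dual_space sc \<Longrightarrow> \<exists>M. \<forall>\<phi>\<in>K. norm (\<phi> f) \<le> M"
  shows "\<exists>M>0. \<forall>\<phi>\<in>K. \<forall>f. norm (\<phi> f) \<le> M * norm f"
proof -
  define T where "T = (\<lambda>n::nat. {f \<in> dual_space sc. \<forall>\<phi>\<in>K. norm (\<phi> f) \<le> real n})"
  have T_eq: "T n = dual_space sc \<inter> (\<Inter>\<phi>\<in>K. \<Inter>c\<in>{c. norm c = 1}. {f \<in> dual_space sc. re_part (c * \<phi> f) \<le> real n})" for n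
  proof -
    have "norm z \<le> real n \<longleftrightarrow> (\<forall>c. norm c = 1 \<longrightarrow> re_part (c * z) \<le> real n)" for z :: 'k
    proof
      assume z: "norm z \<le> real n"
      show "\<forall>c. norm c = 1 \<longrightarrow> re_part (c * z) \<le> real n"
      proof (intro allI impI)
        fix c :: 'k assume "norm c = 1"
        then show "re_part (c * z) \<le> real n"
          using re_part_le_norm[of "c * z"] z by (simp add: norm_mult)
      qed
    next
      assume *: "\<forall>c. norm c = 1 \<longrightarrow> re_part (c * z) \<le> real n"
      obtain c where "norm c = 1" "c * z = of_real (norm z)"
        by (rule unit_scalar_rotating)
      with * show "norm z \<le> real n"
        by (metis re_part_of_real)
    qed
    then show ?thesis
      unfolding T_def by auto
  qed
  have closed_T: "closed (T n)" for n
    unfolding T_eq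
  proof (intro closed_Int closed_dual_space closed_INT ballI)
    fix \<phi> c assume "\<phi> \<in> K"
    then have "\<phi> \<in> bidual_space sc"
      using K by blast
    from closed_halfspace[OF bidual_mult[OF this, of c]]
    show "closed {f \<in> dual_space sc. re_part (c * \<phi> f) \<le> real n}" .
  qed
  let ?X = "top_of_set (dual_space sc)"
  have union: "\<Union>(range T) = dual_space sc"
  proof (intro antisym subsetI)
    fix f assume f: "f \<in> dual_space sc"
    obtain M where M: "\<forall>\<phi>\<in>K. norm (\<phi> f) \<le> M"
      using ptw[OF f] by blast
    obtain n :: nat where "M \<le> real n"
      using real_arch_simple by blast
    with M f have "f \<in> T n"
      unfolding T_def by auto
    then show "f \<in> \<Union>(range T)"
      by blast
  qed (auto simp: T_def)
  have "\<exists>n. ?X interior_of T n \<noteq> {}"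
  proof (rule ccontr)
    assume empty: "\<not> ?thesis"
    have "completely_metrizable_space ?X"
      using closed_dual_space
      by (intro completely_metrizable_space_closedin completely_metrizable_space_euclidean) simp
    then have "completely_metrizable_space ?X \<or> locally_compact_space ?X \<and> regular_space ?X"
      by (rule disjI1)
    moreover have "countable (range T)"
      by simp
    moreover have "closedin ?X S \<and> ?X interior_of S = {}" if "S \<in> range T" for S
    proof -
      from that obtain n where n: "S = T n"
        by blast
      have "T n \<subseteq> dual_space sc"
        unfolding T_def by blast
      then have "closedin ?X (T n)"
        by (rule closed_subset[OF _ closed_T])
      with empty n show ?thesis
        by blast
    qed
    ultimately have "?X interior_of \<Union>(range T) = {}"
      by (rule Baire_category_alt)
    moreover have "?X interior_of dual_space sc = dual_space sc"
      by (metis interior_of_topspace topspace_euclidean_subtopology)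
    ultimately show False
      unfolding union using dual_space_0 by blast
  qed
  then obtain n f0 where "f0 \<in> ?X interior_of T n"
    by blast
  then obtain U where U: "openin ?X U" "f0 \<in> U" "U \<subseteq> T n"
    unfolding interior_of_def by blast
  then obtain r where r: "0 < r" "ball f0 r \<inter> dual_space sc \<subseteq> U"
    unfolding openin_contains_ball by blast
  have f0: "f0 \<in> T n"
    using U by blast
  \<comment> \<open>The summand \<open>1\<close> keeps the bound positive when \<open>n = 0\<close>.\<close>
  have bound: "norm (\<phi> f) \<le> (4 * real n + 1) / r * norm f" if \<phi>: "\<phi> \<in> K" for \<phi> f
  proof (cases "f \<in> dual_space sc \<and> f \<noteq> 0")
    case True
    have \<phi>b: "\<phi> \<in> bidual_space sc"
      using \<phi> K by blast
    define t where "t = r / (2 * norm f)"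
    have t: "0 < t"
      using True r(1) by (simp add: t_def)
    have "f0 + t *\<^sub>R f \<in> ball f0 r"
      using True r(1) t by (simp add: dist_norm t_def)
    moreover have "f0 + t *\<^sub>R f \<in> dual_space sc"
      using f0 True by (simp add: T_def dual_space_add dual_space_scaleR)
    ultimately have "f0 + t *\<^sub>R f \<in> T n"
      using r(2) U(3) by blast
    then have "norm (\<phi> (f0 + t *\<^sub>R f)) \<le> real n" "norm (\<phi> f0) \<le> real n"
      using f0 \<phi> unfolding T_def by blast+
    moreover have "\<phi> (f0 + t *\<^sub>R f) = \<phi> f0 + of_real t * \<phi> f"
      using f0 True bidual_add[OF \<phi>b] bidual_scaleR[OF \<phi>b] by (simp add: T_def dual_space_scaleR)
    ultimately have "norm (of_real t * \<phi> f) \<le> 2 * real n"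
      using norm_triangle_ineq4[of "\<phi> f0 + of_real t * \<phi> f" "\<phi> f0"] by simp
    then have "t * norm (\<phi> f) \<le> 2 * real n"
      using t by (simp add: norm_mult)
    then have "r * norm (\<phi> f) \<le> 4 * real n * norm f"
      using True by (simp add: t_def field_simps)
    also have "\<dots> \<le> (4 * real n + 1) * norm f"
      by (intro mult_right_mono) auto
    finally show ?thesis
      using r(1) by (simp add: field_simps)
  next
    case False
    have \<phi>b: "\<phi> \<in> bidual_space sc"
      using \<phi> K by blast
    then have "\<phi> f = 0"
      using False bidual_outside[OF \<phi>b, of f] bidual_scaleR[OF \<phi>b, of 0 0] by auto
    then show ?thesis
      using r(1) by simp
  qed
  show ?thesis
  proof (intro exI conjI ballI allI)
    show "0 < (4 * real n + 1) / r"
      using r(1) by (intro divide_pos_pos) auto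
  qed (rule bound)
qed

text \<open>
  The compact sets defining the Mackey topology are pointwise bounded, hence norm bounded, so
  uniform convergence on them follows from norm convergence.
\<close>

lemma closure_subset_mackey_closure:
  fixes sc :: "'k::real_or_complex \<Rightarrow> 'a::banach \<Rightarrow> 'a"
  assumes Z: "Z \<subseteq> bidual_space sc" and A: "A \<subseteq> dual_space sc"
  shows "closure A \<subseteq> mackey sc Z closure_of A"
proof
  fix f assume f: "f \<in> closure A"
  have fd: "f \<in> dual_space sc"
    using f closure_minimal[OF A closed_dual_space] by blast
  show "f \<in> mackey sc Z closure_of A"
    unfolding mackey_closure_iff
  proof (intro conjI allI impI fd)
    fix \<FF> :: "(('a \<Rightarrow>\<^sub>L 'k) \<Rightarrow> 'k) set set" and e :: real
    assume \<FF>: "finite \<FF> \<and> (\<forall>K\<in>\<FF>. K \<subseteq> Z \<and> absolutely_convex K \<and> compactin (sigma_bidual sc Z) K) \<and> 0 < e"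
    have sub: "\<Union>\<FF> \<subseteq> bidual_space sc"
      using \<FF> Z by blast
    have "\<exists>M. \<forall>\<phi>\<in>\<Union>\<FF>. norm (\<phi> g) \<le> M" if g: "g \<in> dual_space sc" for g
    proof -
      have "\<exists>M. \<forall>\<phi>\<in>K. norm (\<phi> g) \<le> M" if "K \<in> \<FF>" for K
      proof -
        have "compactin (sigma_bidual sc Z) K"
          using that \<FF> by blast
        then obtain M where "\<And>\<phi>. \<phi> \<in> K \<Longrightarrow> norm (\<phi> g) \<le> M"
          using compactin_sigma_bidual_bounded[OF _ g] by metis
        then show ?thesis
          by (intro exI[of _ M] ballI)
      qed
      then have "bounded (\<Union>K\<in>\<FF>. (\<lambda>\<phi>. \<phi> g) ` K)"
        using \<FF> by (intro bounded_Union finite_imageI) (auto simp: bounded_iff)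
      then obtain M where "\<forall>z\<in>(\<Union>K\<in>\<FF>. (\<lambda>\<phi>. \<phi> g) ` K). norm z \<le> M"
        unfolding bounded_iff by blast
      then show ?thesis
        by (intro exI[of _ M]) auto
    qed
    then have "\<exists>M>0. \<forall>\<phi>\<in>\<Union>\<FF>. \<forall>g. norm (\<phi> g) \<le> M * norm g"
      by (rule uniform_boundedness_bidual[OF sub])
    then obtain M where M: "0 < M" "\<forall>\<phi>\<in>\<Union>\<FF>. \<forall>g. norm (\<phi> g) \<le> M * norm g"
      by (elim exE conjE)
    have "0 < e / M"
      using \<FF> M(1) by simp
    then obtain g where g: "g \<in> A" "dist g f < e / M"
      using f unfolding closure_approachable by blast
    have gd: "g \<in> dual_space sc"
      using g(1) A by blast
    have "norm (\<phi> g - \<phi> f) < e" if "\<phi> \<in> \<Union>\<FF>" for \<phi>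
    proof -
      have "\<phi> \<in> bidual_space sc"
        using that sub by blast
      then have "norm (\<phi> g - \<phi> f) = norm (\<phi> (g - f))"
        using bidual_diff[OF _ gd fd] by simp
      also have "\<dots> \<le> M * norm (g - f)"
        using M(2) that by blast
      also have "\<dots> < e"
        using g(2) M(1) by (simp add: dist_norm field_simps)
      finally show ?thesis .
    qed
    then have "\<forall>K\<in>\<FF>. \<forall>\<phi>\<in>K. norm (\<phi> g - \<phi> f) < e"
      by blast
    moreover have "g \<in> A \<inter> dual_space sc"
      using g(1) gd by blast
    ultimately show "\<exists>g\<in>A \<inter> dual_space sc. \<forall>K\<in>\<FF>. \<forall>\<phi>\<in>K. norm (\<phi> g - \<phi> f) < e"
      by (rule bexI)
  qed
qed

text \<open>
  Tychonoff's theorem. Both forms of the Banach-Alaoglu theorem below cut down such a box by closed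
  conditions that express linearity.
\<close>

lemma compact_function_box: "compact {\<phi> :: 'b \<Rightarrow> 'k::real_or_complex. \<forall>f. norm (\<phi> f) \<le> r f}"
proof -
  have "compactin (product_topology (\<lambda>i::'b. euclidean :: 'k topology) UNIV) (PiE UNIV (\<lambda>f. cball 0 (r f)))"
    unfolding compactin_PiE by simp
  moreover have "PiE UNIV (\<lambda>f. cball 0 (r f)) = {\<phi> :: 'b \<Rightarrow> 'k. \<forall>f. norm (\<phi> f) \<le> r f}"
    by (auto simp: PiE_UNIV_domain Pi_iff)
  ultimately show ?thesis
    by (simp add: euclidean_product_topology)
qed

definition bidual_ball ::
  "('k::real_or_complex \<Rightarrow> 'a::banach \<Rightarrow> 'a) \<Rightarrow> (('a \<Rightarrow>\<^sub>L 'k) \<Rightarrow> 'k) set" where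
  "bidual_ball sc = {\<phi> \<in> bidual_space sc. \<forall>f. norm (\<phi> f) \<le> norm f}"

lemma compact_bidual_ball: "compact (bidual_ball sc)"
proof -
  have eq: "bidual_ball sc = {\<phi>. \<forall>f. norm (\<phi> f) \<le> norm f} \<inter>
     ((\<Inter>f\<in>- dual_space sc. {\<phi>. \<phi> f = 0}) \<inter>
     (\<Inter>f\<in>dual_space sc. \<Inter>g\<in>dual_space sc. {\<phi>. \<phi> (f + g) = \<phi> f + \<phi> g}) \<inter>
     (\<Inter>c. \<Inter>f\<in>dual_space sc. {\<phi>. \<phi> (blinfun_mult_right c o\<^sub>L f) = c * \<phi> f}))"
    (is "_ = ?A \<inter> ?B")
  proof (intro antisym subsetI)
    fix \<phi> assume "\<phi> \<in> ?A \<inter> ?B"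
    then show "\<phi> \<in> bidual_ball sc"
      unfolding bidual_ball_def bidual_space_def by (auto intro!: exI[of _ 1])
  qed (auto simp: bidual_ball_def bidual_space_def)
  have "closed ?B"
    by (intro closed_Int closed_INT ballI closed_Collect_eq continuous_intros
        continuous_on_product_coordinates)
  then show ?thesis
    unfolding eq by (rule compact_Int_closed[OF compact_function_box])
qed

lemma absolutely_convex_bidual_ball:
  fixes sc :: "'k::real_or_complex \<Rightarrow> 'a::banach \<Rightarrow> 'a"
  shows "absolutely_convex (bidual_ball sc)"
  unfolding absolutely_convex_def
proof (intro ballI allI impI)
  fix \<phi> \<psi> :: "('a \<Rightarrow>\<^sub>L 'k) \<Rightarrow> 'k" and a b :: 'k
  assume \<phi>: "\<phi> \<in> bidual_ball sc" and \<psi>: "\<psi> \<in> bidual_ball sc" and ab: "norm a + norm b \<le> 1"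
  have bd: "\<phi> \<in> bidual_space sc" "\<psi> \<in> bidual_space sc"
    using \<phi> \<psi> by (simp_all add: bidual_ball_def)
  have le: "norm (a * \<phi> f + b * \<psi> f) \<le> norm f" for f
  proof -
    have "norm (a * \<phi> f + b * \<psi> f) \<le> norm a * norm (\<phi> f) + norm b * norm (\<psi> f)"
      by (rule order_trans[OF norm_triangle_ineq]) (simp add: norm_mult)
    also have "\<dots> \<le> norm a * norm f + norm b * norm f"
      using \<phi> \<psi> by (intro add_mono mult_left_mono) (auto simp: bidual_ball_def)
    also have "\<dots> \<le> 1 * norm f"
      using mult_right_mono[OF ab, of "norm f"] by (simp add: distrib_right)
    finally show ?thesis by simp
  qed
  have "(\<lambda>f. a * \<phi> f + b * \<psi> f) \<in> bidual_space sc"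
    by (rule bidualI[where M = 1])
       (simp_all add: bidual_outside[OF bd(1)] bidual_outside[OF bd(2)] bidual_add[OF bd(1)]
         bidual_add[OF bd(2)] bidual_scale[OF bd(1)] bidual_scale[OF bd(2)] algebra_simps
         le[unfolded distrib_left])
  then show "(\<lambda>f. a * \<phi> f + b * \<psi> f) \<in> bidual_ball sc"
    using le by (simp add: bidual_ball_def)
qed

section \<open>Baire-one functionals and functionals of countable type\<close>

lemma continuous_map_mult_bidual:
  fixes sc :: "'k::real_or_complex \<Rightarrow> 'a::banach \<Rightarrow> 'a"
  shows "continuous_map (weak_star_bidual sc) (weak_star_bidual sc) (\<lambda>\<phi> f. c * \<phi> f)"
  unfolding weak_star_bidual_def sigma_bidual_def
proof (rule continuous_map_initial_topology)
  fix \<phi> assume "\<phi> \<in> topspace (initial_topology (bidual_space sc) ((\<lambda>f \<phi>. \<phi> f) ` dual_space sc))"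
  then have "\<phi> \<in> bidual_space sc"
    by simp
  then show "(\<lambda>f. c * \<phi> f) \<in> bidual_space sc"
    by (rule bidual_mult)
next
  fix \<Phi> :: "(('a \<Rightarrow>\<^sub>L 'k) \<Rightarrow> 'k) \<Rightarrow> 'k"
  assume "\<Phi> \<in> (\<lambda>f \<phi>. \<phi> f) ` dual_space sc"
  then obtain f where f: "\<Phi> = (\<lambda>\<phi>. \<phi> f)" "f \<in> dual_space sc"
    by blast
  have "continuous_map (initial_topology (bidual_space sc) ((\<lambda>f \<phi>. \<phi> f) ` dual_space sc)) euclidean (\<lambda>\<phi>. \<phi> f)"
    by (rule continuous_map_eval_initial_topology) (rule imageI[OF f(2)])
  moreover have "continuous_map euclidean euclidean (\<lambda>z::'k. c * z)"
    by (simp add: continuous_intros)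
  ultimately have "continuous_map (initial_topology (bidual_space sc) ((\<lambda>f \<phi>. \<phi> f) ` dual_space sc)) euclidean
      ((\<lambda>z. c * z) \<circ> (\<lambda>\<phi>. \<phi> f))"
    by (rule continuous_map_compose)
  then show "continuous_map (initial_topology (bidual_space sc) ((\<lambda>f \<phi>. \<phi> f) ` dual_space sc)) euclidean
      (\<lambda>\<phi>. \<Phi> (\<lambda>f. c * \<phi> f))"
    by (simp add: f(1) o_def)
qed

lemma topspace_weak_star_bidual [simp]: "topspace (weak_star_bidual sc) = bidual_space sc"
  by (simp add: weak_star_bidual_def)

lemma B1_subset_bidual: "B1_set sc \<subseteq> bidual_space sc"
  unfolding B1_set_def by blast

lemma C_subset_bidual: "C_set sc \<subseteq> bidual_space sc"
  unfolding C_set_def by blast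

lemma embedded_subset_B1: "embedded_space sc \<subseteq> B1_set sc"
proof
  fix \<phi> assume "\<phi> \<in> embedded_space sc"
  then obtain x where x: "\<phi> = canonical_embedding sc x"
    unfolding embedded_space_def by blast
  have b: "\<phi> \<in> bidual_space sc"
    unfolding x by (rule canonical_embedding_in_bidual)
  then have "limitin (weak_star_bidual sc) (\<lambda>n. canonical_embedding sc x) \<phi> sequentially"
    by (simp add: x limitin_const_iff)
  with b show "\<phi> \<in> B1_set sc"
    unfolding B1_set_def by (intro CollectI conjI exI[of _ "\<lambda>_. x"])
qed

lemma B1_subset_C: "B1_set sc \<subseteq> C_set sc"
proof
  fix \<phi> assume "\<phi> \<in> B1_set sc"
  then obtain x where b: "\<phi> \<in> bidual_space sc"
    and lim: "limitin (weak_star_bidual sc) (\<lambda>n::nat. canonical_embedding sc (x n)) \<phi> sequentially"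
    unfolding B1_set_def by blast
  have "\<phi> \<in> weak_star_bidual sc closure_of (canonical_embedding sc ` range x)"
  proof (rule limitin_closedin[OF lim closedin_closure_of])
    have "canonical_embedding sc (x n) \<in> weak_star_bidual sc closure_of (canonical_embedding sc ` range x)" for n
      by (rule subsetD[OF closure_of_subset]) (auto simp: canonical_embedding_in_bidual)
    then show "\<forall>\<^sub>F n in sequentially. canonical_embedding sc (x n)
        \<in> weak_star_bidual sc closure_of (canonical_embedding sc ` range x)"
      by simp
  qed simp
  moreover have "countable (range x)"
    by simp
  ultimately show "\<phi> \<in> C_set sc"
    unfolding C_set_def using b by blast
qed

lemma B1_mult:
  assumes "\<phi> \<in> B1_set sc"
  shows "(\<lambda>f. c * \<phi> f) \<in> B1_set sc"
proof -
  obtain x where b: "\<phi> \<in> bidual_space sc"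
    and lim: "limitin (weak_star_bidual sc) (\<lambda>n::nat. canonical_embedding sc (x n)) \<phi> sequentially"
    using assms unfolding B1_set_def by blast
  have "limitin (weak_star_bidual sc) ((\<lambda>\<phi> f. c * \<phi> f) \<circ> (\<lambda>n. canonical_embedding sc (x n)))
      (\<lambda>f. c * \<phi> f) sequentially"
    by (rule continuous_map_limit[OF continuous_map_mult_bidual lim])
  then have "limitin (weak_star_bidual sc) (\<lambda>n. canonical_embedding sc (sc c (x n)))
      (\<lambda>f. c * \<phi> f) sequentially"
    unfolding o_def mult_canonical_embedding .
  then show ?thesis
    unfolding B1_set_def using bidual_mult[OF b, of c]
    by (intro CollectI conjI exI[of _ "\<lambda>n. sc c (x n)"])
qed

lemma C_mult:
  assumes "\<phi> \<in> C_set sc"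
  shows "(\<lambda>f. c * \<phi> f) \<in> C_set sc"
proof -
  obtain D where b: "\<phi> \<in> bidual_space sc" and D: "countable D"
    and cl: "\<phi> \<in> weak_star_bidual sc closure_of (canonical_embedding sc ` D)"
    using assms unfolding C_set_def by blast
  let ?m = "\<lambda>\<phi> f. c * \<phi> f"
  have "?m \<phi> \<in> ?m ` (weak_star_bidual sc closure_of (canonical_embedding sc ` D))"
    by (rule imageI[OF cl])
  also have "\<dots> \<subseteq> weak_star_bidual sc closure_of (?m ` canonical_embedding sc ` D)"
    by (rule continuous_map_image_closure_subset[OF continuous_map_mult_bidual])
  also have "?m ` canonical_embedding sc ` D = canonical_embedding sc ` sc c ` D"
    unfolding image_image mult_canonical_embedding ..
  finally have "?m \<phi> \<in> weak_star_bidual sc closure_of (canonical_embedding sc ` sc c ` D)" .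
  moreover have "countable (sc c ` D)"
    using D by simp
  ultimately show ?thesis
    unfolding C_set_def using bidual_mult[OF b, of c] by blast
qed

lemma bidual_sub:
  assumes "\<phi> \<in> bidual_space sc" "\<psi> \<in> bidual_space sc"
  shows "(\<lambda>f. \<phi> f - \<psi> f) \<in> bidual_space sc"
proof -
  obtain M where M: "\<And>f. norm (\<phi> f) \<le> M * norm f"
    by (rule bidual_bound[OF assms(1)]) (rule that)
  obtain N where N: "\<And>f. norm (\<psi> f) \<le> N * norm f"
    by (rule bidual_bound[OF assms(2)]) (rule that)
  have le: "norm (\<phi> f - \<psi> f) \<le> (M + N) * norm f" for f
    using norm_triangle_ineq4[of "\<phi> f" "\<psi> f"] M[of f] N[of f] by (simp add: distrib_right)
  show ?thesis
  proof (rule bidualI)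
    fix f assume "f \<notin> dual_space sc"
    then show "\<phi> f - \<psi> f = 0"
      by (simp add: bidual_outside[OF assms(1)] bidual_outside[OF assms(2)])
  next
    fix f g assume "f \<in> dual_space sc" "g \<in> dual_space sc"
    then show "\<phi> (f + g) - \<psi> (f + g) = \<phi> f - \<psi> f + (\<phi> g - \<psi> g)"
      by (simp add: bidual_add[OF assms(1)] bidual_add[OF assms(2)])
  next
    fix c f assume "f \<in> dual_space sc"
    then show "\<phi> (dual_scale c f) - \<psi> (dual_scale c f) = c * (\<phi> f - \<psi> f)"
      by (simp add: bidual_scale[OF assms(1)] bidual_scale[OF assms(2)] algebra_simps)
  qed (rule le)
qed

section \<open>Helly's theorem\<close>

definition annihilator :: "('a::real_normed_vector \<Rightarrow>\<^sub>L 'k::real_normed_vector) set \<Rightarrow> 'a set" where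
  "annihilator F = {x. \<forall>f\<in>F. blinfun_apply f x = 0}"

text \<open>
  A functional that vanishes on the common kernel of finitely many others is a linear combination
  of them; testing with an element of the bidual avoids the coefficients.
\<close>

lemma bidual_vanishes_on_span:
  fixes sc :: "'k::real_or_complex \<Rightarrow> 'a::banach \<Rightarrow> 'a"
  assumes sc: "banach_over sc" and \<psi>: "\<psi> \<in> bidual_space sc"
    and F: "finite F" "F \<subseteq> dual_space sc" "\<And>f. f \<in> F \<Longrightarrow> \<psi> f = 0"
    and g: "g \<in> dual_space sc" "\<And>x. x \<in> annihilator F \<Longrightarrow> blinfun_apply g x = 0"
  shows "\<psi> g = 0"
  using F g
proof (induction F arbitrary: g)
  case empty
  then have "g = 0"
    by (intro blinfun_eqI) (simp add: annihilator_def)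
  then show ?case
    using bidual_scaleR[OF \<psi>, of 0 0] by simp
next
  case (insert f F)
  have fd: "f \<in> dual_space sc"
    using insert.prems(1) by blast
  have IH: "\<psi> h = 0" if h: "h \<in> dual_space sc" "\<And>x. x \<in> annihilator F \<Longrightarrow> blinfun_apply h x = 0" for h
    by (rule insert.IH) (use insert.prems(1,2) h in auto)
  show ?case
  proof (cases "\<forall>x\<in>annihilator F. blinfun_apply f x = 0")
    case True
    then have "annihilator F \<subseteq> annihilator (insert f F)"
      by (auto simp: annihilator_def)
    then show ?thesis
      using insert.prems(3,4) by (intro IH) auto
  next
    case False
    then obtain y where y: "y \<in> annihilator F" "blinfun_apply f y \<noteq> 0"
      by blast
    define c where "c = blinfun_apply g y / blinfun_apply f y"
    have h: "g - dual_scale c f \<in> dual_space sc"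
      using insert.prems(3) fd by (intro dual_space_diff dual_space_dual_scale)
    have "\<psi> (g - dual_scale c f) = 0"
    proof (rule IH[OF h])
      fix x assume x: "x \<in> annihilator F"
      let ?z = "x - sc (blinfun_apply f x / blinfun_apply f y) y"
      have "?z \<in> annihilator (insert f F)"
        unfolding annihilator_def
      proof (intro CollectI ballI)
        fix k assume k: "k \<in> insert f F"
        then have "k \<in> dual_space sc"
          using insert.prems(1) by blast
        then have "blinfun_apply k ?z = blinfun_apply k x - blinfun_apply f x / blinfun_apply f y * blinfun_apply k y"
          by (simp add: blinfun.diff_right dual_spaceD)
        also have "\<dots> = 0"
          using k x y by (auto simp: annihilator_def)
        finally show "blinfun_apply k ?z = 0" .
      qed
      then have "blinfun_apply g ?z = 0"
        by (rule insert.prems(4))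
      then show "blinfun_apply (g - dual_scale c f) x = 0"
        using y(2) by (simp add: blinfun.diff_right blinfun.diff_left dual_spaceD[OF insert.prems(3)] c_def field_simps)
    qed
    then have "\<psi> g = \<psi> (dual_scale c f)"
      using bidual_diff[OF \<psi> insert.prems(3) dual_space_dual_scale[OF fd]] by simp
    also have "\<dots> = 0"
      using bidual_scale[OF \<psi> fd] insert.prems(2)[of f] by simp
    finally show ?thesis .
  qed
qed

lemma bidual_interpolation:
  fixes sc :: "'k::real_or_complex \<Rightarrow> 'a::banach \<Rightarrow> 'a"
  assumes sc: "banach_over sc" and \<phi>: "\<phi> \<in> bidual_space sc"
    and F: "finite F" "F \<subseteq> dual_space sc"
  shows "\<exists>x. \<forall>f\<in>F. blinfun_apply f x = \<phi> f"
  using F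
proof (induction F)
  case (insert f F)
  then have Fd: "F \<subseteq> dual_space sc" and fd: "f \<in> dual_space sc"
    by auto
  obtain x where x: "\<forall>f\<in>F. blinfun_apply f x = \<phi> f"
    using insert.IH[OF Fd] by (elim exE)
  show ?case
  proof (cases "\<forall>y\<in>annihilator F. blinfun_apply f y = 0")
    case True
    let ?\<psi> = "\<lambda>f. \<phi> f - canonical_embedding sc x f"
    have "?\<psi> f = 0"
    proof (rule bidual_vanishes_on_span[OF sc _ insert.hyps(1) Fd _ fd])
      show "?\<psi> \<in> bidual_space sc"
        by (rule bidual_sub[OF \<phi> canonical_embedding_in_bidual])
      show "?\<psi> k = 0" if "k \<in> F" for k
        using that x Fd by (simp add: canonical_embedding_apply subsetD)
    qed (use True in blast)
    then have "blinfun_apply f x = \<phi> f"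
      using fd by (simp add: canonical_embedding_apply)
    with x show ?thesis
      by (intro exI[of _ x]) simp
  next
    case False
    then obtain y where y: "y \<in> annihilator F" "blinfun_apply f y \<noteq> 0"
      by blast
    let ?x = "x + sc ((\<phi> f - blinfun_apply f x) / blinfun_apply f y) y"
    have "blinfun_apply k ?x = \<phi> k" if "k \<in> insert f F" for k
    proof -
      have "k \<in> dual_space sc"
        using that Fd fd by blast
      then have "blinfun_apply k ?x = blinfun_apply k x + (\<phi> f - blinfun_apply f x) / blinfun_apply f y * blinfun_apply k y"
        by (simp add: blinfun.add_right dual_spaceD)
      also have "\<dots> = \<phi> k"
        using that x y by (auto simp: annihilator_def)
      finally show ?thesis .
    qed
    then show ?thesis
      by (intro exI[of _ ?x] ballI)
  qed
qed simp

text \<open>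
  Some \<open>x\<close> interpolates \<open>\<phi>\<close> on \<open>F\<close> exactly, and its distance from the annihilator \<open>W\<close> of \<open>F\<close> is at most \<open>M\<close>:
  a functional \<open>h\<close> of norm at most \<open>1\<close> that vanishes on \<open>W\<close> and exceeds \<open>M\<close> at \<open>x\<close> would satisfy \<open>\<phi> h = h x\<close>, since it
  depends linearly on \<open>F\<close>, against \<open>|\<phi> h| \<le> M\<close>.
\<close>

theorem Helly_bidual:
  fixes sc :: "'k::real_or_complex \<Rightarrow> 'a::banach \<Rightarrow> 'a"
  assumes sc: "banach_over sc" and \<phi>: "\<phi> \<in> bidual_space sc"
    and M: "\<And>f. norm (\<phi> f) \<le> M * norm f" "0 < M"
    and F: "finite F" "F \<subseteq> dual_space sc"
  shows "\<exists>x. norm x \<le> M + 1 \<and> (\<forall>f\<in>F. blinfun_apply f x = \<phi> f)"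
proof (rule ccontr)
  assume none: "\<not> ?thesis"
  obtain x where x: "\<forall>f\<in>F. blinfun_apply f x = \<phi> f"
    using bidual_interpolation[OF sc \<phi> F] by (elim exE)
  let ?W = "annihilator F"
  have zero: "0 \<in> ?W"
    by (simp add: annihilator_def)
  have scale: "sc c w \<in> ?W" if "w \<in> ?W" for c w
    using that F(2) by (auto simp: annihilator_def dual_spaceD subset_iff)
  have conv: "convex ?W"
    by (rule convexI) (simp add: annihilator_def blinfun.add_right blinfun.scaleR_right)
  have far: "M + 1 \<le> norm (x - w)" if w: "w \<in> ?W" for w
  proof (rule ccontr)
    assume "\<not> M + 1 \<le> norm (x - w)"
    moreover have "\<forall>f\<in>F. blinfun_apply f (x - w) = \<phi> f"
      using x w by (simp add: blinfun.diff_right annihilator_def)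
    ultimately have "norm (x - w) \<le> M + 1 \<and> (\<forall>f\<in>F. blinfun_apply f (x - w) = \<phi> f)"
      by simp
    then show False
      using none by blast
  qed
  have "?W \<noteq> {}"
    using zero by blast
  then obtain g :: "'a \<Rightarrow> 'k" where g: "\<And>y z. g (y + z) = g y + g z" "\<And>c y. g (sc c y) = c * g y"
    "\<And>y. norm (g y) \<le> norm y" "\<And>w. w \<in> ?W \<Longrightarrow> re_part (g w) \<le> re_part (g x) - (M + 1)"
    by (rule scalar_separation[OF sc conv _ far]) (assumption, rule that)
  have "norm (g y) \<le> norm y * 1" for y
    using g(3) by simp
  then obtain h where h: "h \<in> dual_space sc" "\<And>y. blinfun_apply h y = g y"
    by (rule dual_spaceI[OF sc g(1) g(2)]) (rule that)
  have gW: "g w = 0" if w: "w \<in> ?W" for w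
  proof (rule ccontr)
    assume "g w \<noteq> 0"
    define b where "b = \<bar>re_part (g x) - (M + 1)\<bar> + 1"
    have "re_part (g (sc (of_real b / g w) w)) \<le> re_part (g x) - (M + 1)"
      by (rule g(4)[OF scale[OF w]])
    moreover have "g (sc (of_real b / g w) w) = of_real b"
      using g(2)[of "of_real b / g w" w] \<open>g w \<noteq> 0\<close> by simp
    ultimately have "b \<le> re_part (g x) - (M + 1)"
      by (simp only: re_part_of_real)
    then show False
      unfolding b_def by linarith
  qed
  let ?\<psi> = "\<lambda>f. \<phi> f - canonical_embedding sc x f"
  have "?\<psi> h = 0"
  proof (rule bidual_vanishes_on_span[OF sc _ F _ h(1)])
    show "?\<psi> \<in> bidual_space sc"
      by (rule bidual_sub[OF \<phi> canonical_embedding_in_bidual])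
    show "?\<psi> k = 0" if "k \<in> F" for k
      using that x F(2) by (simp add: canonical_embedding_apply subsetD)
    show "blinfun_apply h y = 0" if "y \<in> annihilator F" for y
      unfolding h(2) by (rule gW[OF that])
  qed
  then have \<phi>h: "\<phi> h = g x"
    using h by (simp add: canonical_embedding_apply)
  have "norm h \<le> 1"
    using g(3) h(2) by (intro norm_blinfun_bound) auto
  then have "norm (g x) \<le> M"
    using M(1)[of h] mult_left_le[of "norm h" M] M(2) unfolding \<phi>h by linarith
  moreover have "M + 1 \<le> re_part (g x)"
    using g(4)[OF zero] gW[OF zero] by simp
  ultimately show False
    using re_part_le_norm[of "g x"] by simp
qed

lemma separable_dense_sequence:
  assumes "separable_space (euclidean :: 'a::metric_space topology)"
  obtains D :: "'a::metric_space set" where "countable D" "\<And>x e. 0 < e \<Longrightarrow> \<exists>y\<in>D. dist y x < e"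
proof -
  obtain D :: "'a set" where D: "countable D" "closure D = UNIV"
    using assms unfolding separable_space_def by auto
  then have "\<And>x e. 0 < e \<Longrightarrow> \<exists>y\<in>D. dist y x < e"
    using closure_approachable by blast
  with D(1) show ?thesis
    by (rule that)
qed

lemma Helly_dense:
  fixes sc :: "'k::real_or_complex \<Rightarrow> 'a::banach \<Rightarrow> 'a"
  assumes sc: "banach_over sc" and \<phi>: "\<phi> \<in> bidual_space sc"
    and M: "\<And>f. norm (\<phi> f) \<le> M * norm f" "0 < M"
    and F: "finite F" "F \<subseteq> dual_space sc"
    and D: "\<And>x e. 0 < e \<Longrightarrow> \<exists>y\<in>D. dist y x < e" and e: "0 < e"
  shows "\<exists>y\<in>D. norm y \<le> M + 2 \<and> (\<forall>f\<in>F. norm (blinfun_apply f y - \<phi> f) < e)"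
proof -
  obtain x where x: "norm x \<le> M + 1" "\<forall>f\<in>F. blinfun_apply f x = \<phi> f"
    using Helly_bidual[OF sc \<phi> M F] by (elim exE conjE)
  define N where "N = 1 + sum norm F"
  have N: "0 < N" "norm f \<le> N" if "f \<in> F" for f
    using member_le_sum[of f F norm] sum_nonneg[of F norm] F(1) that unfolding N_def by auto
  have N0: "0 < N"
    unfolding N_def using sum_nonneg[of F norm] by (simp add: add_pos_nonneg)
  have "0 < min 1 (e / N)"
    using e N0 by simp
  then obtain y where y: "y \<in> D" "dist y x < min 1 (e / N)"
    using D by blast
  have "norm (blinfun_apply f y - \<phi> f) < e" if "f \<in> F" for f
  proof -
    have "blinfun_apply f y - \<phi> f = blinfun_apply f (y - x)"
      using x(2) that by (simp add: blinfun.diff_right)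
    then have "norm (blinfun_apply f y - \<phi> f) \<le> N * norm (y - x)"
      using norm_blinfun[of f "y - x"] mult_right_mono[OF N(2)[OF that], of "norm (y - x)"] by simp
    also have "\<dots> < e"
      using y(2) N0 by (simp add: dist_norm field_simps)
    finally show ?thesis .
  qed
  moreover have "norm y \<le> M + 2"
    using norm_triangle_ineq[of x "y - x"] x(1) y(2) by (simp add: dist_norm)
  ultimately show ?thesis
    using y(1) by blast
qed

text \<open>
  By Helly's theorem the image of any norm-dense subset of \<open>X\<close> is weak-star dense in the bidual.
\<close>

lemma C_set_separable:
  fixes sc :: "'k::real_or_complex \<Rightarrow> 'a::banach \<Rightarrow> 'a"
  assumes sc: "banach_over sc" and sep: "separable_space (euclidean :: 'a topology)"
  shows "C_set sc = bidual_space sc"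
proof (intro antisym C_subset_bidual subsetI)
  fix \<phi> assume \<phi>: "\<phi> \<in> bidual_space sc"
  obtain D :: "'a set" where D: "countable D" "\<And>x e. 0 < e \<Longrightarrow> \<exists>y\<in>D. dist y x < e"
    by (rule separable_dense_sequence[OF sep]) (rule that)
  obtain M where M: "0 < M" "\<And>f. norm (\<phi> f) \<le> M * norm f"
    by (rule bidual_bound[OF \<phi>]) (rule that)
  have "\<phi> \<in> weak_star_bidual sc closure_of (canonical_embedding sc ` D)"
    unfolding weak_star_bidual_def sigma_bidual_def closure_of_initial_topology_iff
  proof (intro conjI allI impI \<phi>)
    fix G :: "((('a \<Rightarrow>\<^sub>L 'k) \<Rightarrow> 'k) \<Rightarrow> 'k) set" and e :: real
    assume G: "finite G \<and> G \<subseteq> (\<lambda>f \<phi>. \<phi> f) ` dual_space sc \<and> 0 < e"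
    then obtain F where F: "F \<subseteq> dual_space sc" "finite F" "G = (\<lambda>f \<phi>. \<phi> f) ` F"
      using finite_subset_image by metis
    have e: "0 < e"
      using G by blast
    have "\<exists>y\<in>D. norm y \<le> M + 2 \<and> (\<forall>f\<in>F. norm (blinfun_apply f y - \<phi> f) < e)"
      by (rule Helly_dense[OF sc \<phi> M(2) M(1) F(2,1) D(2) e])
    then obtain y where y: "y \<in> D" "\<forall>f\<in>F. norm (blinfun_apply f y - \<phi> f) < e"
      by (elim bexE conjE)
    have "\<forall>\<Phi>\<in>G. norm (\<Phi> (canonical_embedding sc y) - \<Phi> \<phi>) < e"
      unfolding F(3) using y(2) F(1) by (auto simp: canonical_embedding_apply subsetD)
    moreover have "canonical_embedding sc y \<in> canonical_embedding sc ` D \<inter> bidual_space sc"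
      using y(1) canonical_embedding_in_bidual by blast
    ultimately show "\<exists>\<psi>\<in>canonical_embedding sc ` D \<inter> bidual_space sc. \<forall>\<Phi>\<in>G. norm (\<Phi> \<psi> - \<Phi> \<phi>) < e"
      by (rule bexI)
  qed
  with \<phi> D(1) show "\<phi> \<in> C_set sc"
    unfolding C_set_def by blast
qed

text \<open>
  Uniform convergence on the unit ball of the bidual is norm convergence, and that ball is
  one of the sets defining \<open>\<mu>(X\<^sup>*, C(X))\<close> because \<open>C(X)\<close> is the whole bidual.
\<close>

lemma mackey_C_closure_separable:
  fixes sc :: "'k::real_or_complex \<Rightarrow> 'a::banach \<Rightarrow> 'a"
  assumes sc: "banach_over sc" and sep: "separable_space (euclidean :: 'a topology)"
  shows "mackey sc (C_set sc) closure_of A \<subseteq> closure A"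
proof
  fix f assume f: "f \<in> mackey sc (C_set sc) closure_of A"
  then have fd: "f \<in> dual_space sc"
    unfolding mackey_closure_iff by (rule conjunct1)
  have ball: "bidual_ball sc \<subseteq> bidual_space sc"
    unfolding bidual_ball_def by blast
  show "f \<in> closure A"
    unfolding closure_approachable
  proof (intro allI impI)
    fix e :: real assume e: "0 < e"
    have "finite {bidual_ball sc} \<and> (\<forall>K\<in>{bidual_ball sc}. K \<subseteq> C_set sc \<and> absolutely_convex K \<and>
        compactin (sigma_bidual sc (C_set sc)) K) \<and> 0 < e / 2"
      unfolding C_set_separable[OF sc sep] ball_simps
      by (intro conjI ball absolutely_convex_bidual_ball
          compact_imp_compactin_sigma_bidual[OF compact_bidual_ball ball] TrueI) (simp_all add: e)
    then have "\<exists>g\<in>A \<inter> dual_space sc. \<forall>K\<in>{bidual_ball sc}. \<forall>\<phi>\<in>K. norm (\<phi> g - \<phi> f) < e / 2"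
      using f unfolding mackey_closure_iff by blast
    then obtain g where g: "g \<in> A" "g \<in> dual_space sc" "\<forall>\<phi>\<in>bidual_ball sc. norm (\<phi> g - \<phi> f) < e / 2"
      by blast
    have "norm (g - f) \<le> e / 2"
    proof (rule dual_norm_le[OF sc dual_space_diff[OF g(2) fd]])
      fix x :: 'a assume x: "norm x \<le> 1"
      have "norm (canonical_embedding sc x h) \<le> norm h" for h
        using norm_canonical_embedding_le[of sc x h] mult_right_mono[OF x, of "norm h"] by simp
      then have "canonical_embedding sc x \<in> bidual_ball sc"
        by (simp add: bidual_ball_def canonical_embedding_in_bidual)
      then have "norm (blinfun_apply (g - f) x) < e / 2"
        using g(2,3) fd by (force simp: canonical_embedding_apply blinfun.diff_left)
      then show "re_part (blinfun_apply (g - f) x) \<le> e / 2"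
        using re_part_le_norm[of "blinfun_apply (g - f) x"] by linarith
    qed
    then have "dist g f < e"
      using e by (simp add: dist_norm)
    with g(1) show "\<exists>g\<in>A. dist g f < e"
      by blast
  qed
qed

section \<open>Convex sets in weak topologies\<close>

lemma convex_sigma_closure:
  fixes sc :: "'k::real_or_complex \<Rightarrow> 'a::banach \<Rightarrow> 'a"
  assumes Z: "Z \<subseteq> bidual_space sc" and C: "convex C" "C \<subseteq> dual_space sc"
  shows "convex (sigma_dual sc Z closure_of C)"
proof (rule convexI)
  fix f g and u v :: real
  assume f: "f \<in> sigma_dual sc Z closure_of C" and g: "g \<in> sigma_dual sc Z closure_of C"
    and uv: "0 \<le> u" "0 \<le> v" "u + v = 1"
  have fd: "f \<in> dual_space sc" "g \<in> dual_space sc"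
    using f g sigma_closure_subset_dual by blast+
  show "u *\<^sub>R f + v *\<^sub>R g \<in> sigma_dual sc Z closure_of C"
    unfolding sigma_closure_iff
  proof (intro conjI allI impI)
    show "u *\<^sub>R f + v *\<^sub>R g \<in> dual_space sc"
      using fd by (intro dual_space_add dual_space_scaleR)
    fix G :: "(('a \<Rightarrow>\<^sub>L 'k) \<Rightarrow> 'k) set" and e :: real
    assume G: "finite G \<and> G \<subseteq> Z \<and> 0 < e"
    have "\<exists>h\<in>C \<inter> dual_space sc. \<forall>\<phi>\<in>G. norm (\<phi> h - \<phi> f) < e"
      using f G unfolding sigma_closure_iff by blast
    then obtain h where h: "h \<in> C" "h \<in> dual_space sc" "\<forall>\<phi>\<in>G. norm (\<phi> h - \<phi> f) < e"
      by blast
    have "\<exists>k\<in>C \<inter> dual_space sc. \<forall>\<phi>\<in>G. norm (\<phi> k - \<phi> g) < e"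
      using g G unfolding sigma_closure_iff by blast
    then obtain k where k: "k \<in> C" "k \<in> dual_space sc" "\<forall>\<phi>\<in>G. norm (\<phi> k - \<phi> g) < e"
      by blast
    have "norm (\<phi> (u *\<^sub>R h + v *\<^sub>R k) - \<phi> (u *\<^sub>R f + v *\<^sub>R g)) < e" if "\<phi> \<in> G" for \<phi>
    proof -
      have \<phi>: "\<phi> \<in> bidual_space sc"
        using that G Z by blast
      have lin: "\<phi> (u *\<^sub>R a + v *\<^sub>R b) = of_real u * \<phi> a + of_real v * \<phi> b"
        if "a \<in> dual_space sc" "b \<in> dual_space sc" for a b
        using bidual_add[OF \<phi> dual_space_scaleR[OF that(1), of u] dual_space_scaleR[OF that(2), of v]]
          bidual_scaleR[OF \<phi> that(1), of u] bidual_scaleR[OF \<phi> that(2), of v] by simp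
      have "\<phi> (u *\<^sub>R h + v *\<^sub>R k) - \<phi> (u *\<^sub>R f + v *\<^sub>R g)
          = of_real u * (\<phi> h - \<phi> f) + of_real v * (\<phi> k - \<phi> g)"
        by (simp add: lin h(2) k(2) fd algebra_simps)
      then have "norm (\<phi> (u *\<^sub>R h + v *\<^sub>R k) - \<phi> (u *\<^sub>R f + v *\<^sub>R g))
          \<le> u * norm (\<phi> h - \<phi> f) + v * norm (\<phi> k - \<phi> g)"
        using norm_triangle_ineq[of "of_real u * (\<phi> h - \<phi> f)" "of_real v * (\<phi> k - \<phi> g)"] uv
        by (simp add: norm_mult)
      also have "\<dots> < e"
        using h(3) k(3) that uv by (intro convex_bound_lt) auto
      finally show ?thesis .
    qed
    moreover have "u *\<^sub>R h + v *\<^sub>R k \<in> C \<inter> dual_space sc"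
      using convexD[OF C(1) h(1) k(1) uv] C(2) by blast
    ultimately show "\<exists>g'\<in>C \<inter> dual_space sc. \<forall>\<phi>\<in>G. norm (\<phi> g' - \<phi> (u *\<^sub>R f + v *\<^sub>R g)) < e"
      by (intro bexI[of _ "u *\<^sub>R h + v *\<^sub>R k"] ballI)
  qed
qed

lemma convex_hull_subset_dual: "A \<subseteq> dual_space sc \<Longrightarrow> convex hull A \<subseteq> dual_space sc"
  by (simp add: hull_minimal convex_dual_space)

lemma sigma_hull_subset_halfspace:
  assumes "\<phi> \<in> Z" "Z \<subseteq> bidual_space sc" "A \<subseteq> halfspace sc \<phi> r"
  shows "sigma_dual sc Z closure_of (convex hull A) \<subseteq> halfspace sc \<phi> r"
proof (rule closure_of_minimal)
  have "\<phi> \<in> bidual_space sc"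
    using assms(1,2) by blast
  then show "convex hull A \<subseteq> halfspace sc \<phi> r"
    by (intro hull_minimal assms(3) convex_halfspace)
qed (rule closedin_halfspace[OF assms(1)])

lemma embedded_nonempty: "embedded_space sc \<noteq> {}"
  unfolding embedded_space_def by simp

lemma canonical_in_embedded: "canonical_embedding sc x \<in> embedded_space sc"
  unfolding embedded_space_def by (rule rangeI)

section \<open>Elementary properties of the envelopes\<close>

lemma subset_sigma_closure: "A \<subseteq> dual_space sc \<Longrightarrow> A \<subseteq> sigma_dual sc Z closure_of A"
  by (rule closure_of_subset) simp

lemma subset_mackey_closure: "A \<subseteq> dual_space sc \<Longrightarrow> A \<subseteq> mackey sc Z closure_of A"
  by (rule closure_of_subset) simp

lemma subset_sigma_hull:
  assumes "A \<subseteq> dual_space sc"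
  shows "A \<subseteq> sigma_dual sc Z closure_of (convex hull A)"
proof -
  have "A \<subseteq> convex hull A"
    by (rule hull_subset)
  also have "\<dots> \<subseteq> sigma_dual sc Z closure_of (convex hull A)"
    using convex_hull_subset_dual[OF assms] by (rule subset_sigma_closure)
  finally show ?thesis .
qed

lemma cover_Inter_mono:
  assumes "\<And>E :: nat \<Rightarrow> 'b set. A = (\<Union>n. E n) \<Longrightarrow> \<Phi> E \<subseteq> \<Psi> E"
  shows "\<Inter>{\<Phi> E | E :: nat \<Rightarrow> 'b set. A = (\<Union>n. E n)} \<subseteq> \<Inter>{\<Psi> E | E. A = (\<Union>n. E n)}"
proof (rule Inter_greatest)
  fix X assume "X \<in> {\<Psi> E | E. A = (\<Union>n. E n)}"
  then obtain E where E: "X = \<Psi> E" "A = (\<Union>n. E n)"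
    by (elim CollectE exE conjE)
  have "\<Inter>{\<Phi> E | E. A = (\<Union>n. E n)} \<subseteq> \<Phi> E"
    by (rule Inter_lower) (intro CollectI exI[of _ E] conjI refl E(2))
  also have "\<dots> \<subseteq> X"
    unfolding E(1) by (rule assms[OF E(2)])
  finally show "\<Inter>{\<Phi> E | E. A = (\<Union>n. E n)} \<subseteq> X" .
qed

lemma cover_Inter_greatest:
  assumes "\<And>E :: nat \<Rightarrow> 'b set. A = (\<Union>n. E n) \<Longrightarrow> B \<subseteq> \<Phi> E"
  shows "B \<subseteq> \<Inter>{\<Phi> E | E :: nat \<Rightarrow> 'b set. A = (\<Union>n. E n)}"
proof (rule Inter_greatest)
  fix X assume "X \<in> {\<Phi> E | E. A = (\<Union>n. E n)}"
  then obtain E where E: "X = \<Phi> E" "A = (\<Union>n. E n)"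
    by (elim CollectE exE conjE)
  show "B \<subseteq> X"
    unfolding E(1) by (rule assms[OF E(2)])
qed

lemma cover_part_subset: "A \<subseteq> D \<Longrightarrow> A = (\<Union>n. E n) \<Longrightarrow> E n \<subseteq> D"
  by blast

text \<open>
  Covers may be indexed by any countable family; the value at the empty set takes care of the empty
  family, which no sequence enumerates.
\<close>

lemma countable_cover_memD:
  fixes \<D> :: "'b set set" and F :: "'b set \<Rightarrow> 'c set"
  assumes mem: "\<And>E :: nat \<Rightarrow> 'b set. A = (\<Union>n. E n) \<Longrightarrow> f \<in> G (\<Union>n. F (E n))"
    and empty: "F {} = {}" and \<D>: "countable \<D>" "A = \<Union>\<D>"
  shows "f \<in> G (\<Union>D\<in>\<D>. F D)"
proof (cases "\<D> = {}")
  case True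
  then show ?thesis
    using mem[of "\<lambda>_. {}"] empty \<D>(2) by simp
next
  case False
  then have range: "range (from_nat_into \<D>) = \<D>"
    using \<D>(1) by (rule range_from_nat_into)
  then have "f \<in> G (\<Union>n. F (from_nat_into \<D> n))"
    using \<D>(2) by (intro mem) simp
  also have "(\<Union>n. F (from_nat_into \<D> n)) = (\<Union>D\<in>range (from_nat_into \<D>). F D)"
    by blast
  finally show ?thesis
    unfolding range .
qed

lemma I_ccl_memD:
  assumes "f \<in> I_ccl sc A" "countable \<D>" "A = \<Union>\<D>"
  shows "f \<in> closure (\<Union>D\<in>\<D>. weak_star_hull sc D)"
proof (rule countable_cover_memD[where G = "closure" and F = "\<lambda>D. weak_star_hull sc D", OF _ _ assms(2,3)])
  show "f \<in> closure (\<Union>n. weak_star_hull sc (E n))" if "A = (\<Union>n. E n)" for E :: "nat \<Rightarrow> _"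
    using assms(1) unfolding I_ccl_def by (rule InterD) (intro CollectI exI[of _ E] conjI refl that)
qed simp

lemma I_env_memD:
  assumes "f \<in> I_env sc A" "countable \<D>" "A = \<Union>\<D>"
  shows "f \<in> closure (convex hull (\<Union>D\<in>\<D>. weak_star_hull sc D))"
proof (rule countable_cover_memD[where G = "\<lambda>S. closure (convex hull S)" and F = "\<lambda>D. weak_star_hull sc D", OF _ _ assms(2,3)])
  show "f \<in> closure (convex hull (\<Union>n. weak_star_hull sc (E n)))" if "A = (\<Union>n. E n)" for E :: "nat \<Rightarrow> _"
    using assms(1) unfolding I_env_def by (rule InterD) (intro CollectI exI[of _ E] conjI refl that)
qed simp

lemma I_ww_memD:
  assumes "f \<in> I_ww sc A" "countable \<D>" "A = \<Union>\<D>"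
  shows "f \<in> weak sc closure_of (\<Union>D\<in>\<D>. weak_star_hull sc D)"
proof (rule countable_cover_memD[where G = "\<lambda>S. weak sc closure_of S" and F = "\<lambda>D. weak_star_hull sc D", OF _ _ assms(2,3)])
  show "f \<in> weak sc closure_of (\<Union>n. weak_star_hull sc (E n))" if "A = (\<Union>n. E n)" for E :: "nat \<Rightarrow> _"
    using assms(1) unfolding I_ww_def by (rule InterD) (intro CollectI exI[of _ E] conjI refl that)
qed simp

lemma I_cbcl_memD:
  assumes "f \<in> I_cbcl sc A" "countable \<D>" "A = \<Union>\<D>"
  shows "f \<in> sigma_dual sc (C_set sc) closure_of (\<Union>D\<in>\<D>. sigma_dual sc (B1_set sc) closure_of (convex hull D))"
proof (rule countable_cover_memD[where G = "\<lambda>S. sigma_dual sc (C_set sc) closure_of S" and F = "\<lambda>D. sigma_dual sc (B1_set sc) closure_of (convex hull D)", OF _ _ assms(2,3)])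
  show "f \<in> sigma_dual sc (C_set sc) closure_of (\<Union>n. sigma_dual sc (B1_set sc) closure_of (convex hull (E n)))" if "A = (\<Union>n. E n)" for E :: "nat \<Rightarrow> _"
    using assms(1) unfolding I_cbcl_def by (rule InterD) (intro CollectI exI[of _ E] conjI refl that)
qed simp

lemma weak_star_closure_subset_dual: "weak_star sc closure_of A \<subseteq> dual_space sc"
  unfolding weak_star_def by (rule sigma_closure_subset_dual)

lemma I_ccl_subset_dual: "I_ccl sc A \<subseteq> dual_space sc"
proof
  fix f assume "f \<in> I_ccl sc A"
  then have "f \<in> closure (\<Union>D\<in>{A}. weak_star_hull sc D)"
    by (rule I_ccl_memD) auto
  also have "\<dots> \<subseteq> dual_space sc"
    using weak_star_closure_subset_dual by (intro closure_minimal closed_dual_space) blast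
  finally show "f \<in> dual_space sc" .
qed

text \<open>
  The trivial cover suffices: the weak-star closed convex hull of \<open>A\<close> is convex and norm closed.
\<close>

lemma I_env_subset_weak_star_hull:
  assumes "A \<subseteq> dual_space sc"
  shows "I_env sc A \<subseteq> weak_star_hull sc A"
proof
  fix f assume "f \<in> I_env sc A"
  then have "f \<in> closure (convex hull (\<Union>D\<in>{A}. weak_star_hull sc D))"
    by (rule I_env_memD) auto
  also have "\<dots> = closure (convex hull (weak_star_hull sc A))"
    by simp
  also have "\<dots> = closure (weak_star_hull sc A)"
  proof -
    have "convex (weak_star_hull sc A)"
      unfolding weak_star_def
      by (intro convex_sigma_closure embedded_subset_bidual convex_convex_hull
          convex_hull_subset_dual assms)
    then show ?thesis
      by (simp add: hull_same)
  qed
  also have "\<dots> = weak_star_hull sc A"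
    unfolding weak_star_def
    by (intro closure_closed closedin_sigma_imp_closed[OF embedded_subset_bidual[of sc]] closedin_closure_of)
  finally show "f \<in> weak_star_hull sc A" .
qed

lemma closure_hull_subset_I_env:
  assumes A: "A \<subseteq> dual_space sc"
  shows "closure (convex hull A) \<subseteq> I_env sc A"
  unfolding I_env_def
proof (rule cover_Inter_greatest)
  fix E :: "nat \<Rightarrow> _" assume AE: "A = (\<Union>n. E n)"
  show "closure (convex hull A) \<subseteq> closure (convex hull (\<Union>n. weak_star_hull sc (E n)))"
    unfolding AE weak_star_def
    by (intro closure_mono hull_mono UN_mono subset_refl subset_sigma_hull cover_part_subset[OF A AE])
qed

lemma subset_I_env: "A \<subseteq> dual_space sc \<Longrightarrow> A \<subseteq> I_env sc A"
  by (rule order_trans[OF order_trans[OF hull_subset closure_subset] closure_hull_subset_I_env])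

lemma weak_closure_subset_I_ww:
  assumes A: "A \<subseteq> dual_space sc"
  shows "weak sc closure_of A \<subseteq> I_ww sc A"
  unfolding I_ww_def
proof (rule cover_Inter_greatest)
  fix E :: "nat \<Rightarrow> _" assume AE: "A = (\<Union>n. E n)"
  show "weak sc closure_of A \<subseteq> weak sc closure_of (\<Union>n. weak_star_hull sc (E n))"
    unfolding AE weak_star_def
    by (intro closure_of_mono UN_mono subset_refl subset_sigma_hull cover_part_subset[OF A AE])
qed

text \<open>
  If \<open>I_env\<close> of every part of \<open>A\<close> respects the halfspaces given by \<open>Z\<close>, then the finite
  halfspace covers above turn \<open>cl_IF A\<close> into a part of the \<open>\<sigma>(X\<^sup>*, Z)\<close>-closure.
\<close>

lemma cl_IF_subset_sigma_closure:
  fixes sc :: "'k::real_or_complex \<Rightarrow> 'a::banach \<Rightarrow> 'a"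
  assumes A: "A \<subseteq> dual_space sc"
    and Z: "Z \<subseteq> bidual_space sc" "Z \<noteq> {}" and mult: "\<And>c \<phi>. \<phi> \<in> Z \<Longrightarrow> (\<lambda>f. c * \<phi> f) \<in> Z"
    and env: "\<And>B \<phi> r. B \<subseteq> A \<Longrightarrow> \<phi> \<in> Z \<Longrightarrow> B \<subseteq> halfspace sc \<phi> r \<Longrightarrow>
      I_env sc B \<subseteq> halfspace sc \<phi> r"
  shows "cl_IF sc A \<subseteq> sigma_dual sc Z closure_of A"
proof
  fix f assume f: "f \<in> cl_IF sc A"
  have "cl_IF sc A \<subseteq> (\<Union>j\<in>{1..1::nat}. I_env sc A)"
    unfolding cl_IF_def by (intro Inter_lower CollectI exI[of _ 1] exI[of _ "\<lambda>_. A"]) auto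
  then have "f \<in> weak_star_hull sc A"
    using f I_env_subset_weak_star_hull[OF A] by auto
  then have fd: "f \<in> dual_space sc"
    using weak_star_closure_subset_dual by blast
  show "f \<in> sigma_dual sc Z closure_of A"
  proof (rule ccontr)
    assume "\<not> ?thesis"
    then obtain n \<psi> d where n: "1 \<le> (n::nat)" "0 < d" "\<And>j. j \<in> {1..n} \<Longrightarrow> \<psi> j \<in> Z"
      "A = (\<Union>j\<in>{1..n}. {g \<in> A. re_part (\<psi> j g) \<le> re_part (\<psi> j f) - d})"
      by (rule finite_halfspace_cover[OF A fd _ Z(1) mult Z(2)]) (assumption, rule that)
    define B where "B = (\<lambda>j. {g \<in> A. re_part (\<psi> j g) \<le> re_part (\<psi> j f) - d})"
    have "cl_IF sc A \<subseteq> (\<Union>j\<in>{1..n}. I_env sc (B j))"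
      unfolding cl_IF_def B_def
      using n(1,4) by (intro Inter_lower CollectI exI[of _ n] exI[of _ "\<lambda>j. {g \<in> A. re_part (\<psi> j g) \<le> re_part (\<psi> j f) - d}"]) auto
    then obtain j where j: "j \<in> {1..n}" "f \<in> I_env sc (B j)"
      using f by blast
    have "B j \<subseteq> halfspace sc (\<psi> j) (re_part (\<psi> j f) - d)" "B j \<subseteq> A"
      using A unfolding B_def by blast+
    then have "I_env sc (B j) \<subseteq> halfspace sc (\<psi> j) (re_part (\<psi> j f) - d)"
      using env[OF _ n(3)[OF j(1)]] by blast
    then show False
      using j(2) n(2) by auto
  qed
qed

section \<open>The general inclusions\<close>

lemma I_cl_subset_I_ccl: "I_cl sc A \<subseteq> I_ccl sc A"
  unfolding I_cl_def I_ccl_def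
  by (intro cover_Inter_mono closure_mono UN_mono closure_of_mono hull_subset subset_refl)

text \<open>
  Banach-Alaoglu in the form of a covering statement. Strict halfspaces are open in the topology of
  pointwise convergence, in which the closure of a bounded set of functionals is compact.
\<close>

lemma weak_star_finite_halfspace_cover:
  fixes sc :: "'k::real_or_complex \<Rightarrow> 'a::banach \<Rightarrow> 'a"
  assumes sc: "banach_over sc" and A: "A \<subseteq> dual_space sc" and r: "\<And>f. f \<in> A \<Longrightarrow> norm f \<le> r"
    and P: "\<And>f. f \<in> weak_star sc closure_of A \<Longrightarrow> \<exists>p\<in>P. snd p < re_part (blinfun_apply f (fst p))"
  obtains Q where "finite Q" "Q \<subseteq> P" "\<And>f. f \<in> A \<Longrightarrow> \<exists>p\<in>Q. snd p < re_part (blinfun_apply f (fst p))"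
proof -
  define L where "L = closure (blinfun_apply ` A)"
  define S where "S = {\<phi> :: 'a \<Rightarrow> 'k. \<forall>x. norm (\<phi> x) \<le> r * norm x}"
  have "compact S"
    unfolding S_def by (rule compact_function_box)
  have "closed S"
    unfolding S_def
    by (intro closed_Collect_all closed_Collect_le continuous_intros continuous_on_product_coordinates)
  have AS: "blinfun_apply ` A \<subseteq> S"
  proof (rule image_subsetI)
    fix f assume f: "f \<in> A"
    have "norm (blinfun_apply f x) \<le> r * norm x" for x
      using norm_blinfun[of f x] mult_right_mono[OF r[OF f], of "norm x"] by simp
    then show "blinfun_apply f \<in> S"
      unfolding S_def by blast
  qed
  have LS: "L \<subseteq> S"
    unfolding L_def by (intro closure_minimal AS \<open>closed S\<close>)
  have "compact (S \<inter> L)"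
    by (intro compact_Int_closed \<open>compact S\<close>) (simp add: L_def)
  then have "compact L"
    using LS by (simp add: Int_absorb1)
  define T where "T = (\<lambda>p. {\<phi> :: 'a \<Rightarrow> 'k. snd p < re_part (\<phi> (fst p))})"
  have open_T: "open (T p)" for p
    unfolding T_def
    by (intro open_Collect_less continuous_intros
        bounded_linear.continuous_on[OF bounded_linear_re_part] continuous_on_product_coordinates)
  have LT: "L \<subseteq> (\<Union>p\<in>P. T p)"
  proof
    fix \<phi> assume \<phi>: "\<phi> \<in> L"
    have near: "\<exists>g\<in>A. \<forall>x\<in>G. norm (blinfun_apply g x - \<phi> x) < e" if "finite G" "0 < e" for G e
    proof -
      let ?U = "\<Inter>x\<in>G. {\<psi> :: 'a \<Rightarrow> 'k. norm (\<psi> x - \<phi> x) < e}"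
      have U: "open ?U"
        using that(1) by (intro open_INT ballI open_Collect_less continuous_intros continuous_on_product_coordinates)
      have \<phi>U: "\<phi> \<in> ?U \<inter> closure (blinfun_apply ` A)"
        using that(2) \<phi> unfolding L_def by simp
      have "?U \<inter> blinfun_apply ` A \<noteq> {}"
      proof
        assume "?U \<inter> blinfun_apply ` A = {}"
        then have "?U \<inter> closure (blinfun_apply ` A) = {}"
          by (rule iffD2[OF open_Int_closure_eq_empty[OF U]])
        with \<phi>U show False
          by (simp only: empty_iff)
      qed
      then obtain \<psi> where "\<psi> \<in> blinfun_apply ` A" "\<psi> \<in> ?U"
        by (elim ex_in_conv[THEN iffD2, THEN exE] IntE)
      then obtain g where "g \<in> A" "blinfun_apply g \<in> ?U"
        by (elim imageE) simp
      then show ?thesis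
        by (intro bexI[of _ g] ballI) auto
    qed
    have closed_L: "\<phi> \<in> C" if "closed C" "\<And>f. f \<in> A \<Longrightarrow> blinfun_apply f \<in> C" for C
      using \<phi> closure_minimal[OF _ that(1), of "blinfun_apply ` A"] that(2) unfolding L_def by blast
    have add: "\<phi> (x + y) = \<phi> x + \<phi> y" for x y
    proof -
      have "\<phi> \<in> {\<phi>. \<phi> (x + y) = \<phi> x + \<phi> y}"
        by (rule closed_L)
          (intro closed_Collect_eq continuous_intros continuous_on_product_coordinates, simp add: blinfun.add_right)
      then show ?thesis by blast
    qed
    have scale: "\<phi> (sc c x) = c * \<phi> x" for c x
    proof -
      have "\<phi> \<in> {\<phi>. \<phi> (sc c x) = c * \<phi> x}"
      proof (rule closed_L)
        show "blinfun_apply f \<in> {\<phi>. \<phi> (sc c x) = c * \<phi> x}" if "f \<in> A" for f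
          using that A dual_spaceD by blast
      qed (intro closed_Collect_eq continuous_intros continuous_on_product_coordinates)
      then show ?thesis by blast
    qed
    have "norm (\<phi> x) \<le> norm x * r" for x
      using LS \<phi> unfolding S_def by (auto simp: mult.commute)
    then obtain f where f: "f \<in> dual_space sc" "\<And>x. blinfun_apply f x = \<phi> x"
      by (rule dual_spaceI[OF sc add scale]) (rule that)
    have "f \<in> weak_star sc closure_of A"
      unfolding weak_star_def sigma_closure_iff
    proof (intro conjI allI impI f(1))
      fix G :: "(('a \<Rightarrow>\<^sub>L 'k) \<Rightarrow> 'k) set" and e :: real
      assume G: "finite G \<and> G \<subseteq> embedded_space sc \<and> 0 < e"
      then obtain H where H: "finite H" "G = canonical_embedding sc ` H"
        unfolding embedded_space_def using finite_subset_image[of G "canonical_embedding sc" UNIV] by auto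
      obtain g where g: "g \<in> A" "\<forall>x\<in>H. norm (blinfun_apply g x - \<phi> x) < e"
        using near[OF H(1)] G by blast
      have "\<forall>\<psi>\<in>G. norm (\<psi> g - \<psi> f) < e"
        unfolding H(2) using g A f by (auto simp: canonical_embedding_apply subsetD)
      then show "\<exists>g\<in>A \<inter> dual_space sc. \<forall>\<psi>\<in>G. norm (\<psi> g - \<psi> f) < e"
        using g(1) A by (intro bexI[of _ g]) auto
    qed
    then obtain p where p: "p \<in> P" "snd p < re_part (blinfun_apply f (fst p))"
      using P by blast
    from p(2) have "\<phi> \<in> T p"
      unfolding f(2) T_def by simp
    with p(1) show "\<phi> \<in> (\<Union>p\<in>P. T p)"
      by (rule UN_I)
  qed
  obtain Q where Q: "Q \<subseteq> P" "finite Q" "L \<subseteq> (\<Union>p\<in>Q. T p)"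
    by (rule compactE_image[OF \<open>compact L\<close> open_T LT])
  show ?thesis
  proof (rule that[OF Q(2,1)])
    fix f assume "f \<in> A"
    then have "blinfun_apply f \<in> L"
      unfolding L_def by (intro subsetD[OF closure_subset] imageI)
    then show "\<exists>p\<in>Q. snd p < re_part (blinfun_apply f (fst p))"
      using Q(3) unfolding T_def by blast
  qed
qed

text \<open>
  A bounded part whose weak-star closure keeps a distance \<open>e\<close> from \<open>f\<close> is covered by finitely many
  halfspaces that keep the distance \<open>e / 2\<close>, and neither convexification nor weak-star closure leaves
  a weak-star closed halfspace.
\<close>

lemma I_ccl_subset_I_cl:
  fixes sc :: "'k::real_or_complex \<Rightarrow> 'a::banach \<Rightarrow> 'a"
  assumes sc: "banach_over sc" and A: "A \<subseteq> dual_space sc"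
  shows "I_ccl sc A \<subseteq> I_cl sc A"
  unfolding I_cl_def
proof (intro Inter_greatest, clarify)
  fix E :: "nat \<Rightarrow> ('a \<Rightarrow>\<^sub>L 'k) set" and f
  assume f: "f \<in> I_ccl sc (\<Union>n. E n)" and AE: "A = (\<Union>n. E n)"
  have fd: "f \<in> dual_space sc"
    using f I_ccl_subset_dual by blast
  show "f \<in> closure (\<Union>n. weak_star sc closure_of (E n))"
  proof (rule ccontr)
    assume "\<not> ?thesis"
    then obtain e where e: "0 < e" "\<And>g n. g \<in> weak_star sc closure_of (E n) \<Longrightarrow> e \<le> dist g f"
      unfolding closure_approachable by (auto simp: not_less)
    define t where "t = (\<lambda>x. re_part (blinfun_apply f x) + e / 2)"
    define P where "P = (\<lambda>x. (x, t x)) ` cball 0 1"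
    define B where "B = (\<lambda>n m. E n \<inter> cball 0 (real m))"
    define piece where "piece = (\<lambda>n m p. {g \<in> B n m. snd p < re_part (blinfun_apply g (fst p))})"
    have "\<exists>Q. finite Q \<and> Q \<subseteq> P \<and> (\<forall>g\<in>B n m. \<exists>p\<in>Q. snd p < re_part (blinfun_apply g (fst p)))"
      for n m
    proof -
      have Bd: "B n m \<subseteq> dual_space sc"
        using A AE unfolding B_def by blast
      have Br: "norm g \<le> real m" if "g \<in> B n m" for g
        using that unfolding B_def by simp
      have far: "\<exists>p\<in>P. snd p < re_part (blinfun_apply g (fst p))"
        if g: "g \<in> weak_star sc closure_of (B n m)" for g
      proof -
        have gd: "g \<in> dual_space sc"
          using g weak_star_closure_subset_dual by blast
        have "weak_star sc closure_of (B n m) \<subseteq> weak_star sc closure_of (E n)"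
          by (rule closure_of_mono) (auto simp: B_def)
        then have "e \<le> dist g f"
          using g e(2) by blast
        then have "e / 2 < norm (g - f)"
          using e(1) by (simp add: dist_norm)
        then obtain x where "norm x \<le> 1" "e / 2 < re_part (blinfun_apply (g - f) x)"
          by (rule dual_norm_approx[OF sc dual_space_diff[OF gd fd]])
        then have "(x, t x) \<in> P" "t x < re_part (blinfun_apply g x)"
          unfolding P_def t_def by (simp_all add: blinfun.diff_left re_part_diff)
        then show ?thesis
          by (intro bexI[of _ "(x, t x)"]) simp_all
      qed
      obtain Q where "finite Q" "Q \<subseteq> P" "\<And>g. g \<in> B n m \<Longrightarrow> \<exists>p\<in>Q. snd p < re_part (blinfun_apply g (fst p))"
        by (rule weak_star_finite_halfspace_cover[OF sc Bd Br far]) (assumption, assumption, rule that)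
      then show ?thesis
        by (intro exI[of _ Q] conjI ballI)
    qed
    then obtain Q where Q: "\<And>n m. finite (Q n m)" "\<And>n m. Q n m \<subseteq> P"
      "\<And>n m g. g \<in> B n m \<Longrightarrow> \<exists>p\<in>Q n m. snd p < re_part (blinfun_apply g (fst p))"
      by metis
    define \<D> where "\<D> = (\<Union>n. \<Union>m. piece n m ` Q n m)"
    have "countable \<D>"
    proof -
      have "countable (piece n m ` Q n m)" for n m
        by (intro countable_image countable_finite Q(1))
      then show ?thesis
        unfolding \<D>_def by simp
    qed
    moreover have "(\<Union>n. E n) = \<Union>\<D>"
    proof (intro antisym subsetI)
      fix g assume "g \<in> (\<Union>n. E n)"
      then obtain n where "g \<in> E n"
        by (rule UN_E)
      moreover obtain m :: nat where "norm g \<le> real m"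
        using real_arch_simple by blast
      ultimately have g: "g \<in> B n m"
        by (simp add: B_def)
      from Q(3)[OF g] obtain p where p: "p \<in> Q n m" "snd p < re_part (blinfun_apply g (fst p))"
        by (rule bexE)
      have "g \<in> piece n m p"
        unfolding piece_def using g p(2) by simp
      moreover have "piece n m p \<in> \<D>"
        unfolding \<D>_def UN_iff by (intro bexI[of _ n] bexI[of _ m] imageI p(1) UNIV_I)
      ultimately show "g \<in> \<Union>\<D>"
        by (rule UnionI[rotated])
    next
      fix g assume "g \<in> \<Union>\<D>"
      then show "g \<in> (\<Union>n. E n)"
        unfolding \<D>_def piece_def B_def by blast
    qed
    ultimately have "f \<in> closure (\<Union>D\<in>\<D>. weak_star_hull sc D)"
      by (rule I_ccl_memD[OF f])
    moreover have "0 < e / 2"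
      using e(1) by simp
    ultimately have "\<exists>h\<in>(\<Union>D\<in>\<D>. weak_star_hull sc D). dist h f < e / 2"
      unfolding closure_approachable by blast
    then obtain D h where D: "D \<in> \<D>" and h: "h \<in> weak_star_hull sc D" "dist h f < e / 2"
      by (elim bexE UN_E)
    from D obtain n m p where p: "p \<in> Q n m" "D = piece n m p"
      unfolding \<D>_def by blast
    have "p \<in> P"
      by (rule subsetD[OF Q(2) p(1)])
    then obtain x where x: "norm x \<le> 1" "p = (x, t x)"
      unfolding P_def by (elim imageE) simp
    have Dh: "D \<subseteq> halfspace sc (canonical_embedding sc (- x)) (- t x)"
    proof
      fix g assume "g \<in> D"
      then have "g \<in> dual_space sc" "t x < re_part (blinfun_apply g x)"
        using A AE unfolding p(2) x(2) piece_def B_def by auto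
      then show "g \<in> halfspace sc (canonical_embedding sc (- x)) (- t x)"
        by (simp add: canonical_embedding_apply blinfun.minus_right re_part_minus)
    qed
    have "h \<in> halfspace sc (canonical_embedding sc (- x)) (- t x)"
      using sigma_hull_subset_halfspace[OF canonical_in_embedded embedded_subset_bidual Dh] h(1)
      unfolding weak_star_def by blast
    then have "h \<in> dual_space sc" "re_part (canonical_embedding sc (- x) h) \<le> - t x"
      by blast+
    then have "e / 2 \<le> re_part (blinfun_apply (h - f) x)"
      by (simp add: canonical_embedding_apply blinfun.minus_right re_part_minus t_def
          blinfun.diff_left re_part_diff)
    also have "\<dots> \<le> norm (blinfun_apply (h - f) x)"
      by (rule re_part_le_norm)
    also have "\<dots> \<le> norm (h - f) * 1"
      using norm_blinfun[of "h - f" x] mult_left_mono[OF x(1), of "norm (h - f)"] by simp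
    finally show False
      using h(2) by (simp add: dist_norm)
  qed
qed

lemma I_ccl_subset_I_ww: "I_ccl sc A \<subseteq> I_ww sc A"
  unfolding I_ccl_def I_ww_def weak_def
  by (intro cover_Inter_mono closure_subset_sigma_closure subset_refl UN_least
      weak_star_closure_subset_dual)

text \<open>By Mazur's theorem a point outside \<open>I_env\<close> of a piece is separated from it weakly; finitely many
  halfspaces together still form a weakly closed set.\<close>

lemma I_ww_subset_cl_IF:
  fixes sc :: "'k::real_or_complex \<Rightarrow> 'a::banach \<Rightarrow> 'a"
  shows "I_ww sc A \<subseteq> cl_IF sc A"
  unfolding cl_IF_def
proof (intro Inter_greatest, clarify)
  fix n :: nat and E :: "nat \<Rightarrow> ('a \<Rightarrow>\<^sub>L 'k) set" and f
  assume f: "f \<in> I_ww sc (\<Union>j\<in>{1..n}. E j)"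
  let ?w = "\<lambda>D. weak_star_hull sc D"
  show "f \<in> (\<Union>j\<in>{1..n}. I_env sc (E j))"
  proof (rule ccontr)
    assume contr: "\<not> ?thesis"
    have "\<exists>D \<phi> d. E j = (\<Union>m::nat. D m) \<and> \<phi> \<in> bidual_space sc \<and> 0 < d \<and>
        (\<forall>c\<in>(\<Union>m. ?w (D m)). f \<in> dual_space sc \<longrightarrow> re_part (\<phi> c) \<le> re_part (\<phi> f) - d)" if j: "j \<in> {1..n}" for j
    proof -
      have "f \<notin> I_env sc (E j)"
        using contr j by blast
      then obtain D where D: "E j = (\<Union>m::nat. D m)" "f \<notin> closure (convex hull (\<Union>m. ?w (D m)))"
        unfolding I_env_def by blast
      obtain \<phi> d where \<phi>: "\<phi> \<in> bidual_space sc" "0 < d"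
        "\<And>c. c \<in> convex hull (\<Union>m. ?w (D m)) \<inter> dual_space sc \<Longrightarrow> f \<in> dual_space sc \<Longrightarrow>
          re_part (\<phi> c) \<le> re_part (\<phi> f) - d"
        by (rule bidual_separation[OF convex_convex_hull D(2)]) (rule that)
      have "re_part (\<phi> c) \<le> re_part (\<phi> f) - d" if c: "c \<in> (\<Union>m. ?w (D m))" and "f \<in> dual_space sc" for c
      proof (rule \<phi>(3)[OF _ that(2)])
        show "c \<in> convex hull (\<Union>m. ?w (D m)) \<inter> dual_space sc"
          using c weak_star_closure_subset_dual hull_subset by fast
      qed
      then show ?thesis
        using D(1) \<phi>(1,2) by (intro exI[of _ D] exI[of _ \<phi>] exI[of _ d]) blast
    qed
    then have "\<forall>j\<in>{1..n}. \<exists>D \<phi> d. E j = (\<Union>m::nat. D m) \<and> \<phi> \<in> bidual_space sc \<and> 0 < d \<and>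
        (\<forall>c\<in>(\<Union>m. ?w (D m)). f \<in> dual_space sc \<longrightarrow> re_part (\<phi> c) \<le> re_part (\<phi> f) - d)"
      by (rule ballI)
    from bchoice[OF this] obtain D where "\<forall>j\<in>{1..n}. \<exists>\<phi> d. E j = (\<Union>m::nat. D j m) \<and> \<phi> \<in> bidual_space sc \<and> 0 < d \<and>
        (\<forall>c\<in>(\<Union>m. ?w (D j m)). f \<in> dual_space sc \<longrightarrow> re_part (\<phi> c) \<le> re_part (\<phi> f) - d)" ..
    from bchoice[OF this] obtain \<phi> where "\<forall>j\<in>{1..n}. \<exists>d. E j = (\<Union>m::nat. D j m) \<and> \<phi> j \<in> bidual_space sc \<and> 0 < d \<and>
        (\<forall>c\<in>(\<Union>m. ?w (D j m)). f \<in> dual_space sc \<longrightarrow> re_part (\<phi> j c) \<le> re_part (\<phi> j f) - d)" ..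
    from bchoice[OF this] obtain d where all: "\<forall>j\<in>{1..n}. E j = (\<Union>m::nat. D j m) \<and> \<phi> j \<in> bidual_space sc \<and> 0 < d j \<and>
        (\<forall>c\<in>(\<Union>m. ?w (D j m)). f \<in> dual_space sc \<longrightarrow> re_part (\<phi> j c) \<le> re_part (\<phi> j f) - d j)" ..
    define \<D> where "\<D> = (\<Union>j\<in>{1..n}. range (D j))"
    have "countable \<D>"
      unfolding \<D>_def by (intro countable_UN countable_image) auto
    moreover have "(\<Union>j\<in>{1..n}. E j) = \<Union>\<D>"
      unfolding \<D>_def using all by auto
    ultimately have fw: "f \<in> weak sc closure_of (\<Union>D\<in>\<D>. ?w D)"
      by (rule I_ww_memD[OF f])
    then have fd: "f \<in> dual_space sc"
      unfolding weak_def using sigma_closure_subset_dual by blast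
    define H where "H = (\<lambda>j. halfspace sc (\<phi> j) (re_part (\<phi> j f) - d j))"
    have "closedin (weak sc) (\<Union>j\<in>{1..n}. H j)"
      unfolding weak_def H_def using all by (intro closedin_Union finite_imageI) (auto intro: closedin_halfspace)
    moreover have "(\<Union>D\<in>\<D>. ?w D) \<subseteq> (\<Union>j\<in>{1..n}. H j)"
    proof
      fix c assume "c \<in> (\<Union>D\<in>\<D>. ?w D)"
      then obtain j m where j: "j \<in> {1..n}" and c: "c \<in> ?w (D j m)"
        unfolding \<D>_def by blast
      have "re_part (\<phi> j c) \<le> re_part (\<phi> j f) - d j"
        using all j c fd by blast
      moreover have "c \<in> dual_space sc"
        using c weak_star_closure_subset_dual by blast
      ultimately show "c \<in> (\<Union>j\<in>{1..n}. H j)"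
        unfolding H_def using j by blast
    qed
    ultimately have "f \<in> (\<Union>j\<in>{1..n}. H j)"
      using fw closure_of_minimal by blast
    then show False
      unfolding H_def using all by force
  qed
qed

lemma cl_IF_subset_I_env: "cl_IF sc A \<subseteq> I_env sc A"
proof -
  have "cl_IF sc A \<subseteq> (\<Union>j\<in>{1..1::nat}. I_env sc A)"
    unfolding cl_IF_def by (intro Inter_lower CollectI exI[of _ 1] exI[of _ "\<lambda>_. A"]) auto
  then show ?thesis
    by simp
qed

lemma cl_IF_subset_weak_star_closure:
  assumes A: "A \<subseteq> dual_space sc"
  shows "cl_IF sc A \<subseteq> weak_star sc closure_of A"
  unfolding weak_star_def
proof (rule cl_IF_subset_sigma_closure[OF A embedded_subset_bidual embedded_nonempty embedded_mult])
  fix B \<phi> r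
  assume B: "B \<subseteq> A" and \<phi>: "\<phi> \<in> embedded_space sc" "B \<subseteq> halfspace sc \<phi> r"
  have "I_env sc B \<subseteq> weak_star_hull sc B"
    using A B by (intro I_env_subset_weak_star_hull) blast
  also have "\<dots> \<subseteq> halfspace sc \<phi> r"
    unfolding weak_star_def by (rule sigma_hull_subset_halfspace[OF \<phi>(1) embedded_subset_bidual \<phi>(2)])
  finally show "I_env sc B \<subseteq> halfspace sc \<phi> r" .
qed

lemma closure_subset_I_mn:
  assumes A: "A \<subseteq> dual_space sc"
  shows "closure A \<subseteq> I_mn sc A"
  unfolding I_mn_def
proof (rule cover_Inter_greatest)
  fix E :: "nat \<Rightarrow> _" assume AE: "A = (\<Union>n. E n)"
  show "closure A \<subseteq> closure (\<Union>n. mackey sc (embedded_space sc) closure_of E n)"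
    unfolding AE
    by (intro closure_mono UN_mono subset_refl subset_mackey_closure cover_part_subset[OF A AE])
qed

lemma I_mn_subset_I_cl: "I_mn sc A \<subseteq> I_cl sc A"
  unfolding I_mn_def I_cl_def weak_star_def
  by (intro cover_Inter_mono closure_mono UN_mono subset_refl mackey_closure_subset_sigma_closure
      embedded_mult)

lemma closure_subset_cl_IC:
  assumes A: "A \<subseteq> dual_space sc"
  shows "closure A \<subseteq> cl_IC sc A"
  unfolding cl_IC_def
proof (rule cover_Inter_greatest)
  fix E :: "nat \<Rightarrow> _" assume AE: "A = (\<Union>n. E n)"
  show "closure A \<subseteq> closure (\<Union>n. I_env sc (E n))"
    unfolding AE
    by (intro closure_mono UN_mono subset_refl subset_I_env cover_part_subset[OF A AE])
qed

lemma cl_IC_subset_I_ccl: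
  assumes A: "A \<subseteq> dual_space sc"
  shows "cl_IC sc A \<subseteq> I_ccl sc A"
  unfolding cl_IC_def I_ccl_def
  by (intro cover_Inter_mono closure_mono UN_mono subset_refl I_env_subset_weak_star_hull)
     (rule cover_part_subset[OF A])

lemma mackey_closure_subset_I_bcl:
  assumes A: "A \<subseteq> dual_space sc"
  shows "mackey sc (C_set sc) closure_of A \<subseteq> I_bcl sc A"
  unfolding I_bcl_def
proof (rule cover_Inter_greatest)
  fix E :: "nat \<Rightarrow> _" assume AE: "A = (\<Union>n. E n)"
  show "mackey sc (C_set sc) closure_of A \<subseteq> mackey sc (C_set sc) closure_of (\<Union>n. mackey sc (B1_set sc) closure_of E n)"
    unfolding AE
    by (intro closure_of_mono UN_mono subset_refl subset_mackey_closure cover_part_subset[OF A AE])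
qed

lemma I_bcl_subset_I_cbcl: "I_bcl sc A \<subseteq> I_cbcl sc A"
  unfolding I_bcl_def I_cbcl_def
proof (rule cover_Inter_mono)
  fix E :: "nat \<Rightarrow> _"
  have "mackey sc (C_set sc) closure_of (\<Union>n. mackey sc (B1_set sc) closure_of E n)
      \<subseteq> sigma_dual sc (C_set sc) closure_of (\<Union>n. mackey sc (B1_set sc) closure_of E n)"
    by (rule mackey_closure_subset_sigma_closure[OF C_mult])
  also have "\<dots> \<subseteq> sigma_dual sc (C_set sc) closure_of
      (\<Union>n. sigma_dual sc (B1_set sc) closure_of (convex hull (E n)))"
    by (intro closure_of_mono UN_mono subset_refl hull_subset
        order_trans[OF mackey_closure_subset_sigma_closure[OF B1_mult]])
  finally show "mackey sc (C_set sc) closure_of (\<Union>n. mackey sc (B1_set sc) closure_of E n)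
      \<subseteq> sigma_dual sc (C_set sc) closure_of
        (\<Union>n. sigma_dual sc (B1_set sc) closure_of (convex hull (E n)))" .
qed

text \<open>
  The halfspaces of a finite cover given by \<open>B\<^sub>1(X)\<close> have a union that is closed also for
  \<open>\<sigma>(X\<^sup>*, C(X))\<close>, because \<open>B\<^sub>1(X) \<subseteq> C(X)\<close>; the outer closure therefore stays in it.
\<close>

lemma I_cbcl_subset_B1_closure:
  fixes sc :: "'k::real_or_complex \<Rightarrow> 'a::banach \<Rightarrow> 'a"
  assumes A: "A \<subseteq> dual_space sc"
  shows "I_cbcl sc A \<subseteq> sigma_dual sc (B1_set sc) closure_of A"
proof
  fix f assume f: "f \<in> I_cbcl sc A"
  have "f \<in> sigma_dual sc (C_set sc) closure_of (\<Union>D\<in>{A}. sigma_dual sc (B1_set sc) closure_of (convex hull D))"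
    by (rule I_cbcl_memD[OF f]) auto
  then have fd: "f \<in> dual_space sc"
    using sigma_closure_subset_dual by blast
  show "f \<in> sigma_dual sc (B1_set sc) closure_of A"
  proof (rule ccontr)
    assume contr: "\<not> ?thesis"
    have ne: "B1_set sc \<noteq> {}"
      using embedded_subset_B1 embedded_nonempty by blast
    obtain n \<psi> d where n: "1 \<le> (n::nat)" "0 < d" "\<And>j. j \<in> {1..n} \<Longrightarrow> \<psi> j \<in> B1_set sc"
      "A = (\<Union>j\<in>{1..n}. {g \<in> A. re_part (\<psi> j g) \<le> re_part (\<psi> j f) - d})"
      by (rule finite_halfspace_cover[OF A fd contr B1_subset_bidual B1_mult ne]) (assumption, rule that)
    define B where "B = (\<lambda>j. {g \<in> A. re_part (\<psi> j g) \<le> re_part (\<psi> j f) - d})"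
    define H where "H = (\<lambda>j. halfspace sc (\<psi> j) (re_part (\<psi> j f) - d))"
    have "f \<in> sigma_dual sc (C_set sc) closure_of
        (\<Union>D\<in>B ` {1..n}. sigma_dual sc (B1_set sc) closure_of (convex hull D))"
      by (rule I_cbcl_memD[OF f]) (use n(4) in \<open>auto simp: B_def\<close>)
    moreover have sub: "(\<Union>D\<in>B ` {1..n}. sigma_dual sc (B1_set sc) closure_of (convex hull D)) \<subseteq> (\<Union>j\<in>{1..n}. H j)"
    proof -
      have "sigma_dual sc (B1_set sc) closure_of (convex hull (B j)) \<subseteq> H j" if "j \<in> {1..n}" for j
        unfolding H_def
      proof (rule sigma_hull_subset_halfspace[OF n(3)[OF that] B1_subset_bidual])
        show "B j \<subseteq> halfspace sc (\<psi> j) (re_part (\<psi> j f) - d)"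
          unfolding B_def using A by blast
      qed
      then show ?thesis
        by blast
    qed
    moreover have cl: "closedin (sigma_dual sc (C_set sc)) (\<Union>j\<in>{1..n}. H j)"
    proof (intro closedin_Union finite_imageI)
      fix S assume "S \<in> H ` {1..n}"
      then obtain j where j: "j \<in> {1..n}" "S = H j"
        by blast
      have "\<psi> j \<in> C_set sc"
        using n(3)[OF j(1)] B1_subset_C by blast
      then show "closedin (sigma_dual sc (C_set sc)) S"
        unfolding j(2) H_def by (rule closedin_halfspace)
    qed simp
    ultimately have "f \<in> (\<Union>j\<in>{1..n}. H j)"
      using subsetD[OF closure_of_minimal[OF sub cl]] by blast
    then show False
      using n(2) unfolding H_def by auto
  qed
qed

lemma B1_closure_subset_weak_star_closure:
  "sigma_dual sc (B1_set sc) closure_of A \<subseteq> weak_star sc closure_of A"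
  unfolding weak_star_def by (rule sigma_closure_antimono[OF embedded_subset_B1])

section \<open>Norm-separable sets\<close>

lemma separable_small_cover:
  fixes A :: "'b::metric_space set"
  assumes sep: "separable_space (subtopology euclidean A)" and e: "0 < e"
  obtains C where "countable C" "C \<subseteq> A" "A \<subseteq> (\<Union>c\<in>C. cball c e)"
proof -
  obtain C where C: "countable C" "C \<subseteq> A" "subtopology euclidean A closure_of C = A"
    using sep unfolding separable_space_def by auto
  have "subtopology euclidean A closure_of C \<subseteq> closure C"
    unfolding closure_of_subtopology using closure_mono[of "A \<inter> C" C] by auto
  then have AC: "A \<subseteq> closure C"
    unfolding C(3) .
  have "A \<subseteq> (\<Union>c\<in>C. cball c e)"
  proof
    fix a assume "a \<in> A"
    then have "a \<in> closure C"
      using AC by blast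
    then obtain c where "c \<in> C" "dist c a < e"
      using e unfolding closure_approachable by blast
    then show "a \<in> (\<Union>c\<in>C. cball c e)"
      by (intro UN_I[of c]) auto
  qed
  with C(1,2) show ?thesis
    by (rule that)
qed

lemma weak_star_hull_subset_cball:
  fixes sc :: "'k::real_or_complex \<Rightarrow> 'a::banach \<Rightarrow> 'a"
  assumes sc: "banach_over sc" and A: "A \<subseteq> dual_space sc" "A \<subseteq> cball c e" and c: "c \<in> dual_space sc"
  shows "weak_star_hull sc A \<subseteq> cball c e"
proof
  fix h assume h: "h \<in> weak_star_hull sc A"
  then have hd: "h \<in> dual_space sc"
    using weak_star_closure_subset_dual by blast
  have "norm (h - c) \<le> e"
  proof (rule dual_norm_le[OF sc dual_space_diff[OF hd c]])
    fix x :: 'a assume x: "norm x \<le> 1"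
    let ?r = "re_part (blinfun_apply c x) + e"
    have "A \<subseteq> halfspace sc (canonical_embedding sc x) ?r"
    proof
      fix g assume g: "g \<in> A"
      then have gd: "g \<in> dual_space sc" and "norm (g - c) \<le> e"
        using A by (auto simp: dist_norm norm_minus_commute)
      moreover have "re_part (blinfun_apply (g - c) x) \<le> norm (g - c)"
        using re_part_le_norm[of "blinfun_apply (g - c) x"] norm_blinfun[of "g - c" x]
          mult_left_mono[OF x, of "norm (g - c)"] by simp
      ultimately show "g \<in> halfspace sc (canonical_embedding sc x) ?r"
        by (simp add: canonical_embedding_apply blinfun.diff_left re_part_diff)
    qed
    then have "weak_star_hull sc A \<subseteq> halfspace sc (canonical_embedding sc x) ?r"
      unfolding weak_star_def
      by (rule sigma_hull_subset_halfspace[OF canonical_in_embedded embedded_subset_bidual])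
    then have "re_part (canonical_embedding sc x h) \<le> ?r"
      using h by blast
    then show "re_part (blinfun_apply (h - c) x) \<le> e"
      using hd by (simp add: canonical_embedding_apply blinfun.diff_left re_part_diff)
  qed
  then show "h \<in> cball c e"
    by (simp add: dist_norm norm_minus_commute)
qed

text \<open>A norm-separable set is covered by countably many parts of small balls, and dual balls survive
  both convexification and weak-star closure.\<close>

lemma norm_separable_small_pieces:
  fixes sc :: "'k::real_or_complex \<Rightarrow> 'a::banach \<Rightarrow> 'a"
  assumes sc: "banach_over sc" and A: "A \<subseteq> dual_space sc"
    and sep: "separable_space (subtopology euclidean A)" and BA: "B \<subseteq> A" and e: "0 < e"
  obtains \<D> where "countable \<D>" "B = \<Union>\<D>"
    "\<And>D h. D \<in> \<D> \<Longrightarrow> h \<in> weak_star_hull sc D \<Longrightarrow> \<exists>b\<in>B. dist b h \<le> e"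
proof -
  have "0 < e / 2"
    using e by simp
  then obtain C where C: "countable C" "C \<subseteq> A" "A \<subseteq> (\<Union>c\<in>C. cball c (e / 2))"
    by (rule separable_small_cover[OF sep])
  define \<D> where "\<D> = (\<lambda>c. B \<inter> cball c (e / 2)) ` C"
  show ?thesis
  proof (rule that)
    show "countable \<D>"
      unfolding \<D>_def using C(1) by (rule countable_image)
    show "B = \<Union>\<D>"
      unfolding \<D>_def using BA C(3) by blast
    fix D h assume D: "D \<in> \<D>" and h: "h \<in> weak_star_hull sc D"
    obtain c where c: "c \<in> C" "D = B \<inter> cball c (e / 2)"
      using D unfolding \<D>_def by (elim imageE)
    have "D \<noteq> {}"
      using h by auto
    then obtain b where b: "b \<in> B" "b \<in> cball c (e / 2)"
      unfolding c(2) by blast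
    have "weak_star_hull sc D \<subseteq> cball c (e / 2)"
    proof (rule weak_star_hull_subset_cball[OF sc])
      show "D \<subseteq> dual_space sc" "D \<subseteq> cball c (e / 2)" "c \<in> dual_space sc"
        using c A BA C(2) by blast+
    qed
    then have "h \<in> cball c (e / 2)"
      using h by blast
    then have "dist b h \<le> e"
      using b(2) dist_triangle[of b h c] by (simp add: dist_commute)
    with b(1) show "\<exists>b\<in>B. dist b h \<le> e"
      by (rule bexI[rotated])
  qed
qed

lemma I_ccl_norm_separable:
  fixes sc :: "'k::real_or_complex \<Rightarrow> 'a::banach \<Rightarrow> 'a"
  assumes sc: "banach_over sc" and A: "A \<subseteq> dual_space sc"
    and sep: "separable_space (subtopology euclidean A)"
  shows "I_ccl sc A \<subseteq> closure A"
proof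
  fix f assume f: "f \<in> I_ccl sc A"
  show "f \<in> closure A"
    unfolding closure_approachable
  proof (intro allI impI)
    fix e :: real assume "0 < e"
    then have e2: "0 < e / 2"
      by simp
    obtain \<D> where \<D>: "countable \<D>" "A = \<Union>\<D>"
      "\<And>D h. D \<in> \<D> \<Longrightarrow> h \<in> weak_star_hull sc D \<Longrightarrow> \<exists>b\<in>A. dist b h \<le> e / 2"
      by (rule norm_separable_small_pieces[OF sc A sep subset_refl e2]) (rule that)
    have "f \<in> closure (\<Union>D\<in>\<D>. weak_star_hull sc D)"
      by (rule I_ccl_memD[OF f \<D>(1,2)])
    then have "\<exists>h\<in>(\<Union>D\<in>\<D>. weak_star_hull sc D). dist h f < e / 2"
      using e2 unfolding closure_approachable by blast
    then obtain D h where D: "D \<in> \<D>" "h \<in> weak_star_hull sc D" "dist h f < e / 2"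
      by (elim bexE UN_E)
    obtain b where "b \<in> A" "dist b h \<le> e / 2"
      using \<D>(3)[OF D(1,2)] by (elim bexE)
    then show "\<exists>b\<in>A. dist b f < e"
      using D(3) dist_triangle[of b f h] by (intro bexI[of _ b]) simp_all
  qed
qed

text \<open>
  The weak-star closed convex hulls of the pieces lie in the sum of \<open>convex hull B\<close> and a small ball,
  which is convex.
\<close>

lemma I_env_norm_separable:
  fixes sc :: "'k::real_or_complex \<Rightarrow> 'a::banach \<Rightarrow> 'a"
  assumes sc: "banach_over sc" and A: "A \<subseteq> dual_space sc"
    and sep: "separable_space (subtopology euclidean A)" and BA: "B \<subseteq> A"
  shows "I_env sc B \<subseteq> closure (convex hull B)"
proof
  fix f assume f: "f \<in> I_env sc B"
  show "f \<in> closure (convex hull B)"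
    unfolding closure_approachable
  proof (intro allI impI)
    fix e :: real assume "0 < e"
    then have e2: "0 < e / 2"
      by simp
    obtain \<D> where \<D>: "countable \<D>" "B = \<Union>\<D>"
      "\<And>D h. D \<in> \<D> \<Longrightarrow> h \<in> weak_star_hull sc D \<Longrightarrow> \<exists>b\<in>B. dist b h \<le> e / 2"
      by (rule norm_separable_small_pieces[OF sc A sep BA e2]) (rule that)
    define N where "N = (\<Union>x\<in>convex hull B. \<Union>y\<in>cball 0 (e / 2). {x + y})"
    have "convex N"
      unfolding N_def by (intro convex_sums convex_convex_hull convex_cball)
    moreover have "(\<Union>D\<in>\<D>. weak_star_hull sc D) \<subseteq> N"
    proof
      fix h assume "h \<in> (\<Union>D\<in>\<D>. weak_star_hull sc D)"
      then obtain D where D: "D \<in> \<D>" "h \<in> weak_star_hull sc D"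
        by (elim UN_E)
      obtain b where b: "b \<in> B" "dist b h \<le> e / 2"
        using \<D>(3)[OF D] by (elim bexE)
      have "b \<in> convex hull B"
        using b(1) by (rule hull_inc)
      moreover have "h - b \<in> cball 0 (e / 2)"
        using b(2) by (simp add: dist_norm norm_minus_commute)
      moreover have "h = b + (h - b)"
        by simp
      ultimately show "h \<in> N"
        unfolding N_def by blast
    qed
    ultimately have "convex hull (\<Union>D\<in>\<D>. weak_star_hull sc D) \<subseteq> N"
      by (simp add: hull_minimal)
    moreover have "f \<in> closure (convex hull (\<Union>D\<in>\<D>. weak_star_hull sc D))"
      by (rule I_env_memD[OF f \<D>(1,2)])
    ultimately have "f \<in> closure N"
      using closure_mono by blast
    then obtain h where h: "h \<in> N" "dist h f < e / 2"
      using e2 unfolding closure_approachable by blast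
    from h(1) obtain b y where b: "b \<in> convex hull B" "y \<in> cball 0 (e / 2)" "h = b + y"
      unfolding N_def by blast
    have "dist b h \<le> e / 2"
      using b(2) unfolding b(3) by (simp add: dist_norm)
    then show "\<exists>b\<in>convex hull B. dist b f < e"
      using h(2) b(1) dist_triangle[of b f h] by (intro bexI[of _ b]) simp_all
  qed
qed

lemma cl_IF_subset_weak_closure:
  fixes sc :: "'k::real_or_complex \<Rightarrow> 'a::banach \<Rightarrow> 'a"
  assumes A: "A \<subseteq> dual_space sc"
    and env: "\<And>B. B \<subseteq> A \<Longrightarrow> I_env sc B \<subseteq> closure (convex hull B)"
  shows "cl_IF sc A \<subseteq> weak sc closure_of A"
  unfolding weak_def
proof (rule cl_IF_subset_sigma_closure[OF A subset_refl _ bidual_mult])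
  show "bidual_space sc \<noteq> {}"
    using canonical_embedding_in_bidual by blast
  fix B \<phi> r
  assume BA: "B \<subseteq> A" and \<phi>: "\<phi> \<in> bidual_space sc" and B: "B \<subseteq> halfspace sc \<phi> r"
  have "convex hull B \<subseteq> halfspace sc \<phi> r"
    using B by (simp add: hull_minimal convex_halfspace[OF \<phi>])
  then have "closure (convex hull B) \<subseteq> halfspace sc \<phi> r"
    by (rule closure_minimal[OF _ closed_halfspace[OF \<phi>]])
  with env[OF BA] show "I_env sc B \<subseteq> halfspace sc \<phi> r"
    by (rule subset_trans)
qed

section \<open>Separable spaces\<close>

lemma I_bcl_subset_I_mn_separable:
  fixes sc :: "'k::real_or_complex \<Rightarrow> 'a::banach \<Rightarrow> 'a"
  assumes sc: "banach_over sc" and sep: "separable_space (euclidean :: 'a topology)"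
  shows "I_bcl sc A \<subseteq> I_mn sc A"
  unfolding I_bcl_def I_mn_def
  by (intro cover_Inter_mono order_trans[OF mackey_C_closure_separable[OF sc sep]]
      closure_mono UN_mono subset_refl mackey_closure_antimono embedded_subset_B1)

lemma I_cbcl_subset_I_ww_separable:
  fixes sc :: "'k::real_or_complex \<Rightarrow> 'a::banach \<Rightarrow> 'a"
  assumes sc: "banach_over sc" and sep: "separable_space (euclidean :: 'a topology)"
  shows "I_cbcl sc A \<subseteq> I_ww sc A"
  unfolding I_cbcl_def I_ww_def weak_def C_set_separable[OF sc sep]
  by (intro cover_Inter_mono closure_of_mono UN_mono subset_refl B1_closure_subset_weak_star_closure)

lemma weak_closure_subset_I_cbcl:
  assumes A: "A \<subseteq> dual_space sc"
  shows "weak sc closure_of A \<subseteq> I_cbcl sc A"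
  unfolding I_cbcl_def weak_def
proof (rule cover_Inter_greatest, rule order_trans[OF sigma_closure_antimono[OF C_subset_bidual]])
  fix E :: "nat \<Rightarrow> _" assume AE: "A = (\<Union>n. E n)"
  show "sigma_dual sc (C_set sc) closure_of A \<subseteq> sigma_dual sc (C_set sc) closure_of
      (\<Union>n. sigma_dual sc (B1_set sc) closure_of (convex hull (E n)))"
    unfolding AE
    by (intro closure_of_mono UN_mono subset_refl subset_sigma_hull cover_part_subset[OF A AE])
qed

section \<open>Independent sequences span \<open>\<ell>\<^sub>1\<close>\<close>

text \<open>
  One of the families of real parts and imaginary parts carries half of the sum of the norms; take its
  signs.
\<close>

lemma sign_pattern_sum:
  fixes a :: "nat \<Rightarrow> 'k::real_or_complex"
  shows "\<exists>\<sigma>. (\<Sum>k<n. norm (a k)) \<le> 2 * norm (\<Sum>k<n. (if k \<in> \<sigma> then a k else - a k))"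
proof -
  have half: "\<exists>\<sigma>. (\<Sum>k<n. \<bar>re_part (c * a k)\<bar>) \<le> norm (\<Sum>k<n. (if k \<in> \<sigma> then a k else - a k))"
    if c: "norm c \<le> 1" for c :: 'k
  proof (intro exI)
    let ?\<sigma> = "{k. 0 \<le> re_part (c * a k)}"
    let ?s = "\<Sum>k<n. (if k \<in> ?\<sigma> then a k else - a k)"
    have "re_part (c * ?s) = (\<Sum>k<n. re_part (c * (if k \<in> ?\<sigma> then a k else - a k)))"
      by (simp only: sum_distrib_left re_part_sum)
    also have "\<dots> = (\<Sum>k<n. \<bar>re_part (c * a k)\<bar>)"
      by (intro sum.cong) (auto simp: re_part_minus)
    finally have "(\<Sum>k<n. \<bar>re_part (c * a k)\<bar>) \<le> norm (c * ?s)"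
      using re_part_le_norm[of "c * ?s"] by simp
    also have "\<dots> \<le> 1 * norm ?s"
      unfolding norm_mult by (intro mult_right_mono c norm_ge_zero)
    finally show "(\<Sum>k<n. \<bar>re_part (c * a k)\<bar>) \<le> norm ?s"
      by simp
  qed
  have sum: "(\<Sum>k<n. norm (a k)) \<le> (\<Sum>k<n. \<bar>re_part (1 * a k)\<bar>) + (\<Sum>k<n. \<bar>re_part (im_unit * a k)\<bar>)"
    unfolding sum.distrib[symmetric] mult_1 by (intro sum_mono norm_le_re_parts)
  obtain \<sigma> where \<sigma>: "(\<Sum>k<n. \<bar>re_part (1 * a k)\<bar>) \<le> norm (\<Sum>k<n. (if k \<in> \<sigma> then a k else - a k))"
    using half[of 1] by auto
  obtain \<tau> where \<tau>: "(\<Sum>k<n. \<bar>re_part (im_unit * a k)\<bar>) \<le> norm (\<Sum>k<n. (if k \<in> \<tau> then a k else - a k))"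
    using half[OF norm_im_unit_le] by (elim exE)
  show ?thesis
  proof (cases "norm (\<Sum>k<n. (if k \<in> \<tau> then a k else - a k)) \<le> norm (\<Sum>k<n. (if k \<in> \<sigma> then a k else - a k))")
    case True
    then show ?thesis
      using sum \<sigma> \<tau> by (intro exI[of _ \<sigma>]) linarith
  next
    case False
    then show ?thesis
      using sum \<sigma> \<tau> by (intro exI[of _ \<tau>]) linarith
  qed
qed

text \<open>
  If every sign pattern on \<open>y 0, \<dots>, y (n - 1)\<close> is realised by a functional taking values near
  \<open>q\<close> or \<open>p\<close>, the difference of the functionals of two opposite patterns sees
  \<open>y k\<close> as \<open>\<plusminus>(q - p)\<close>. Controlling the values up to a small ball, and not only
  their real parts, makes this work for complex coefficients.
\<close>

lemma independent_sequence_lower_bound: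
  fixes sc :: "'k::real_or_complex \<Rightarrow> 'a::banach \<Rightarrow> 'a" and y :: "nat \<Rightarrow> 'a"
  assumes r: "0 < r"
    and indep: "\<And>\<sigma>. \<exists>f\<in>dual_space sc. norm f \<le> r \<and>
      (\<forall>k<n. norm (blinfun_apply f (y k) - (if k \<in> \<sigma> then q else p)) \<le> \<eta>)"
  shows "(norm (q - p) / 2 - 2 * \<eta>) / (2 * r) * (\<Sum>k<n. norm (a k)) \<le> norm (\<Sum>k<n. sc (a k) (y k))"
proof -
  let ?S = "\<Sum>k<n. norm (a k)"
  obtain \<sigma> where \<sigma>: "?S \<le> 2 * norm (\<Sum>k<n. (if k \<in> \<sigma> then a k else - a k))"
    using sign_pattern_sum by blast
  obtain f where f: "f \<in> dual_space sc" "norm f \<le> r"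
    "\<And>k. k < n \<Longrightarrow> norm (blinfun_apply f (y k) - (if k \<in> \<sigma> then q else p)) \<le> \<eta>"
    using indep[of \<sigma>] by (elim bexE conjE) simp
  obtain g where g: "g \<in> dual_space sc" "norm g \<le> r"
    "\<And>k. k < n \<Longrightarrow> norm (blinfun_apply g (y k) - (if k \<in> - \<sigma> then q else p)) \<le> \<eta>"
    using indep[of "- \<sigma>"] by (elim bexE conjE) simp
  define h where "h = f - g"
  define s where "s = (\<lambda>k. if k \<in> \<sigma> then a k else - a k)"
  have hy: "norm (a k * blinfun_apply h (y k) - (q - p) * s k) \<le> norm (a k) * (2 * \<eta>)" if k: "k < n" for k
  proof -
    let ?u = "blinfun_apply f (y k) - (if k \<in> \<sigma> then q else p)"
    let ?v = "blinfun_apply g (y k) - (if k \<in> - \<sigma> then q else p)"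
    have "a k * blinfun_apply h (y k) - (q - p) * s k = a k * (?u - ?v)"
      by (simp add: h_def s_def blinfun.diff_left algebra_simps)
    moreover have "norm (?u - ?v) \<le> 2 * \<eta>"
      using norm_triangle_ineq4[of ?u ?v] f(3)[OF k] g(3)[OF k] by linarith
    ultimately show ?thesis
      by (simp only: norm_mult) (rule mult_left_mono, simp_all)
  qed
  have "blinfun_apply h (\<Sum>k<n. sc (a k) (y k)) = (\<Sum>k<n. a k * blinfun_apply h (y k))"
    using dual_space_diff[OF f(1) g(1)] by (simp add: h_def blinfun.sum_right dual_spaceD)
  then have "norm (blinfun_apply h (\<Sum>k<n. sc (a k) (y k)) - (q - p) * (\<Sum>k<n. s k))
      = norm (\<Sum>k<n. a k * blinfun_apply h (y k) - (q - p) * s k)"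
    by (simp add: sum_subtractf sum_distrib_left)
  also have "\<dots> \<le> (\<Sum>k<n. norm (a k) * (2 * \<eta>))"
    by (rule sum_norm_le) (use hy in simp)
  also have "\<dots> = 2 * \<eta> * ?S"
    by (simp add: sum_distrib_left mult.commute)
  finally have near: "norm (blinfun_apply h (\<Sum>k<n. sc (a k) (y k)) - (q - p) * (\<Sum>k<n. s k)) \<le> 2 * \<eta> * ?S" .
  have "norm (q - p) * ?S \<le> norm (q - p) * (2 * norm (\<Sum>k<n. s k))"
    unfolding s_def by (intro mult_left_mono \<sigma> norm_ge_zero)
  then have "norm (q - p) / 2 * ?S \<le> norm ((q - p) * (\<Sum>k<n. s k))"
    by (simp add: norm_mult)
  also have "\<dots> \<le> norm (blinfun_apply h (\<Sum>k<n. sc (a k) (y k))) + 2 * \<eta> * ?S"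
    using near norm_triangle_ineq4[of "blinfun_apply h (\<Sum>k<n. sc (a k) (y k))"
        "blinfun_apply h (\<Sum>k<n. sc (a k) (y k)) - (q - p) * (\<Sum>k<n. s k)"] by simp
  finally have "(norm (q - p) / 2 - 2 * \<eta>) * ?S \<le> norm (blinfun_apply h (\<Sum>k<n. sc (a k) (y k)))"
    by (simp add: left_diff_distrib)
  also have "\<dots> \<le> norm h * norm (\<Sum>k<n. sc (a k) (y k))"
    by (rule norm_blinfun)
  also have "\<dots> \<le> (2 * r) * norm (\<Sum>k<n. sc (a k) (y k))"
    using norm_triangle_ineq4[of f g] f(2) g(2) unfolding h_def by (intro mult_right_mono) auto
  finally show ?thesis
    using r by (simp add: field_simps)
qed

lemma contains_l1I:
  fixes sc :: "'k::real_or_complex \<Rightarrow> 'a::banach \<Rightarrow> 'a" and y :: "nat \<Rightarrow> 'a"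
  assumes sc: "banach_over sc" and m: "0 < m" and M: "\<And>k. norm (y k) \<le> M"
    and lower: "\<And>n (a :: nat \<Rightarrow> 'k). m * (\<Sum>k<n. norm (a k)) \<le> norm (\<Sum>k<n. sc (a k) (y k))"
  shows "contains_l1 sc"
proof -
  define T where "T = (\<lambda>a. \<Sum>k. sc (a k) (y k))"
  have le: "norm (sc (a k) (y k)) \<le> M * norm (a k)" for a k
    using mult_left_mono[OF M[of k], of "norm (a k)"] by (simp add: banach_overD(5)[OF sc] mult.commute)
  have sum_norm: "summable (\<lambda>k. norm (sc (a k) (y k)))" if "a \<in> l1_space" for a
  proof (rule summable_comparison_test'[where N = 0])
    show "summable (\<lambda>k. M * norm (a k))"
      using that unfolding l1_space_def by (intro summable_mult) simp
    show "norm (norm (sc (a k) (y k))) \<le> M * norm (a k)" for k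
      using le[of a k] by simp
  qed
  have sum: "summable (\<lambda>k. sc (a k) (y k))" if "a \<in> l1_space" for a
    by (rule summable_norm_cancel[OF sum_norm[OF that]])
  have add: "T (\<lambda>n. a n + b n) = T a + T b" if "a \<in> l1_space" "b \<in> l1_space" for a b
    unfolding T_def banach_overD(2)[OF sc] by (rule suminf_add[symmetric, OF sum[OF that(1)] sum[OF that(2)]])
  have scale: "T (\<lambda>n. c * a n) = sc c (T a)" if "a \<in> l1_space" for a c
  proof -
    have "bounded_linear (sc c)"
    proof (rule bounded_linear_intro)
      show "sc c (r *\<^sub>R x) = r *\<^sub>R sc c x" for r x
        unfolding banach_overD(6)[OF sc, symmetric] banach_overD(3)[OF sc] by (simp add: mult.commute)
      show "norm (sc c x) \<le> norm x * norm c" for x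
        by (simp add: banach_overD(5)[OF sc])
    qed (rule banach_overD(1)[OF sc])
    then have "(\<Sum>k. sc c (sc (a k) (y k))) = sc c (\<Sum>k. sc (a k) (y k))"
      by (rule bounded_linear.suminf[OF _ sum[OF that], symmetric])
    then show ?thesis
      unfolding T_def banach_overD(3)[OF sc] .
  qed
  have bounds: "m * l1_norm a \<le> norm (T a) \<and> norm (T a) \<le> M * l1_norm a" if a: "a \<in> l1_space" for a
  proof
    have sa: "summable (\<lambda>k. norm (a k))"
      using a by (simp add: l1_space_def)
    have "(\<lambda>n. m * (\<Sum>k<n. norm (a k))) \<longlonglongrightarrow> m * l1_norm a"
      unfolding l1_norm_def by (intro tendsto_mult_left summable_LIMSEQ sa)
    moreover have "(\<lambda>n. norm (\<Sum>k<n. sc (a k) (y k))) \<longlonglongrightarrow> norm (T a)"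
      unfolding T_def by (intro tendsto_norm summable_LIMSEQ sum a)
    ultimately show "m * l1_norm a \<le> norm (T a)"
      by (rule LIMSEQ_le) (use lower in blast)
    have "norm (T a) \<le> (\<Sum>k. norm (sc (a k) (y k)))"
      unfolding T_def by (rule summable_norm[OF sum_norm[OF a]])
    also have "\<dots> \<le> (\<Sum>k. M * norm (a k))"
      by (intro suminf_le le sum_norm a summable_mult sa)
    also have "\<dots> = M * l1_norm a"
      unfolding l1_norm_def by (rule suminf_mult[OF sa])
    finally show "norm (T a) \<le> M * l1_norm a" .
  qed
  show ?thesis
    unfolding contains_l1_def
    by (intro exI[of _ T] conjI ballI allI add scale exI[of _ m] exI[of _ M] m bounds)
qed

section \<open>Halfspaces of a separable space without \<open>\<ell>\<^sub>1\<close>\<close>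

text \<open>
  In the application \<open>\<O>\<close> consists of the open sets that meet a given set, and \<open>G F\<close> of the members of \<open>X\<close> that
  approximate an element of the bidual on the finite set \<open>F\<close>. A finite family of parts of \<open>U\<close> has to be
  hit by a single such approximation.
\<close>

definition always_hit ::
  "('b set \<Rightarrow> 'x set) \<Rightarrow> 'w set set \<Rightarrow> ('w set \<Rightarrow> 'x \<Rightarrow> bool) \<Rightarrow> 'w set \<Rightarrow> bool" where
  "always_hit G \<O> R U \<longleftrightarrow> (\<forall>\<W> F. finite \<W> \<and> \<W> \<subseteq> {W\<in>\<O>. W \<subseteq> U} \<and> finite F \<longrightarrow>
    (\<exists>x\<in>G F. \<forall>W\<in>\<W>. R W x))"

lemma always_hitD:
  assumes "always_hit G \<O> R U" "finite \<W>" "\<W> \<subseteq> {W\<in>\<O>. W \<subseteq> U}" "finite F"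
  shows "\<exists>x\<in>G F. \<forall>W\<in>\<W>. R W x"
  using assms unfolding always_hit_def by simp

lemma not_always_hit_iff:
  "\<not> always_hit G \<O> R U \<longleftrightarrow> (\<exists>\<W> F. finite \<W> \<and> \<W> \<subseteq> {W\<in>\<O>. W \<subseteq> U} \<and> finite F \<and>
    \<not> (\<exists>x\<in>G F. \<forall>W\<in>\<W>. R W x))"
  unfolding always_hit_def by simp

text \<open>
  A pigeonhole principle along a tree: if finitely many members of \<open>\<O>\<close> can always be hit
  simultaneously, each by some member of the finite set \<open>Q\<close>, then below some member of \<open>\<O>\<close> one fixed
  \<open>q \<in> Q\<close> suffices for all of them. If \<open>q\<close> fails on a finite family, then one member
  of that family must do without \<open>q\<close>, since otherwise finitely many failures could be combined.
\<close>

lemma always_hit_pigeonhole: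
  fixes hit :: "'w set \<Rightarrow> 'x \<Rightarrow> 'q \<Rightarrow> bool" and G :: "'b set \<Rightarrow> 'x set"
  assumes Q: "finite Q" and G: "\<And>F F'. F \<subseteq> F' \<Longrightarrow> G F' \<subseteq> G F"
    and mono: "\<And>W W' x q. W \<subseteq> W' \<Longrightarrow> hit W x q \<Longrightarrow> hit W' x q"
    and U: "U \<in> \<O>" "always_hit G \<O> (\<lambda>W x. \<exists>q\<in>Q. hit W x q) U"
  shows "\<exists>V\<in>\<O>. \<exists>q\<in>Q. always_hit G \<O> (\<lambda>W x. hit W x q) V"
  using Q U
proof (induction Q arbitrary: U)
  case empty
  have "\<exists>x\<in>G {}. \<forall>W\<in>{U}. \<exists>q\<in>{}. hit W x q"
    by (rule always_hitD[OF empty.prems(2)]) (use empty.prems(1) in auto)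
  then show ?case
    by simp
next
  case (insert q Q)
  show ?case
  proof (cases "always_hit G \<O> (\<lambda>W x. hit W x q) U")
    case True
    show ?thesis
      by (rule bexI[where x = U], rule bexI[where x = q], rule True, rule insertI1,
          rule insert.prems(1))
  next
    case False
    then obtain \<W>0 F0 where 0: "finite \<W>0" "\<W>0 \<subseteq> {W\<in>\<O>. W \<subseteq> U}" "finite F0"
      and fail: "\<not> (\<exists>x\<in>G F0. \<forall>W\<in>\<W>0. hit W x q)"
      unfolding not_always_hit_iff by (elim exE conjE)
    have "\<exists>W0\<in>\<W>0. always_hit G \<O> (\<lambda>W x. \<exists>q\<in>Q. hit W x q) W0"
    proof (rule ccontr)
      assume "\<not> ?thesis"
      then have "\<forall>W0\<in>\<W>0. \<exists>\<W> F. finite \<W> \<and> \<W> \<subseteq> {W\<in>\<O>. W \<subseteq> W0} \<and> finite F \<and>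
          \<not> (\<exists>x\<in>G F. \<forall>W\<in>\<W>. \<exists>q\<in>Q. hit W x q)"
        unfolding not_always_hit_iff[symmetric] by (simp only: bex_simps ball_simps)
      from bchoice[OF this] obtain K where "\<forall>W0\<in>\<W>0. \<exists>F. finite (K W0) \<and> K W0 \<subseteq> {W\<in>\<O>. W \<subseteq> W0} \<and> finite F \<and>
          \<not> (\<exists>x\<in>G F. \<forall>W\<in>K W0. \<exists>q\<in>Q. hit W x q)" ..
      from bchoice[OF this] obtain H where KH: "\<forall>W0\<in>\<W>0. finite (K W0) \<and> K W0 \<subseteq> {W\<in>\<O>. W \<subseteq> W0} \<and> finite (H W0) \<and>
          \<not> (\<exists>x\<in>G (H W0). \<forall>W\<in>K W0. \<exists>q\<in>Q. hit W x q)" ..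
      let ?K = "\<Union>W0\<in>\<W>0. K W0" and ?F = "F0 \<union> (\<Union>W0\<in>\<W>0. H W0)"
      have "\<exists>x\<in>G ?F. \<forall>W\<in>?K. \<exists>q\<in>insert q Q. hit W x q"
      proof (rule always_hitD[OF insert.prems(2)])
        show "finite ?K" "finite ?F"
          using 0(1,3) KH by simp_all
        show "?K \<subseteq> {W\<in>\<O>. W \<subseteq> U}"
        proof
          fix W assume "W \<in> ?K"
          then obtain W0 where W0: "W0 \<in> \<W>0" "W \<in> K W0"
            by (rule UN_E)
          have "K W0 \<subseteq> {W\<in>\<O>. W \<subseteq> W0}"
            using KH W0(1) by blast
          then have "W \<in> \<O>" "W \<subseteq> W0"
            using W0(2) by blast+
          moreover have "W0 \<subseteq> U"
            using 0(2) W0(1) by blast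
          ultimately show "W \<in> {W\<in>\<O>. W \<subseteq> U}"
            by blast
        qed
      qed
      then obtain x where x: "x \<in> G ?F" "\<forall>W\<in>?K. \<exists>q\<in>insert q Q. hit W x q"
        by (rule bexE)
      have "x \<in> G F0"
        by (rule subsetD[OF G x(1)]) simp
      then obtain W0 where W0: "W0 \<in> \<W>0" "\<not> hit W0 x q"
        using fail by blast
      have "x \<in> G (H W0)"
        by (rule subsetD[OF G x(1)]) (use W0(1) in blast)
      moreover have "\<forall>W\<in>K W0. \<exists>q\<in>Q. hit W x q"
      proof
        fix W assume W: "W \<in> K W0"
        then have "W \<in> ?K"
          using W0(1) by blast
        then obtain q' where q': "q' \<in> insert q Q" "hit W x q'"
          using x(2) by blast
        have "K W0 \<subseteq> {W\<in>\<O>. W \<subseteq> W0}"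
          using KH W0(1) by blast
        then have "W \<subseteq> W0"
          using W by blast
        then have "q' \<noteq> q"
          using mono[of W W0 x q] q'(2) W0(2) by blast
        with q' show "\<exists>q\<in>Q. hit W x q"
          by blast
      qed
      ultimately have "\<exists>x\<in>G (H W0). \<forall>W\<in>K W0. \<exists>q\<in>Q. hit W x q"
        by (rule bexI[rotated])
      then show False
        using KH W0(1) by blast
    qed
    then obtain W0 where W0: "W0 \<in> \<W>0" "always_hit G \<O> (\<lambda>W x. \<exists>q\<in>Q. hit W x q) W0"
      by (rule bexE)
    have "W0 \<in> \<O>"
      using 0(2) W0(1) by blast
    from insert.IH[OF this W0(2)] show ?thesis
      by blast
  qed
qed

text \<open>
  The sets below form a \<open>\<sigma>\<close>-ideal. If \<open>\<phi>\<close> were the weak-star limit of a sequence \<open>(x\<^sub>n)\<close> in \<open>X\<close>, the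
  set \<open>Re \<phi> \<le> c\<close> would belong to it for \<open>c < d\<close>, with the covering sets \<open>{f | \<forall>m\<ge>n. Re (f x\<^sub>m) \<le> d}\<close>.
\<close>

definition weak_star_coverable ::
  "('k::real_or_complex \<Rightarrow> 'a::banach \<Rightarrow> 'a) \<Rightarrow> (('a \<Rightarrow>\<^sub>L 'k) \<Rightarrow> 'k) \<Rightarrow> real \<Rightarrow> ('a \<Rightarrow>\<^sub>L 'k) set \<Rightarrow> bool" where
  "weak_star_coverable sc \<phi> d S \<longleftrightarrow> (\<exists>\<E>. countable \<E> \<and> S \<subseteq> \<Union>\<E> \<and>
    (\<forall>E\<in>\<E>. \<forall>g\<in>weak_star_hull sc E. re_part (\<phi> g) \<le> d))"

lemma weak_star_coverable_mono:
  "weak_star_coverable sc \<phi> d T \<Longrightarrow> S \<subseteq> T \<Longrightarrow> weak_star_coverable sc \<phi> d S"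
  unfolding weak_star_coverable_def by (meson subset_trans)

lemma weak_star_coverable_Union:
  assumes "countable \<S>" "\<And>S. S \<in> \<S> \<Longrightarrow> weak_star_coverable sc \<phi> d S"
  shows "weak_star_coverable sc \<phi> d (\<Union>\<S>)"
proof -
  have "\<forall>S\<in>\<S>. \<exists>\<E>. countable \<E> \<and> S \<subseteq> \<Union>\<E> \<and>
      (\<forall>E\<in>\<E>. \<forall>g\<in>weak_star_hull sc E. re_part (\<phi> g) \<le> d)"
    using assms(2) unfolding weak_star_coverable_def by (rule ballI)
  from bchoice[OF this] obtain \<E> where \<E>: "\<forall>S\<in>\<S>. countable (\<E> S) \<and> S \<subseteq> \<Union>(\<E> S) \<and>
      (\<forall>E\<in>\<E> S. \<forall>g\<in>weak_star_hull sc E. re_part (\<phi> g) \<le> d)" ..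
  show ?thesis
    unfolding weak_star_coverable_def
  proof (intro exI[of _ "\<Union>S\<in>\<S>. \<E> S"] conjI)
    show "countable (\<Union>S\<in>\<S>. \<E> S)"
      using assms(1) \<E> by (intro countable_UN) blast+
    show "\<Union>\<S> \<subseteq> \<Union>(\<Union>S\<in>\<S>. \<E> S)"
    proof
      fix x assume "x \<in> \<Union>\<S>"
      then obtain S where S: "S \<in> \<S>" "x \<in> S"
        by (rule UnionE)
      then have "x \<in> \<Union>(\<E> S)"
        using \<E> by blast
      with S(1) show "x \<in> \<Union>(\<Union>S\<in>\<S>. \<E> S)"
        by blast
    qed
    show "\<forall>E\<in>\<Union>S\<in>\<S>. \<E> S. \<forall>g\<in>weak_star_hull sc E. re_part (\<phi> g) \<le> d"
    proof
      fix E assume "E \<in> (\<Union>S\<in>\<S>. \<E> S)"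
      then obtain S where "S \<in> \<S>" "E \<in> \<E> S"
        by (rule UN_E)
      then show "\<forall>g\<in>weak_star_hull sc E. re_part (\<phi> g) \<le> d"
        using \<E> by blast
    qed
  qed
qed

lemma weak_star_coverable_Un:
  assumes "weak_star_coverable sc \<phi> d S" "weak_star_coverable sc \<phi> d T"
  shows "weak_star_coverable sc \<phi> d (S \<union> T)"
  using weak_star_coverable_Union[of "{S, T}" sc \<phi> d] assms by auto

lemma finite_net:
  fixes S :: "'k::real_or_complex set"
  assumes S: "closed S" "\<And>z. z \<in> S \<Longrightarrow> norm z \<le> r" and e: "0 < e"
  obtains P where "finite P" "P \<subseteq> S" "S \<subseteq> (\<Union>p\<in>P. ball p e)"
proof -
  have "bounded S"
    using S(2) unfolding bounded_iff by blast
  then have "compact S"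
    using S(1) by (simp add: compact_eq_bounded_closed)
  moreover have "S \<subseteq> (\<Union>p\<in>S. ball p e)"
    using e by auto
  ultimately obtain P where "P \<subseteq> S" "finite P" "S \<subseteq> (\<Union>p\<in>P. ball p e)"
    using compactE_image[of S S "\<lambda>p. ball p e"] by auto
  then show ?thesis
    using that by blast
qed

lemma closed_re_part_le: "closed {z :: 'k::real_or_complex. re_part z \<le> c}"
  by (intro closed_Collect_le bounded_linear.continuous_on[OF bounded_linear_re_part] continuous_intros)

lemma closed_re_part_ge: "closed {z :: 'k::real_or_complex. c \<le> re_part z}"
  by (intro closed_Collect_le bounded_linear.continuous_on[OF bounded_linear_re_part] continuous_intros)

lemma closed_norm_le: "closed {z :: 'k::real_normed_vector. norm z \<le> r}"
  by (intro closed_Collect_le continuous_intros)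

text \<open>
  If a halfspace of an element \<open>\<phi>\<close> of the bidual is not coverable, remove all its coverable relatively
  open parts; by separability countably many suffice, so what remains, \<open>S\<close>, is nonempty and none of its
  nonempty relatively open parts is coverable. On such a part \<open>Re \<phi>\<close> is at most \<open>c\<close>, yet it exceeds
  \<open>d\<close> somewhere on the weak-star closed convex hull. Approximating \<open>\<phi>\<close> by \<open>x \<in> X\<close> at finitely many points of both kinds
  splits finitely many parts at once into two nonempty parts, since a weak-star open halfspace that meets
  the closed convex hull of a set meets the set. Iteration gives an independent sequence.

  Relatively open parts are taken with respect to evaluation at a dense sequence \<open>x\<close>. The values of \<open>\<phi>\<close> on
  \<open>S\<close> are confined to a ball around \<open>p\<close>, which settles one side of the splittings in advance. In the end the
  values at the members of the sequence are within \<open>2 \<eta>\<close> of \<open>p\<close> or of some \<open>q\<close> with \<open>Re q \<ge> d - \<eta>\<close>, and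
  \<open>independent_sequence_lower_bound\<close> asks for \<open>8 \<eta> < |q - p|\<close>; hence the hypothesis \<open>9 \<eta> < d - c\<close>.
\<close>

locale uncoverable =
  fixes sc :: "'k::real_or_complex \<Rightarrow> 'a::banach \<Rightarrow> 'a" and \<phi> :: "('a \<Rightarrow>\<^sub>L 'k) \<Rightarrow> 'k"
    and c d M \<eta> r :: real and p :: 'k and x :: "nat \<Rightarrow> 'a" and S :: "('a \<Rightarrow>\<^sub>L 'k) set"
  assumes sc: "banach_over sc" and \<phi>: "\<phi> \<in> bidual_space sc"
    and M: "0 < M" "\<And>f. norm (\<phi> f) \<le> M * norm f" and \<eta>: "0 < \<eta>" "9 * \<eta> < d - c" and r: "0 < r"
    and dense: "\<And>y e. 0 < e \<Longrightarrow> \<exists>z\<in>range x. dist z y < e"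
    and p: "re_part p \<le> c"
    and S: "S \<subseteq> dual_space sc" "\<And>f. f \<in> S \<Longrightarrow> norm f \<le> r" "\<And>f. f \<in> S \<Longrightarrow> norm (\<phi> f - p) < \<eta>"
    and nonempty: "S \<noteq> {}"
    and uncoverable: "\<And>U. open U \<Longrightarrow> S \<inter> (\<lambda>f n. blinfun_apply f (x n)) -` U \<noteq> {} \<Longrightarrow>
      \<not> weak_star_coverable sc \<phi> d (S \<inter> (\<lambda>f n. blinfun_apply f (x n)) -` U)"
begin

definition ev :: "('a \<Rightarrow>\<^sub>L 'k) \<Rightarrow> nat \<Rightarrow> 'k" where
  "ev f = (\<lambda>n. blinfun_apply f (x n))"

definition parts :: "(nat \<Rightarrow> 'k) set set" where
  "parts = {U. open U \<and> S \<inter> ev -` U \<noteq> {}}"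

definition approximants :: "('a \<Rightarrow>\<^sub>L 'k) set \<Rightarrow> nat set" where
  "approximants F = {m. norm (x m) \<le> M + 2 \<and>
    (\<forall>f\<in>F \<inter> dual_space sc. norm (blinfun_apply f (x m) - \<phi> f) < \<eta>)}"

lemma approximants_antimono: "F \<subseteq> F' \<Longrightarrow> approximants F' \<subseteq> approximants F"
  unfolding approximants_def by blast

lemma approximants_nonempty:
  assumes "finite F"
  obtains m where "m \<in> approximants F"
proof -
  have fin: "finite (F \<inter> dual_space sc)" and sub: "F \<inter> dual_space sc \<subseteq> dual_space sc"
    using assms by simp_all
  have "\<exists>y\<in>range x. norm y \<le> M + 2 \<and> (\<forall>f\<in>F \<inter> dual_space sc. norm (blinfun_apply f y - \<phi> f) < \<eta>)"
    by (rule Helly_dense[OF sc \<phi> M(2,1) fin sub dense \<eta>(1)])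
  then obtain y where y: "y \<in> range x" "norm y \<le> M + 2"
    "\<forall>f\<in>F \<inter> dual_space sc. norm (blinfun_apply f y - \<phi> f) < \<eta>"
    by (elim bexE conjE)
  obtain m where "y = x m"
    using y(1) by (rule rangeE)
  with y(2,3) have "m \<in> approximants F"
    unfolding approximants_def by simp
  then show ?thesis
    by (rule that)
qed

lemma exceeding_hull_point:
  assumes "W \<in> parts"
  shows "\<exists>t. t \<in> weak_star_hull sc (S \<inter> ev -` W) \<and> d < re_part (\<phi> t)"
proof (rule ccontr)
  assume "\<not> ?thesis"
  then have "\<forall>g\<in>weak_star_hull sc (S \<inter> ev -` W). re_part (\<phi> g) \<le> d"
    by (simp add: not_less Ball_def)
  then have "weak_star_coverable sc \<phi> d (S \<inter> ev -` W)"
    unfolding weak_star_coverable_def by (intro exI[of _ "{S \<inter> ev -` W}"]) simp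
  moreover have "\<not> weak_star_coverable sc \<phi> d (S \<inter> ev -` W)"
    using assms uncoverable[of W] unfolding parts_def ev_def by blast
  ultimately show False
    by blast
qed

definition hits :: "(nat \<Rightarrow> 'k) set \<Rightarrow> nat \<Rightarrow> 'k \<Rightarrow> bool" where
  "hits W m q \<longleftrightarrow> (\<exists>f\<in>S. ev f \<in> W \<and> norm (ev f m - q) < \<eta>)"

lemma UNIV_in_parts: "UNIV \<in> parts"
  using nonempty by (simp add: parts_def)

text \<open>
  Points with \<open>Re \<phi> > d\<close> in the hulls of finitely many parts force a good approximation of \<open>\<phi>\<close> to take
  values with real part at least \<open>d - \<eta>\<close> on these parts. Such values lie in a compact set, so finitely many
  small balls suffice, and the pigeonhole principle selects one of them for all parts of some \<open>V\<close>.
\<close>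

lemma homogeneous_part:
  obtains V q where "V \<in> parts" "d - \<eta> \<le> re_part q" "always_hit approximants parts (\<lambda>W m. hits W m q) V"
proof -
  define K where "K = {z :: 'k. norm z \<le> r * (M + 2)} \<inter> {z. d - \<eta> \<le> re_part z}"
  have "closed K"
    unfolding K_def by (intro closed_Int closed_norm_le closed_re_part_ge)
  moreover have "norm z \<le> r * (M + 2)" if "z \<in> K" for z
    using that unfolding K_def by blast
  ultimately obtain Q where Q: "finite Q" "Q \<subseteq> K" "K \<subseteq> (\<Union>q\<in>Q. ball q \<eta>)"
    by (rule finite_net[OF _ _ \<eta>(1)]) assumption
  have "always_hit approximants parts (\<lambda>W m. \<exists>q\<in>Q. hits W m q) UNIV"
    unfolding always_hit_def
  proof (intro allI impI)
    fix \<W> and F :: "('a \<Rightarrow>\<^sub>L 'k) set"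
    assume "finite \<W> \<and> \<W> \<subseteq> {W \<in> parts. W \<subseteq> UNIV} \<and> finite F"
    then have \<W>: "finite \<W>" "\<And>W. W \<in> \<W> \<Longrightarrow> W \<in> parts" and F: "finite F"
      by blast+
    have "\<forall>W\<in>\<W>. \<exists>t. t \<in> weak_star_hull sc (S \<inter> ev -` W) \<and> d < re_part (\<phi> t)"
      by (intro ballI exceeding_hull_point \<W>(2))
    from bchoice[OF this] obtain t where
      t: "\<forall>W\<in>\<W>. t W \<in> weak_star_hull sc (S \<inter> ev -` W) \<and> d < re_part (\<phi> (t W))" ..
    have "finite (F \<union> t ` \<W>)"
      using F \<W>(1) by simp
    then obtain m where m: "m \<in> approximants (F \<union> t ` \<W>)"
      by (rule approximants_nonempty)
    have "\<exists>q\<in>Q. hits W m q" if W: "W \<in> \<W>" for W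
    proof -
      have tW: "t W \<in> weak_star_hull sc (S \<inter> ev -` W)" "d < re_part (\<phi> (t W))"
        using t W by blast+
      have td: "t W \<in> dual_space sc"
        using tW(1) weak_star_closure_subset_dual by blast
      have "norm (blinfun_apply (t W) (x m) - \<phi> (t W)) < \<eta>"
        using m W td unfolding approximants_def by blast
      then have big: "d - \<eta> < re_part (blinfun_apply (t W) (x m))"
        using tW(2) abs_re_part_le[of "blinfun_apply (t W) (x m) - \<phi> (t W)"] by (simp add: re_part_diff)
      have "\<exists>f\<in>S \<inter> ev -` W. d - \<eta> \<le> re_part (ev f m)"
      proof (rule ccontr)
        assume none: "\<not> ?thesis"
        have "re_part (ev f m) \<le> d - \<eta>" if "f \<in> S \<inter> ev -` W" for f
        proof (rule ccontr)
          assume "\<not> re_part (ev f m) \<le> d - \<eta>"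
          then have "d - \<eta> \<le> re_part (ev f m)"
            by simp
          with that none show False
            by blast
        qed
        then have "S \<inter> ev -` W \<subseteq> halfspace sc (canonical_embedding sc (x m)) (d - \<eta>)"
          using S(1) by (auto simp: canonical_embedding_apply ev_def subset_iff)
        from sigma_hull_subset_halfspace[OF canonical_in_embedded embedded_subset_bidual this]
        have "re_part (canonical_embedding sc (x m) (t W)) \<le> d - \<eta>"
          using tW(1) unfolding weak_star_def by blast
        with big td show False
          by (simp add: canonical_embedding_apply)
      qed
      then obtain f where f: "f \<in> S" "ev f \<in> W" "d - \<eta> \<le> re_part (ev f m)"
        by blast
      have "norm (ev f m) \<le> norm f * norm (x m)"
        unfolding ev_def by (rule norm_blinfun)
      also have "\<dots> \<le> r * (M + 2)"
        using S(2)[OF f(1)] m r unfolding approximants_def by (intro mult_mono) auto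
      finally have "ev f m \<in> K"
        using f(3) by (simp add: K_def)
      then have "ev f m \<in> (\<Union>q\<in>Q. ball q \<eta>)"
        by (rule subsetD[OF Q(3)])
      then obtain q where "q \<in> Q" "norm (ev f m - q) < \<eta>"
        by (elim UN_E) (simp add: dist_norm norm_minus_commute)
      with f show ?thesis
        unfolding hits_def by blast
    qed
    moreover have "m \<in> approximants F"
      by (rule subsetD[OF approximants_antimono m]) simp
    ultimately show "\<exists>m\<in>approximants F. \<forall>W\<in>\<W>. \<exists>q\<in>Q. hits W m q"
      by blast
  qed
  from always_hit_pigeonhole[where G = approximants and hit = hits, OF Q(1) approximants_antimono _ UNIV_in_parts this]
  have "\<exists>V\<in>parts. \<exists>q\<in>Q. always_hit approximants parts (\<lambda>W m. hits W m q) V"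
    unfolding hits_def by blast
  then obtain V q where V: "V \<in> parts" "q \<in> Q" "always_hit approximants parts (\<lambda>W m. hits W m q) V"
    by (elim bexE)
  have "q \<in> K"
    by (rule subsetD[OF Q(2) V(2)])
  then have "d - \<eta> \<le> re_part q"
    unfolding K_def by blast
  then show ?thesis
    by (rule that[OF V(1) _ V(3)])
qed

definition independent :: "(nat \<Rightarrow> 'k) set \<Rightarrow> 'k \<Rightarrow> nat list \<Rightarrow> bool" where
  "independent V q ms \<longleftrightarrow> (\<forall>m\<in>set ms. norm (x m) \<le> M + 2) \<and>
    (\<forall>\<sigma>. \<exists>f\<in>S. ev f \<in> V \<and> (\<forall>k<length ms. norm (ev f (ms ! k) - (if k \<in> \<sigma> then q else p)) < 2 * \<eta>))"

text \<open>
  The parts realising the patterns so far are split by one approximation \<open>x m\<close> that is good at a point of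
  each part, where the value is near \<open>p\<close>, and that hits each part near \<open>q\<close>.
\<close>

lemma independent_extend:
  assumes V: "V \<in> parts" "always_hit approximants parts (\<lambda>W m. hits W m q) V"
    and ind: "independent V q ms"
  shows "\<exists>m. independent V q (ms @ [m])"
proof -
  let ?n = "length ms"
  define W where "W = (\<lambda>\<sigma>. V \<inter> (\<Inter>k\<in>{..<?n}. {u. norm (u (ms ! k) - (if k \<in> \<sigma> then q else p)) < 2 * \<eta>}))"
  have openW: "open (W \<sigma>)" for \<sigma>
    unfolding W_def using V(1) unfolding parts_def
    by (intro open_Int open_INT ballI open_Collect_less continuous_intros
        continuous_on_product_coordinates) auto
  have ex: "\<exists>f\<in>S. ev f \<in> W \<sigma>" for \<sigma>
  proof -
    obtain f where f: "f \<in> S" "ev f \<in> V"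
      "\<forall>k<?n. norm (ev f (ms ! k) - (if k \<in> \<sigma> then q else p)) < 2 * \<eta>"
      using ind unfolding independent_def by blast
    have "ev f \<in> W \<sigma>"
      unfolding W_def using f(2,3) by simp
    with f(1) show ?thesis
      by (rule bexI[rotated])
  qed
  have W_parts: "W \<sigma> \<in> {W \<in> parts. W \<subseteq> V}" for \<sigma>
  proof -
    obtain f where "f \<in> S" "ev f \<in> W \<sigma>"
      using ex by (rule bexE)
    then have "S \<inter> ev -` W \<sigma> \<noteq> {}"
      by blast
    moreover have "W \<sigma> \<subseteq> V"
      unfolding W_def by (rule Int_lower1)
    ultimately show ?thesis
      unfolding parts_def using openW by simp
  qed
  obtain s where s: "\<And>\<sigma>. s \<sigma> \<in> S" "\<And>\<sigma>. ev (s \<sigma>) \<in> W \<sigma>"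
    using ex by metis
  have "\<exists>m\<in>approximants (s ` Pow {..<?n}). \<forall>U\<in>W ` Pow {..<?n}. hits U m q"
    by (rule always_hitD[OF V(2)]) (use W_parts in auto)
  then obtain m where m: "m \<in> approximants (s ` Pow {..<?n})" "\<forall>U\<in>W ` Pow {..<?n}. hits U m q"
    by (rule bexE)
  have W_cut: "W (\<sigma> \<inter> {..<?n}) = W \<sigma>" for \<sigma>
    unfolding W_def by (intro arg_cong2[where f = "(\<inter>)"] INF_cong refl) auto
  have "\<exists>f\<in>S. ev f \<in> V \<and> (\<forall>k<length (ms @ [m]). norm (ev f ((ms @ [m]) ! k) - (if k \<in> \<sigma> then q else p)) < 2 * \<eta>)" for \<sigma>
  proof -
    let ?\<tau> = "\<sigma> \<inter> {..<?n}"
    have \<tau>: "?\<tau> \<in> Pow {..<?n}"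
      by blast
    have "\<exists>f\<in>S. ev f \<in> W ?\<tau> \<and> norm (ev f m - (if ?n \<in> \<sigma> then q else p)) < 2 * \<eta>"
    proof (cases "?n \<in> \<sigma>")
      case True
      have "hits (W ?\<tau>) m q"
        using m(2) \<tau> by blast
      then obtain f where "f \<in> S" "ev f \<in> W ?\<tau>" "norm (ev f m - q) < \<eta>"
        unfolding hits_def by blast
      then show ?thesis
        using True \<eta>(1) by (intro bexI[of _ f]) simp_all
    next
      case False
      have sd: "s ?\<tau> \<in> dual_space sc"
        using s(1) S(1) by blast
      then have "norm (blinfun_apply (s ?\<tau>) (x m) - \<phi> (s ?\<tau>)) < \<eta>"
        using m(1) \<tau> unfolding approximants_def by blast
      moreover have "norm (\<phi> (s ?\<tau>) - p) < \<eta>"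
        by (rule S(3)[OF s(1)])
      ultimately have "norm (ev (s ?\<tau>) m - p) < 2 * \<eta>"
        using norm_triangle_ineq[of "blinfun_apply (s ?\<tau>) (x m) - \<phi> (s ?\<tau>)" "\<phi> (s ?\<tau>) - p"]
        unfolding ev_def by simp
      then show ?thesis
        using False s by (intro bexI[of _ "s ?\<tau>"]) simp_all
    qed
    then obtain f where f: "f \<in> S" "ev f \<in> W \<sigma>" "norm (ev f m - (if ?n \<in> \<sigma> then q else p)) < 2 * \<eta>"
      unfolding W_cut by (elim bexE conjE)
    have fV: "ev f \<in> V" and old: "\<And>k. k < ?n \<Longrightarrow> norm (ev f (ms ! k) - (if k \<in> \<sigma> then q else p)) < 2 * \<eta>"
      using f(2) unfolding W_def by simp_all
    have "norm (ev f ((ms @ [m]) ! k) - (if k \<in> \<sigma> then q else p)) < 2 * \<eta>" if "k < length (ms @ [m])" for k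
    proof (cases "k = ?n")
      case True
      then show ?thesis
        using f(3) by simp
    next
      case False
      then have "k < ?n"
        using that by simp
      then show ?thesis
        using old[of k] by (simp add: nth_append)
    qed
    with f(1) fV show ?thesis
      by (intro bexI[of _ f]) simp_all
  qed
  moreover have "norm (x m) \<le> M + 2"
    using m(1) unfolding approximants_def by blast
  ultimately have "independent V q (ms @ [m])"
    using ind unfolding independent_def by simp
  then show ?thesis
    by (rule exI)
qed

lemma contains_l1: "contains_l1 sc"
proof -
  obtain V q where V: "V \<in> parts" "d - \<eta> \<le> re_part q" "always_hit approximants parts (\<lambda>W m. hits W m q) V"
    by (rule homogeneous_part)
  have "\<exists>L. \<forall>n. (independent V q (L n) \<and> length (L n) = n) \<and> (\<exists>m. L (Suc n) = L n @ [m])"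
  proof (rule dependent_nat_choice)
    have "independent V q []"
      using V(1) unfolding independent_def parts_def by auto
    then show "\<exists>ms. independent V q ms \<and> length ms = 0"
      by (intro exI[of _ "[]"]) simp
  next
    fix ms n assume ms: "independent V q ms \<and> length ms = n"
    then obtain m where "independent V q (ms @ [m])"
      using independent_extend[OF V(1,3)] by blast
    with ms show "\<exists>ms'. (independent V q ms' \<and> length ms' = Suc n) \<and> (\<exists>m. ms' = ms @ [m])"
      by (intro exI[of _ "ms @ [m]"]) simp
  qed
  then obtain L where ind: "\<forall>n. (independent V q (L n) \<and> length (L n) = n) \<and> (\<exists>m. L (Suc n) = L n @ [m])"
    by (rule exE)
  have L: "independent V q (L n)" "length (L n) = n" "\<exists>m. L (Suc n) = L n @ [m]" for n
    using ind by simp_all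
  define y where "y = (\<lambda>k. L (Suc k) ! k)"
  have nth: "L n ! k = y k" if "k < n" for n k
    using that
  proof (induction n)
    case (Suc n)
    obtain m where m: "L (Suc n) = L n @ [m]"
      using L(3) by (rule exE)
    show ?case
    proof (cases "k = n")
      case False
      then have "k < n"
        using Suc.prems by simp
      then show ?thesis
        using Suc.IH L(2)[of n] unfolding m by (simp add: nth_append)
    qed (simp add: y_def)
  qed simp
  have bound: "norm (x (y k)) \<le> M + 2" for k
  proof -
    have "y k \<in> set (L (Suc k))"
      unfolding y_def using L(2)[of "Suc k"] by (intro nth_mem) simp
    then show ?thesis
      using L(1)[of "Suc k"] unfolding independent_def by blast
  qed
  have indep: "\<exists>f\<in>dual_space sc. norm f \<le> r \<and>
      (\<forall>k<n. norm (blinfun_apply f (x (y k)) - (if k \<in> \<sigma> then q else p)) \<le> 2 * \<eta>)" for n \<sigma>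
  proof -
    obtain f where f: "f \<in> S" "\<forall>k<length (L n). norm (ev f (L n ! k) - (if k \<in> \<sigma> then q else p)) < 2 * \<eta>"
      using L(1)[of n] unfolding independent_def by blast
    have "norm (blinfun_apply f (x (y k)) - (if k \<in> \<sigma> then q else p)) \<le> 2 * \<eta>" if "k < n" for k
    proof -
      have "k < length (L n)"
        using that L(2)[of n] by simp
      then have "norm (ev f (L n ! k) - (if k \<in> \<sigma> then q else p)) < 2 * \<eta>"
        by (rule f(2)[rule_format])
      then show ?thesis
        unfolding nth[OF that] ev_def by (rule less_imp_le)
    qed
    then show ?thesis
      using f(1) S(1) S(2)[OF f(1)] by (intro bexI[of _ f]) auto
  qed
  have "d - \<eta> - c \<le> re_part (q - p)"
    using V(2) p by (simp add: re_part_diff)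
  also have "\<dots> \<le> norm (q - p)"
    by (rule re_part_le_norm)
  finally have "0 < norm (q - p) / 2 - 2 * (2 * \<eta>)"
    using \<eta>(2) by simp
  then have "0 < (norm (q - p) / 2 - 2 * (2 * \<eta>)) / (2 * r)"
    using r by simp
  then show ?thesis
    by (rule contains_l1I[OF sc _ bound]) (rule independent_sequence_lower_bound[OF r indep])
qed

end

theorem halfspace_coverable_no_l1:
  fixes sc :: "'k::real_or_complex \<Rightarrow> 'a::banach \<Rightarrow> 'a"
  assumes sc: "banach_over sc" and sep: "separable_space (euclidean :: 'a topology)"
    and nol1: "\<not> contains_l1 sc" and \<phi>: "\<phi> \<in> bidual_space sc" and cd: "c < d"
  shows "weak_star_coverable sc \<phi> d (halfspace sc \<phi> c)"
proof (rule ccontr)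
  assume contr: "\<not> ?thesis"
  obtain M where M: "0 < M" "\<And>f. norm (\<phi> f) \<le> M * norm f"
    by (rule bidual_bound[OF \<phi>]) (rule that)
  define \<eta> where "\<eta> = (d - c) / 10"
  have \<eta>: "0 < \<eta>" "9 * \<eta> < d - c"
    using cd by (simp_all add: \<eta>_def)
  obtain D :: "'a set" where D: "countable D" "\<And>x e. 0 < e \<Longrightarrow> \<exists>y\<in>D. dist y x < e"
    by (rule separable_dense_sequence[OF sep]) (rule that)
  have "D \<noteq> {}"
    using D(2)[of 1 0] by auto
  define x where "x = from_nat_into D"
  have range_x: "range x = D"
    unfolding x_def by (rule range_from_nat_into[OF \<open>D \<noteq> {}\<close> D(1)])
  \<comment> \<open>Uncoverability passes to a part on which both \<open>f\<close> and \<open>\<phi> f\<close> are confined.\<close>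
  define S0 where "S0 = (\<lambda>n::nat. {f \<in> dual_space sc. re_part (\<phi> f) \<le> c \<and> norm f \<le> real (Suc n)})"
  have "\<exists>n. \<not> weak_star_coverable sc \<phi> d (S0 n)"
  proof (rule ccontr)
    assume "\<not> (\<exists>n. \<not> weak_star_coverable sc \<phi> d (S0 n))"
    then have "weak_star_coverable sc \<phi> d (\<Union>(range S0))"
      by (intro weak_star_coverable_Union) auto
    moreover have "halfspace sc \<phi> c \<subseteq> \<Union>(range S0)"
    proof
      fix f assume f: "f \<in> halfspace sc \<phi> c"
      obtain n :: nat where "norm f \<le> real n"
        using real_arch_simple by blast
      then have "f \<in> S0 n"
        using f unfolding S0_def by simp
      then show "f \<in> \<Union>(range S0)"
        by blast
    qed
    ultimately show False
      using contr weak_star_coverable_mono by blast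
  qed
  then obtain n where n: "\<not> weak_star_coverable sc \<phi> d (S0 n)"
    by (rule exE)
  define r where "r = real (Suc n)"
  define K where "K = {z :: 'k. norm z \<le> M * r} \<inter> {z. re_part z \<le> c}"
  have "closed K"
    unfolding K_def by (intro closed_Int closed_norm_le closed_re_part_le)
  moreover have "norm z \<le> M * r" if "z \<in> K" for z
    using that unfolding K_def by blast
  ultimately obtain P where P: "finite P" "P \<subseteq> K" "K \<subseteq> (\<Union>p\<in>P. ball p \<eta>)"
    by (rule finite_net[OF _ _ \<eta>(1)]) assumption
  define S1 where "S1 = (\<lambda>p. {f \<in> S0 n. norm (\<phi> f - p) < \<eta>})"
  have "\<exists>p\<in>P. \<not> weak_star_coverable sc \<phi> d (S1 p)"
  proof (rule ccontr)
    assume "\<not> (\<exists>p\<in>P. \<not> weak_star_coverable sc \<phi> d (S1 p))"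
    then have "weak_star_coverable sc \<phi> d (\<Union>(S1 ` P))"
      using P(1) by (intro weak_star_coverable_Union) (auto intro: countable_finite)
    moreover have "S0 n \<subseteq> \<Union>(S1 ` P)"
    proof
      fix f assume f: "f \<in> S0 n"
      have "norm f \<le> r"
        using f by (simp add: S0_def r_def)
      then have "M * norm f \<le> M * r"
        using M(1) by (intro mult_left_mono) simp_all
      then have "norm (\<phi> f) \<le> M * r"
        using M(2)[of f] by linarith
      then have "\<phi> f \<in> K"
        using f by (simp add: K_def S0_def)
      then have "\<phi> f \<in> (\<Union>p\<in>P. ball p \<eta>)"
        by (rule subsetD[OF P(3)])
      then obtain p where "p \<in> P" "norm (\<phi> f - p) < \<eta>"
        by (elim UN_E) (simp add: dist_norm norm_minus_commute)
      with f show "f \<in> \<Union>(S1 ` P)"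
        unfolding S1_def by blast
    qed
    ultimately show False
      using n weak_star_coverable_mono by blast
  qed
  then obtain p where p: "p \<in> P" "\<not> weak_star_coverable sc \<phi> d (S1 p)"
    by (rule bexE)
  have "re_part p \<le> c"
    using P(2) p(1) unfolding K_def by blast
  define e where "e = (\<lambda>f n. blinfun_apply f (x n) :: 'k)"
  define \<V> where "\<V> = {U. open U \<and> weak_star_coverable sc \<phi> d (S1 p \<inter> e -` U)}"
  obtain \<V>' where \<V>': "\<V>' \<subseteq> \<V>" "countable \<V>'" "\<Union>\<V>' = \<Union>\<V>"
    by (rule Lindelof[of \<V>]) (auto simp: \<V>_def)
  have removed: "weak_star_coverable sc \<phi> d (\<Union>((\<lambda>U. S1 p \<inter> e -` U) ` \<V>'))"
    using \<V>'(1,2) by (intro weak_star_coverable_Union) (auto simp: \<V>_def)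
  define S where "S = S1 p - e -` \<Union>\<V>"
  have uncov: "\<not> weak_star_coverable sc \<phi> d (S \<inter> e -` U)" if U: "open U" "S \<inter> e -` U \<noteq> {}" for U
  proof
    assume "weak_star_coverable sc \<phi> d (S \<inter> e -` U)"
    then have "weak_star_coverable sc \<phi> d (S \<inter> e -` U \<union> \<Union>((\<lambda>U. S1 p \<inter> e -` U) ` \<V>'))"
      by (rule weak_star_coverable_Un[OF _ removed])
    moreover have "S1 p \<inter> e -` U \<subseteq> S \<inter> e -` U \<union> \<Union>((\<lambda>U. S1 p \<inter> e -` U) ` \<V>')"
      unfolding S_def \<V>'(3)[symmetric] by blast
    ultimately have "weak_star_coverable sc \<phi> d (S1 p \<inter> e -` U)"
      by (rule weak_star_coverable_mono)
    then have "U \<in> \<V>"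
      using U(1) by (simp add: \<V>_def)
    then show False
      using U(2) unfolding S_def by blast
  qed
  have nonempty: "S \<noteq> {}"
  proof
    assume "S = {}"
    then have "S1 p \<subseteq> \<Union>((\<lambda>U. S1 p \<inter> e -` U) ` \<V>')"
      unfolding S_def \<V>'(3)[symmetric] by blast
    then show False
      using p(2) weak_star_coverable_mono[OF removed] by blast
  qed
  have "uncoverable sc \<phi> c d M \<eta> r p x S"
  proof
    show "\<exists>z\<in>range x. dist z y < e" if "0 < e" for y e
      unfolding range_x by (rule D(2)[OF that])
    show "\<not> weak_star_coverable sc \<phi> d (S \<inter> (\<lambda>f n. blinfun_apply f (x n)) -` U)"
      if "open U" "S \<inter> (\<lambda>f n. blinfun_apply f (x n)) -` U \<noteq> {}" for U
      using uncov[of U] that unfolding e_def by blast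
  qed (use sc \<phi> M \<eta> \<open>re_part p \<le> c\<close> nonempty in \<open>auto simp: r_def S_def S1_def S0_def\<close>)
  then have "contains_l1 sc"
    by (rule uncoverable.contains_l1)
  with nol1 show False
    by blast
qed

text \<open>
  A halfspace that separates a point from \<open>A\<close> leaves room for a second, larger one; a cover of the first
  by sets with weak-star closed convex hulls in the second excludes the point from \<open>I_env A\<close>.
\<close>

lemma I_env_no_l1:
  fixes sc :: "'k::real_or_complex \<Rightarrow> 'a::banach \<Rightarrow> 'a"
  assumes sc: "banach_over sc" and sep: "separable_space (euclidean :: 'a topology)"
    and nol1: "\<not> contains_l1 sc" and A: "A \<subseteq> dual_space sc"
  shows "I_env sc A \<subseteq> closure (convex hull A)"
proof
  fix f assume f: "f \<in> I_env sc A"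
  have fd: "f \<in> dual_space sc"
    using f I_env_subset_weak_star_hull[OF A] weak_star_closure_subset_dual by blast
  show "f \<in> closure (convex hull A)"
  proof (rule ccontr)
    assume "\<not> ?thesis"
    then obtain \<phi> e where \<phi>: "\<phi> \<in> bidual_space sc" and e: "0 < e"
      and sepd: "\<And>g. g \<in> convex hull A \<inter> dual_space sc \<Longrightarrow> f \<in> dual_space sc \<Longrightarrow> re_part (\<phi> g) \<le> re_part (\<phi> f) - e"
      by (rule bidual_separation[OF convex_convex_hull]) (rule that)
    let ?c = "re_part (\<phi> f) - e" and ?d = "re_part (\<phi> f) - e / 2"
    have Ac: "A \<subseteq> halfspace sc \<phi> ?c"
    proof
      fix g assume g: "g \<in> A"
      then have "g \<in> dual_space sc"
        using A by blast
      moreover from this have "re_part (\<phi> g) \<le> ?c"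
        using g by (intro sepd fd) (simp add: hull_inc)
      ultimately show "g \<in> halfspace sc \<phi> ?c"
        by blast
    qed
    have "?c < ?d"
      using e by simp
    then have "weak_star_coverable sc \<phi> ?d (halfspace sc \<phi> ?c)"
      by (rule halfspace_coverable_no_l1[OF sc sep nol1 \<phi>])
    then obtain \<E> where \<E>: "countable \<E>" "halfspace sc \<phi> ?c \<subseteq> \<Union>\<E>"
      "\<forall>E\<in>\<E>. \<forall>g\<in>weak_star_hull sc E. re_part (\<phi> g) \<le> ?d"
      unfolding weak_star_coverable_def by (elim exE conjE)
    define \<D> where "\<D> = (\<lambda>E. A \<inter> E) ` \<E>"
    let ?H = "halfspace sc \<phi> ?d"
    have "countable \<D>"
      unfolding \<D>_def using \<E>(1) by (rule countable_image)
    moreover have "A = \<Union>\<D>"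
    proof -
      have "A \<subseteq> \<Union>\<E>"
        by (rule subset_trans[OF Ac \<E>(2)])
      then show ?thesis
        unfolding \<D>_def by blast
    qed
    ultimately have "f \<in> closure (convex hull (\<Union>D\<in>\<D>. weak_star_hull sc D))"
      by (rule I_env_memD[OF f])
    moreover have "(\<Union>D\<in>\<D>. weak_star_hull sc D) \<subseteq> ?H"
    proof
      fix g assume "g \<in> (\<Union>D\<in>\<D>. weak_star_hull sc D)"
      then obtain E where E: "E \<in> \<E>" "g \<in> weak_star_hull sc (A \<inter> E)"
        unfolding \<D>_def by blast
      have "weak_star_hull sc (A \<inter> E) \<subseteq> weak_star_hull sc E"
        by (intro closure_of_mono hull_mono Int_lower2)
      then have "re_part (\<phi> g) \<le> ?d"
        using E \<E>(3) by blast
      moreover have "g \<in> dual_space sc"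
        using E(2) weak_star_closure_subset_dual by blast
      ultimately show "g \<in> ?H"
        by blast
    qed
    then have "convex hull (\<Union>D\<in>\<D>. weak_star_hull sc D) \<subseteq> ?H"
      by (simp add: hull_minimal convex_halfspace[OF \<phi>])
    then have "closure (convex hull (\<Union>D\<in>\<D>. weak_star_hull sc D)) \<subseteq> ?H"
      by (rule closure_minimal[OF _ closed_halfspace[OF \<phi>]])
    ultimately have "f \<in> ?H"
      by (rule rev_subsetD)
    with e show False
      by simp
  qed
qed

section \<open>The comparison theorem\<close>

theorem proposition4p4:
  fixes sc :: "'k::real_or_complex \<Rightarrow> 'a::banach \<Rightarrow> 'a"
    and A :: "('a \<Rightarrow>\<^sub>L 'k) set"
  assumes "banach_over sc" and "A \<subseteq> dual_space sc"
  shows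
    "( I_cl sc A = I_ccl sc A \<and>
       I_ccl sc A \<subseteq> I_ww sc A \<and>
       I_ww sc A \<subseteq> cl_IF sc A \<and>
       cl_IF sc A \<subseteq> I_env sc A \<inter> (weak_star sc closure_of A) \<and>
       I_env sc A \<inter> (weak_star sc closure_of A) \<subseteq> weak_star sc closure_of A \<and>
       closure A \<subseteq> I_mn sc A \<and>
       I_mn sc A \<subseteq> I_cl sc A \<and>
       closure A \<subseteq> cl_IC sc A \<and>
       cl_IC sc A \<subseteq> I_ccl sc A \<and>
       closure A \<subseteq> mackey sc (C_set sc) closure_of A \<and>
       mackey sc (C_set sc) closure_of A \<subseteq> I_bcl sc A \<and>
       I_bcl sc A \<subseteq> I_cbcl sc A \<and>
       I_cbcl sc A \<subseteq> sigma_dual sc (B1_set sc) closure_of A \<and>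
       sigma_dual sc (B1_set sc) closure_of A \<subseteq> weak_star sc closure_of A )
     \<and>
     ( separable_space (subtopology euclidean A) \<longrightarrow>
         I_ccl sc A = closure A \<and>
         I_ww sc A = cl_IF sc A \<and>
         cl_IF sc A = weak sc closure_of A \<and>
         I_env sc A = closure (convex hull A) )
     \<and>
     ( separable_space (euclidean :: 'a topology) \<longrightarrow>
         closure A = mackey sc (C_set sc) closure_of A \<and>
         I_bcl sc A \<subseteq> I_mn sc A \<and>
         I_cbcl sc A \<subseteq> I_ww sc A )
     \<and>
     ( separable_space (euclidean :: 'a topology) \<and> \<not> contains_l1 sc \<longrightarrow>
         I_env sc A = closure (convex hull A) \<and>
         I_cbcl sc A = I_ww sc A \<and>
         I_ww sc A = cl_IF sc A \<and>
         cl_IF sc A = weak sc closure_of A )"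
proof (intro conjI impI)
  have A: "A \<subseteq> dual_space sc" and sc: "banach_over sc"
    using assms by blast+
  show "I_cl sc A = I_ccl sc A"
    by (rule antisym[OF I_cl_subset_I_ccl I_ccl_subset_I_cl[OF sc A]])
  show "I_ccl sc A \<subseteq> I_ww sc A"
    by (rule I_ccl_subset_I_ww)
  show ww_IF: "I_ww sc A \<subseteq> cl_IF sc A"
    by (rule I_ww_subset_cl_IF)
  show "cl_IF sc A \<subseteq> I_env sc A \<inter> (weak_star sc closure_of A)"
    by (rule Int_greatest[OF cl_IF_subset_I_env cl_IF_subset_weak_star_closure[OF A]])
  show "I_env sc A \<inter> (weak_star sc closure_of A) \<subseteq> weak_star sc closure_of A"
    by (rule Int_lower2)
  show "closure A \<subseteq> I_mn sc A"
    by (rule closure_subset_I_mn[OF A])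
  show "I_mn sc A \<subseteq> I_cl sc A"
    by (rule I_mn_subset_I_cl)
  show cl_IC: "closure A \<subseteq> cl_IC sc A"
    by (rule closure_subset_cl_IC[OF A])
  show IC_ccl: "cl_IC sc A \<subseteq> I_ccl sc A"
    by (rule cl_IC_subset_I_ccl[OF A])
  show cl_mackey: "closure A \<subseteq> mackey sc (C_set sc) closure_of A"
    by (rule closure_subset_mackey_closure[OF C_subset_bidual A])
  show "mackey sc (C_set sc) closure_of A \<subseteq> I_bcl sc A"
    by (rule mackey_closure_subset_I_bcl[OF A])
  show "I_bcl sc A \<subseteq> I_cbcl sc A"
    by (rule I_bcl_subset_I_cbcl)
  show "I_cbcl sc A \<subseteq> sigma_dual sc (B1_set sc) closure_of A"
    by (rule I_cbcl_subset_B1_closure[OF A])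
  show "sigma_dual sc (B1_set sc) closure_of A \<subseteq> weak_star sc closure_of A"
    by (rule B1_closure_subset_weak_star_closure)
  have weak_ww: "weak sc closure_of A \<subseteq> I_ww sc A"
    by (rule weak_closure_subset_I_ww[OF A])
  {
    assume sep: "separable_space (subtopology euclidean A)"
    show "I_ccl sc A = closure A"
      by (rule antisym[OF I_ccl_norm_separable[OF sc A sep] order_trans[OF cl_IC IC_ccl]])
    have IF_weak: "cl_IF sc A \<subseteq> weak sc closure_of A"
      by (rule cl_IF_subset_weak_closure[OF A I_env_norm_separable[OF sc A sep]])
    show "I_ww sc A = cl_IF sc A"
      by (rule antisym[OF ww_IF order_trans[OF IF_weak weak_ww]])
    show "cl_IF sc A = weak sc closure_of A"
      by (rule antisym[OF IF_weak order_trans[OF weak_ww ww_IF]])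
    show "I_env sc A = closure (convex hull A)"
      by (rule antisym[OF I_env_norm_separable[OF sc A sep subset_refl] closure_hull_subset_I_env[OF A]])
  }
  {
    assume sep: "separable_space (euclidean :: 'a topology)"
    show "closure A = mackey sc (C_set sc) closure_of A"
      by (rule antisym[OF cl_mackey mackey_C_closure_separable[OF sc sep]])
    show "I_bcl sc A \<subseteq> I_mn sc A"
      by (rule I_bcl_subset_I_mn_separable[OF sc sep])
    show "I_cbcl sc A \<subseteq> I_ww sc A"
      by (rule I_cbcl_subset_I_ww_separable[OF sc sep])
  }
  {
    assume *: "separable_space (euclidean :: 'a topology) \<and> \<not> contains_l1 sc"
    then have sep: "separable_space (euclidean :: 'a topology)" and nol1: "\<not> contains_l1 sc"
      by (rule conjunct1, rule conjunct2)
    have env: "I_env sc B \<subseteq> closure (convex hull B)" if "B \<subseteq> A" for B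
      by (rule I_env_no_l1[OF sc sep nol1 subset_trans[OF that A]])
    show "I_env sc A = closure (convex hull A)"
      by (rule antisym[OF env[OF subset_refl] closure_hull_subset_I_env[OF A]])
    have IF_weak: "cl_IF sc A \<subseteq> weak sc closure_of A"
      by (rule cl_IF_subset_weak_closure[OF A env])
    have cbcl_ww: "I_cbcl sc A \<subseteq> I_ww sc A"
      by (rule I_cbcl_subset_I_ww_separable[OF sc sep])
    show "I_cbcl sc A = I_ww sc A"
      by (rule antisym[OF cbcl_ww order_trans[OF order_trans[OF ww_IF IF_weak] weak_closure_subset_I_cbcl[OF A]]])
    show "I_ww sc A = cl_IF sc A"
      by (rule antisym[OF ww_IF order_trans[OF IF_weak weak_ww]])
    show "cl_IF sc A = weak sc closure_of A"
      by (rule antisym[OF IF_weak order_trans[OF weak_ww ww_IF]])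
  }
qed

end
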